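(* Let $\mu,\nu,\sigma\in\mathbb{C}$ with $\sigma\neq 0$, and let $f(z)$ be a solution of $$f''+(e^{2z}-\nu^2)f=\sigma e^{(\mu+1)z},$$ written in the form $$f(z)=AJ_\nu(e^z)+BY_\nu(e^z)+\sigma S_{\mu,\nu}(e^z),\qquad A,B\in\mathbb{C},$$ where $S_{\mu,\nu}$ is the Lommel function. Then $\lambda(f)<+\infty$ if and only if $A=B=0$ and either $\mu+\nu=2p+1$ or $\mu-\nu=2p+1$ for a non-negative integer $p$ and $$S_{\mu,\nu}(\zeta)=\zeta^{\mu-1}\left[\sum_{k=0}^{p}\frac{(-1)^kc_k}{\zeta^{2k}}\right],$$ where $c_0=1$ and $c_k=\prod_{m=1}^{k}[(\mu-2m+1)^2-\nu^2]$ for $1\le k\le p$.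
   Context: For an entire function $f\not\equiv0$, $\lambda(f)=\limsup_{r\to+\infty}\frac{\log n(r,1/f)}{\log r}$ is the exponent of convergence of zeros, where $n(r,1/f)$ is the number of zeros of $f$ in $|z|\le r$ counted with multiplicity ($\lambda(f)=0$ if $f$ has finitely many zeros). $J_\nu,Y_\nu$ are the Bessel functions of the first and second kinds. Lommel function: if neither $\mu+\nu$ nor $\mu-\nu$ is an odd negative integer, put $$s_{\mu,\nu}(\zeta)=\zeta^{\mu+1}\sum_{k\ge0}\frac{(-1)^k\zeta^{2k}}{\prod_{m=0}^{k}[(\mu+2m+1)^2-\nu^2]},$$ $$S_{\mu,\nu}(\zeta)=s_{\mu,\nu}(\zeta)+2^{\mu-1}\Gamma\!\left(\tfrac{\mu+\nu+1}{2}\right)\Gamma\!\left(\tfrac{\mu-\nu+1}{2}\right)\left[\sin\!\left(\tfrac{(\mu-\nu)\pi}{2}\right)J_\nu(\zeta)-\cos\!\left(\tfrac{(\mu-\nu)\pi}{2}\right)Y_\nu(\zeta)\right];$$ for the remaining $(\mu,\nu)$, $S_{\mu,\nu}$ is defined as the limit of this expression in the parameters. It is analytic on the Riemann surface of $\log\zeta$ (principal branch $|\arg\zeta|<\pi$) and is a particular solution of $\zeta^2y''+\zeta y'+(\zeta^2-\nu^2)y=\zeta^{\mu+1}$. The functions $J_\nu(e^z),Y_\nu(e^z),S_{\mu,\nu}(e^z)$ denote the entire functions of $z$ obtained by evaluating at the point of the Riemann surface with $\log\zeta=z$. All solutions of the differential equation are entire, and every solution has the displayed form. *)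

theory Defs
  imports "HOL-Complex_Analysis.Complex_Analysis"
begin

text \<open>
  A point \<open>\<zeta>\<close> of the Riemann surface of the logarithm is represented by \<open>w = log \<zeta>\<close>, an arbitrary
  complex number. The functions \<open>bessel_J\<close>, \<open>bessel_Y\<close>, \<open>lommel_s\<close> and \<open>lommel_S\<close> take \<open>w\<close> as their
  last argument, so that \<open>bessel_J \<nu> w\<close> is $J_\nu(e^w)$ etc.; the power $\zeta^a$
  is \<open>exp (a * w)\<close>, and integer powers of \<open>\<zeta>\<close> are integer powers of \<open>exp w\<close>.
\<close>

text \<open>The library function \<open>rGamma\<close> is the entire function $1/\Gamma$, vanishing at the poles of $\Gamma$.\<close>

definition bessel_J :: "complex \<Rightarrow> complex \<Rightarrow> complex" where
  "bessel_J \<nu> w = exp (\<nu> * (w - of_real (ln 2))) *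
     (\<Sum>k. (-1) ^ k * rGamma (\<nu> + of_nat k + 1) / fact k * (exp w / 2) ^ (2 * k))"

definition bessel_Y_nonint :: "complex \<Rightarrow> complex \<Rightarrow> complex" where
  "bessel_Y_nonint \<nu> w =
     (bessel_J \<nu> w * cos (\<nu> * of_real pi) - bessel_J (-\<nu>) w) / sin (\<nu> * of_real pi)"

definition bessel_Y :: "complex \<Rightarrow> complex \<Rightarrow> complex" where
  "bessel_Y \<nu> w =
     (if \<nu> \<in> \<int> then Lim (at \<nu>) (\<lambda>n. bessel_Y_nonint n w) else bessel_Y_nonint \<nu> w)"

definition lommel_regular :: "(complex \<times> complex) set" where
  "lommel_regular = {(\<mu>, \<nu>). \<forall>j::nat. \<mu> + \<nu> \<noteq> - of_nat (2 * j + 1) \<and> \<mu> - \<nu> \<noteq> - of_nat (2 * j + 1)}"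

definition lommel_s :: "complex \<Rightarrow> complex \<Rightarrow> complex \<Rightarrow> complex" where
  "lommel_s \<mu> \<nu> w = exp ((\<mu> + 1) * w) *
     (\<Sum>k. (-1) ^ k * exp w ^ (2 * k) / (\<Prod>m\<le>k. ((\<mu> + 2 * of_nat m + 1)\<^sup>2 - \<nu>\<^sup>2)))"

definition lommel_S_regular :: "complex \<Rightarrow> complex \<Rightarrow> complex \<Rightarrow> complex" where
  "lommel_S_regular \<mu> \<nu> w = lommel_s \<mu> \<nu> w +
     2 powr (\<mu> - 1) * Gamma ((\<mu> + \<nu> + 1) / 2) * Gamma ((\<mu> - \<nu> + 1) / 2) *
       (sin ((\<mu> - \<nu>) * of_real pi / 2) * bessel_J \<nu> w
        - cos ((\<mu> - \<nu>) * of_real pi / 2) * bessel_Y \<nu> w)"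

text \<open>For the exceptional parameters, both parameters vary in the limit, through regular pairs.\<close>

definition lommel_S :: "complex \<Rightarrow> complex \<Rightarrow> complex \<Rightarrow> complex" where
  "lommel_S \<mu> \<nu> w =
     (if (\<mu>, \<nu>) \<in> lommel_regular then lommel_S_regular \<mu> \<nu> w
      else Lim (at (\<mu>, \<nu>) within lommel_regular) (\<lambda>(m, n). lommel_S_regular m n w))"

definition lommel_coeff :: "complex \<Rightarrow> complex \<Rightarrow> nat \<Rightarrow> complex" where
  "lommel_coeff \<mu> \<nu> k = (\<Prod>m=1..k. ((\<mu> - 2 * of_nat m + 1)\<^sup>2 - \<nu>\<^sup>2))"

text \<open>
  The next two definitions are meant for entire functions that do not vanish identically; then the
  sum is finite, and \<open>zorder f z\<close> is the multiplicity of the zero \<open>z\<close>.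
\<close>

definition zero_count :: "(complex \<Rightarrow> complex) \<Rightarrow> real \<Rightarrow> int" where
  "zero_count f r = (\<Sum>z | norm z \<le> r \<and> f z = 0. zorder f z)"

definition conv_exponent :: "(complex \<Rightarrow> complex) \<Rightarrow> ereal" where
  "conv_exponent f =
     (if finite {z. f z = 0} then 0
      else Limsup at_top (\<lambda>r::real. ereal (ln (real_of_int (zero_count f r)) / ln r)))"

end

theory Submission
  imports Defs
begin

text \<open>
  In the variable \<open>\<zeta> = e\<^sup>z\<close> the function \<open>\<phi>(\<zeta>) = \<zeta>\<^bsup>1/2\<^esup> f(log \<zeta>)\<close> solves a perturbation of \<open>\<phi>'' + \<phi> = 0\<close>.
  If \<open>\<lambda>(f)\<close> is finite, there are zero-free discs with radii \<open>m\<close>, far larger than \<open>log R\<close>, about real centres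
  \<open>R\<close> tending to infinity. On these, the \<open>m\<close>-th roots of \<open>\<phi>\<close> are a normal family whose limits have modulus 1, so
  \<open>\<phi>\<close> is subexponential there. This rules out both exponentials \<open>e\<^bsup>i\<zeta>\<^esup>\<close>, \<open>e\<^bsup>-i\<zeta>\<^esup>\<close> in the asymptotics of \<open>\<phi>\<close>, and \<open>f\<close> is asymptotic to
  the formal solution in powers of \<open>\<zeta>\<close>, which is unique. The same holds for \<open>f(z + \<pi>i)\<close>; hence
  \<open>f(z + \<pi>i) = e\<^bsup>(\<mu>+1)\<pi>i\<^esup> f(z)\<close>, so \<open>f(z) e\<^bsup>-(\<mu>-1)z\<^esup>\<close> is a function of \<open>\<zeta>\<^sup>2\<close>, and its growth at \<open>0\<close> and \<open>\<infinity>\<close>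
  makes it a Laurent polynomial. Comparing coefficients gives \<open>\<mu> + \<nu> = 2p + 1\<close> or \<open>\<mu> - \<nu> = 2p + 1\<close>
  and \<open>f/\<sigma>\<close> explicitly. For such parameters \<open>S\<^bsub>\<mu>,\<nu>\<^esub>\<close> is the same finite sum: the infinite tail of the Bessel series
  cancels \<open>s\<^bsub>\<mu>,\<nu>\<^esub>\<close>. Thus \<open>A J\<^sub>\<nu> + B Y\<^sub>\<nu> = 0\<close> and \<open>A = B = 0\<close>. Conversely, the zeros of the finite sum lie
  on finitely many translates of \<open>\<pi>i\<int>\<close>.
\<close>

section \<open>Solutions on the slit plane with integrable inhomogeneity\<close>

text \<open>The normal family has to be built from \<open>f\<close>, whose zeros are controlled and
  whose inhomogeneity is nonzero, while the decay argument requires an inhomogeneity O(\<zeta>^-2).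
  Hence a finite part of the formal solution is subtracted; being of power growth, it does not spoil
  the estimates on the discs. It depends on the equation alone, so it cancels from the difference of
  \<open>f\<close> and its normalised translate. Polynomially many zeros in z leave discs of radius
  m of order R / (log R)^K in \<zeta>, so powers of R are e^(o(m)). At R + i m/2 and R - i m/2 one
  exponential has modulus e^(m/2), which a bound of order e^(m/8) excludes. For S the coordinates a
  = (\<mu> + \<nu> + 1) / 2 and b = (\<mu> - \<nu> + 1) / 2 are used. The hard case is a = p + 1, b
  = -j: the regular formula has the form infinity times zero, and S is a limit in two variables,
  which separate continuity does not determine.\<close>

lemma exp_bound_of_deriv_le:
  fixes E E' k k' :: "real \<Rightarrow> real"
  assumes "a \<le> b"
    and E: "\<And>t. a \<le> t \<Longrightarrow> t \<le> b \<Longrightarrow> (E has_real_derivative E' t) (at t)"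
    and k: "\<And>t. a \<le> t \<Longrightarrow> t \<le> b \<Longrightarrow> (k has_real_derivative k' t) (at t)"
    and le: "\<And>t. a \<le> t \<Longrightarrow> t \<le> b \<Longrightarrow> E' t \<le> k' t * E t"
  shows "E b \<le> E a * exp (k b - k a)"
proof -
  have "E b * exp (- k b) \<le> E a * exp (- k a)"
  proof (rule DERIV_nonpos_imp_nonincreasing[OF \<open>a \<le> b\<close>])
    fix t assume t: "a \<le> t" "t \<le> b"
    have "((\<lambda>t. E t * exp (- k t)) has_real_derivative
            E' t * exp (- k t) + exp (- k t) * (- k' t) * E t) (at t)"
      by (rule DERIV_mult[OF E[OF t] DERIV_fun_exp[OF DERIV_minus[OF k[OF t]]]])
    moreover have "E' t * exp (- k t) + exp (- k t) * (- k' t) * E t = (E' t - k' t * E t) * exp (- k t)"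
      by (simp add: algebra_simps)
    moreover have "\<dots> \<le> 0"
      using le[OF t] by (simp add: mult_nonpos_nonneg)
    ultimately show "\<exists>y. ((\<lambda>t. E t * exp (- k t)) has_real_derivative y) (at t) \<and> y \<le> 0"
      by metis
  qed
  then have "E b * exp (- k b) * exp (k b) \<le> E a * exp (- k a) * exp (k b)"
    by (rule mult_right_mono) simp
  then show ?thesis
    by (simp add: exp_diff exp_minus field_simps)
qed

text \<open>Gronwall's inequality run backwards, by reflection. It carries a bound from the right
  end of an interval to the left end: from infinity on the real axis, and from Re z = 0 towards
  decreasing Re z.\<close>

lemma exp_bound_of_deriv_ge:
  fixes E E' k k' :: "real \<Rightarrow> real"
  assumes "a \<le> b"
    and E: "\<And>t. a \<le> t \<Longrightarrow> t \<le> b \<Longrightarrow> (E has_real_derivative E' t) (at t)"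
    and k: "\<And>t. a \<le> t \<Longrightarrow> t \<le> b \<Longrightarrow> (k has_real_derivative k' t) (at t)"
    and ge: "\<And>t. a \<le> t \<Longrightarrow> t \<le> b \<Longrightarrow> - (k' t * E t) \<le> E' t"
  shows "E a \<le> E b * exp (k b - k a)"
proof -
  have "E (- (- a)) \<le> E (- (- b)) * exp ((- k (- (- a))) - (- k (- (- b))))"
  proof (rule exp_bound_of_deriv_le[where E = "\<lambda>t. E (- t)" and k = "\<lambda>t. - k (- t)"
          and E' = "\<lambda>t. - E' (- t)" and k' = "\<lambda>t. k' (- t)"])
    fix t assume t: "- b \<le> t" "t \<le> - a"
    have neg: "(uminus has_real_derivative - 1) (at t)"
      by (auto intro!: derivative_eq_intros)
    show "((\<lambda>t. E (- t)) has_real_derivative - E' (- t)) (at t)"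
      using DERIV_chain2[OF E neg] t by simp
    show "((\<lambda>t. - k (- t)) has_real_derivative k' (- t)) (at t)"
      using DERIV_minus[OF DERIV_chain2[OF k neg]] t by simp
    show "- E' (- t) \<le> k' (- t) * E (- t)"
      using ge[of "- t"] t by auto
  qed (use assms in auto)
  then show ?thesis
    by simp
qed

lemma has_real_derivative_cmod_sq:
  fixes u :: "real \<Rightarrow> complex"
  assumes "(u has_vector_derivative u') (at t)"
  shows "((\<lambda>t. (cmod (u t))\<^sup>2) has_real_derivative 2 * Re (cnj (u t) * u')) (at t)"
proof -
  have "((\<lambda>t. u t \<bullet> u t) has_derivative (\<lambda>h. u t \<bullet> (h *\<^sub>R u') + (h *\<^sub>R u') \<bullet> u t)) (at t)"
    using assms unfolding has_vector_derivative_def by (intro has_derivative_inner)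
  moreover have "(\<lambda>h. u t \<bullet> (h *\<^sub>R u') + (h *\<^sub>R u') \<bullet> u t) = (*) (2 * Re (cnj (u t) * u'))"
    by (auto simp: fun_eq_iff inner_complex_def algebra_simps)
  ultimately show ?thesis
    by (simp add: has_field_derivative_def power2_norm_eq_inner)
qed

lemma has_vector_derivative_along_line:
  assumes "(f has_field_derivative f') (at (p + of_real t * d))"
  shows "((\<lambda>t. f (p + of_real t * d)) has_vector_derivative (f' * d)) (at t)"
proof -
  have "((\<lambda>t. p + of_real t * d) has_vector_derivative d) (at t)"
    by (auto intro!: derivative_eq_intros)
  from field_vector_diff_chain_at[OF this assms] show ?thesis
    by (simp add: o_def mult.commute)
qed

text \<open>A mean value inequality with a variable bound: \<open>k\<close> is an explicit primitive
  of a majorant of the derivative.\<close>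

lemma norm_diff_le_of_deriv_le:
  fixes f :: "real \<Rightarrow> complex" and k k' :: "real \<Rightarrow> real"
  assumes "a \<le> b"
    and "\<And>t. a \<le> t \<Longrightarrow> t \<le> b \<Longrightarrow> (f has_vector_derivative f' t) (at t)"
    and "\<And>t. a \<le> t \<Longrightarrow> t \<le> b \<Longrightarrow> (k has_real_derivative k' t) (at t)"
    and "\<And>t. a \<le> t \<Longrightarrow> t \<le> b \<Longrightarrow> norm (f' t) \<le> k' t"
  shows "norm (f b - f a) \<le> k b - k a"
proof (cases "a = b")
  case False
  show ?thesis
  proof (rule differentiable_bound_general[where f' = f' and \<phi>' = k'])
    show "continuous_on {a..b} f"
      using assms(2) has_vector_derivative_continuous continuous_at_imp_continuous_on
      by (metis atLeastAtMost_iff)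
    show "continuous_on {a..b} k"
      using assms(3) DERIV_isCont continuous_at_imp_continuous_on by (metis atLeastAtMost_iff)
  qed (use assms False in \<open>auto simp: has_real_derivative_iff_has_vector_derivative\<close>)
qed auto

text \<open>Regions Re \<zeta> + |Im \<zeta>| >= c suit horizontal lines: they are invariant under
  moving right, and 2 / (t + |\<eta>|)^2 has an elementary primitive there. They also contain all
  \<zeta> with Re \<zeta> >= 0 and |\<zeta>| >= c.\<close>

lemma norm_ge_one_of_sector:
  assumes "2 \<le> Re \<zeta> + \<bar>Im \<zeta>\<bar>"
  shows "1 \<le> norm \<zeta>" "\<zeta> \<notin> \<real>\<^sub>\<le>\<^sub>0" "1 / (norm \<zeta>)\<^sup>2 \<le> 2 / (Re \<zeta> + \<bar>Im \<zeta>\<bar>)\<^sup>2"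
proof -
  define x y where "x = Re \<zeta>" and "y = \<bar>Im \<zeta>\<bar>"
  have n: "(norm \<zeta>)\<^sup>2 = x\<^sup>2 + y\<^sup>2"
    by (simp add: cmod_power2 x_def y_def)
  have "0 \<le> (x - y)\<^sup>2"
    by simp
  then have le: "(x + y)\<^sup>2 \<le> 2 * (norm \<zeta>)\<^sup>2"
    unfolding n by (simp add: power2_eq_square algebra_simps)
  have "2\<^sup>2 \<le> (x + y)\<^sup>2"
    using assms unfolding x_def y_def by (intro power_mono) auto
  with le have "1\<^sup>2 \<le> (norm \<zeta>)\<^sup>2"
    by simp
  then show one: "1 \<le> norm \<zeta>"
    by (rule power2_le_imp_le) simp
  show "\<zeta> \<notin> \<real>\<^sub>\<le>\<^sub>0"
    using assms by (auto simp: complex_nonpos_Reals_iff)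
  show "1 / (norm \<zeta>)\<^sup>2 \<le> 2 / (Re \<zeta> + \<bar>Im \<zeta>\<bar>)\<^sup>2"
    using le one assms unfolding x_def [symmetric] y_def [symmetric]
    by (auto simp: divide_simps zero_less_power2 zero_less_mult_iff)
qed

section \<open>Energy and amplitudes for an integrable perturbation of the equation of e^(i \<zeta>)
  and e^(-i \<zeta>)\<close>

locale slit_solution =
  fixes \<phi> \<phi>' g :: "complex \<Rightarrow> complex" and \<kappa> :: complex and G :: real
  assumes deriv_\<phi>: "\<zeta> \<notin> \<real>\<^sub>\<le>\<^sub>0 \<Longrightarrow> (\<phi> has_field_derivative \<phi>' \<zeta>) (at \<zeta>)"
    and deriv_\<phi>': "\<zeta> \<notin> \<real>\<^sub>\<le>\<^sub>0 \<Longrightarrow> (\<phi>' has_field_derivative (\<kappa> / \<zeta>\<^sup>2 - 1) * \<phi> \<zeta> + g \<zeta>) (at \<zeta>)"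
    and g_bound: "\<zeta> \<notin> \<real>\<^sub>\<le>\<^sub>0 \<Longrightarrow> 1 \<le> norm \<zeta> \<Longrightarrow> norm (g \<zeta>) \<le> G / (norm \<zeta>)\<^sup>2"
begin

lemma G_nonneg: "0 \<le> G"
  using order_trans[OF norm_ge_zero g_bound[of 1]] by simp

text \<open>On the ray in direction \<open>d\<close> the energy \<open>|\<phi>|\<^sup>2 + |\<phi>'|\<^sup>2 + 1\<close> grows at most at the exponential
  rate \<open>|1 - d\<^sup>2| = 2 |Im d|\<close>, up to an integrable perturbation.\<close>

lemma energy_ray:
  assumes d: "norm d = 1" "d \<notin> \<real>\<^sub>\<le>\<^sub>0" and T: "1 \<le> T"
  shows "(norm (\<phi> (T * d)))\<^sup>2 + (norm (\<phi>' (T * d)))\<^sup>2 + 1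
    \<le> ((norm (\<phi> d))\<^sup>2 + (norm (\<phi>' d))\<^sup>2 + 1) * exp (2 * \<bar>Im d\<bar> * T + norm \<kappa> + G)"
proof -
  define u where "u = (\<lambda>t::real. \<phi> (t * d))"
  define v where "v = (\<lambda>t::real. d * \<phi>' (t * d))"
  define v' where "v' = (\<lambda>t::real. d * (((\<kappa> / (t * d)\<^sup>2 - 1) * u t + g (t * d)) * d))"
  define E where "E = (\<lambda>t. (norm (u t))\<^sup>2 + (norm (v t))\<^sup>2 + 1)"
  define k where "k = (\<lambda>t. 2 * \<bar>Im d\<bar> * t - (norm \<kappa> + G) / t)"
  have slit: "of_real t * d \<notin> \<real>\<^sub>\<le>\<^sub>0" if "t \<ge> 1" for t
    using that d by (auto simp: complex_nonpos_Reals_iff mult_le_0_iff)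
  have du: "(u has_vector_derivative v t) (at t)" if "t \<ge> 1" for t
    using has_vector_derivative_along_line[of \<phi> "\<phi>' (t * d)" 0 t d] deriv_\<phi>[OF slit[OF that]]
    by (simp add: u_def v_def mult.commute)
  have dv: "(v has_vector_derivative v' t) (at t)" if "t \<ge> 1" for t
    using has_vector_derivative_mult_right[OF has_vector_derivative_along_line[of \<phi>' _ 0 t d], of _ d]
      deriv_\<phi>'[OF slit[OF that]]
    by (simp add: u_def v_def v'_def)
  have "E T \<le> E 1 * exp (k T - k 1)"
  proof (rule exp_bound_of_deriv_le[where E' = "\<lambda>t. 2 * Re (cnj (u t) * v t) + 2 * Re (cnj (v t) * v' t)"
        and k' = "\<lambda>t. 2 * \<bar>Im d\<bar> + (norm \<kappa> + G) / t\<^sup>2"])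
    fix t :: real assume t: "1 \<le> t" "t \<le> T"
    show "(E has_real_derivative 2 * Re (cnj (u t) * v t) + 2 * Re (cnj (v t) * v' t)) (at t)"
      unfolding E_def
      using DERIV_add[OF DERIV_add[OF has_real_derivative_cmod_sq[OF du[OF t(1)]]
          has_real_derivative_cmod_sq[OF dv[OF t(1)]]] DERIV_const]
      by simp
    show "(k has_real_derivative 2 * \<bar>Im d\<bar> + (norm \<kappa> + G) / t\<^sup>2) (at t)"
      unfolding k_def using t by (auto intro!: derivative_eq_intros simp: power2_eq_square field_simps)
    \<comment> \<open>As d times its conjugate is 1, 1 - d^2 is d times the difference of the
      conjugate and d.\<close>
    have dd: "norm (1 - d\<^sup>2) = 2 * \<bar>Im d\<bar>"
    proof -
      have "d * cnj d = 1"
        using d(1) by (simp add: complex_norm_square [symmetric] flip: of_real_power)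
      then have "1 - d\<^sup>2 = d * (cnj d - d)"
        by (simp add: power2_eq_square algebra_simps)
      also have "norm \<dots> = norm (cnj d - d)"
        using d(1) by (simp add: norm_mult)
      also have "cnj d - d = - (2 * Im d) * \<i>"
        by (auto simp: complex_eq_iff)
      finally show ?thesis
        by (simp add: norm_mult)
    qed
    have d0: "d \<noteq> 0"
      using d by auto
    have td: "norm (t * d) = t"
      using t d by (simp add: norm_mult)
    have "Re (cnj (u t) * v t) = Re (cnj (v t) * u t)"
      by simp
    then have "2 * Re (cnj (u t) * v t) + 2 * Re (cnj (v t) * v' t) = 2 * Re (cnj (v t) * (u t + v' t))"
      by (simp add: distrib_left del: cnj.sel complex_cnj)
    also have "\<dots> \<le> 2 * norm (cnj (v t) * (u t + v' t))"
      by (intro mult_left_mono complex_Re_le_cmod) simp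
    also have "u t + v' t = (1 - d\<^sup>2) * u t + (\<kappa> / t\<^sup>2 * u t + d\<^sup>2 * g (t * d))"
      using t d0 by (simp add: v'_def field_simps power2_eq_square)
    also have "2 * norm (cnj (v t) * ((1 - d\<^sup>2) * u t + (\<kappa> / t\<^sup>2 * u t + d\<^sup>2 * g (t * d))))
        \<le> 2 * (norm (v t) * (2 * \<bar>Im d\<bar> * norm (u t) + (norm \<kappa> / t\<^sup>2 * norm (u t) + G / t\<^sup>2)))"
    proof -
      have "norm (g (t * d)) \<le> G / t\<^sup>2"
        using g_bound[OF slit[OF t(1)]] td t by simp
      then have "norm (d\<^sup>2 * g (t * d)) \<le> G / t\<^sup>2"
        using d by (simp add: norm_mult norm_power)
      moreover have "norm ((1 - d\<^sup>2) * u t) = 2 * \<bar>Im d\<bar> * norm (u t)"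
        using dd by (simp add: norm_mult)
      moreover have "norm (\<kappa> / t\<^sup>2 * u t) = norm \<kappa> / t\<^sup>2 * norm (u t)"
        by (simp add: norm_mult norm_divide norm_power)
      ultimately have "norm ((1 - d\<^sup>2) * u t + (\<kappa> / t\<^sup>2 * u t + d\<^sup>2 * g (t * d)))
          \<le> 2 * \<bar>Im d\<bar> * norm (u t) + (norm \<kappa> / t\<^sup>2 * norm (u t) + G / t\<^sup>2)"
        by (intro order_trans[OF norm_triangle_ineq] add_mono) auto
      then show ?thesis
        by (simp add: norm_mult mult_left_mono)
    qed
    also have "\<dots> = (2 * \<bar>Im d\<bar> + norm \<kappa> / t\<^sup>2) * (2 * norm (u t) * norm (v t)) + G / t\<^sup>2 * (2 * norm (v t))"
      by (simp add: algebra_simps)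
    also have "\<dots> \<le> (2 * \<bar>Im d\<bar> + norm \<kappa> / t\<^sup>2) * E t + G / t\<^sup>2 * E t"
    proof (intro add_mono mult_left_mono)
      show "2 * norm (u t) * norm (v t) \<le> E t"
        using sum_squares_bound[of "norm (u t)" "norm (v t)"] by (simp add: E_def)
      show "2 * norm (v t) \<le> E t"
      proof -
        have "2 * norm (v t) \<le> (norm (v t))\<^sup>2 + 1"
          using sum_squares_bound[of "norm (v t)" 1] by simp
        then show ?thesis
          using zero_le_power2[of "norm (u t)"] unfolding E_def by linarith
      qed
    qed (use G_nonneg in auto)
    finally show "2 * Re (cnj (u t) * v t) + 2 * Re (cnj (v t) * v' t)
        \<le> (2 * \<bar>Im d\<bar> + (norm \<kappa> + G) / t\<^sup>2) * E t"
      by (simp add: algebra_simps add_divide_distrib)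
  qed (use T in auto)
  also have "\<dots> \<le> E 1 * exp (2 * \<bar>Im d\<bar> * T + norm \<kappa> + G)"
  proof (intro mult_left_mono)
    have "0 \<le> (norm \<kappa> + G) / T"
      using G_nonneg T by auto
    then show "exp (k T - k 1) \<le> exp (2 * \<bar>Im d\<bar> * T + norm \<kappa> + G)"
      by (simp add: k_def)
    show "0 \<le> E 1" by (simp add: E_def add_nonneg_nonneg)
  qed
  finally show ?thesis
    using d by (simp add: E_def u_def v_def norm_mult add.assoc)
qed

text \<open>Every point of the sector |arg \<zeta>| <= 3 pi/4 outside the unit disc lies on a ray
  from a compact arc that avoids the slit. The energies on the arc are bounded, and the square root
  of the growth factor exp(2 |Im d| T) of \<open>energy_ray\<close> is exp |Im \<zeta>|.\<close>

lemma exp_Im_bound: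
  obtains C where "0 < C"
    and "\<And>\<zeta>. 1 \<le> norm \<zeta> \<Longrightarrow> 0 \<le> Re \<zeta> + \<bar>Im \<zeta>\<bar> \<Longrightarrow> norm (\<phi> \<zeta>) \<le> C * exp \<bar>Im \<zeta>\<bar>"
    and "\<And>\<zeta>. 1 \<le> norm \<zeta> \<Longrightarrow> 0 \<le> Re \<zeta> + \<bar>Im \<zeta>\<bar> \<Longrightarrow> norm (\<phi>' \<zeta>) \<le> C * exp \<bar>Im \<zeta>\<bar>"
proof -
  define K where "K = sphere (0::complex) 1 \<inter> {\<zeta>. 0 \<le> Re \<zeta> + \<bar>Im \<zeta>\<bar>}"
  have slit: "\<zeta> \<notin> \<real>\<^sub>\<le>\<^sub>0" if "\<zeta> \<in> K" for \<zeta>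
    using that by (auto simp: K_def complex_nonpos_Reals_iff cmod_def)
  have "compact K"
    unfolding K_def by (intro compact_Int_closed compact_sphere closed_Collect_le continuous_intros)
  moreover have "continuous_on K (\<lambda>\<zeta>. (norm (\<phi> \<zeta>))\<^sup>2 + (norm (\<phi>' \<zeta>))\<^sup>2 + 1)"
    using slit deriv_\<phi> deriv_\<phi>' DERIV_isCont
    by (intro continuous_intros continuous_at_imp_continuous_on) blast+
  ultimately obtain B where B: "\<And>\<zeta>. \<zeta> \<in> K \<Longrightarrow> (norm (\<phi> \<zeta>))\<^sup>2 + (norm (\<phi>' \<zeta>))\<^sup>2 + 1 \<le> B"
    using compact_continuous_image compact_imp_bounded bounded_imp_bdd_above
    unfolding bdd_above_def by (metis (no_types, lifting) imageI)
  define C where "C = sqrt (\<bar>B\<bar> * exp (norm \<kappa> + G)) + 1"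
  have C0: "0 < C"
    by (simp add: C_def add_nonneg_pos)
  have main: "norm (\<phi> \<zeta>) \<le> C * exp \<bar>Im \<zeta>\<bar> \<and> norm (\<phi>' \<zeta>) \<le> C * exp \<bar>Im \<zeta>\<bar>"
    if \<zeta>: "1 \<le> norm \<zeta>" "0 \<le> Re \<zeta> + \<bar>Im \<zeta>\<bar>" for \<zeta>
  proof -
    define T d where "T = norm \<zeta>" and "d = \<zeta> / norm \<zeta>"
    have dK: "d \<in> K"
    proof -
      have "Re d + \<bar>Im d\<bar> = (Re \<zeta> + \<bar>Im \<zeta>\<bar>) / norm \<zeta>"
        using \<zeta> by (simp add: d_def add_divide_distrib)
      moreover have "\<zeta> \<noteq> 0"
        using \<zeta> by auto
      ultimately show ?thesis
        using \<zeta> by (simp add: K_def d_def norm_divide)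
    qed
    have \<zeta>_eq: "\<zeta> = T * d" and T: "1 \<le> T"
      using \<zeta> by (auto simp: T_def d_def)
    have Im_d: "2 * \<bar>Im d\<bar> * T = 2 * \<bar>Im \<zeta>\<bar>"
      using T by (simp add: \<zeta>_eq abs_mult)
    have "norm d = 1"
      using dK by (simp add: K_def)
    then have "(norm (\<phi> \<zeta>))\<^sup>2 + (norm (\<phi>' \<zeta>))\<^sup>2 + 1
        \<le> ((norm (\<phi> d))\<^sup>2 + (norm (\<phi>' d))\<^sup>2 + 1) * exp (2 * \<bar>Im \<zeta>\<bar> + norm \<kappa> + G)"
      using energy_ray[of d T, unfolded Im_d] slit[OF dK] T by (simp add: \<zeta>_eq [symmetric])
    also have "\<dots> \<le> \<bar>B\<bar> * exp (2 * \<bar>Im \<zeta>\<bar> + norm \<kappa> + G)"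
      using B[OF dK] by (intro mult_right_mono) auto
    also have "\<dots> = (sqrt (\<bar>B\<bar> * exp (norm \<kappa> + G)) * exp \<bar>Im \<zeta>\<bar>)\<^sup>2"
      by (simp add: power_mult_distrib exp_add exp_double)
    also have "\<dots> \<le> (C * exp \<bar>Im \<zeta>\<bar>)\<^sup>2"
      by (intro power_mono mult_right_mono) (auto simp: C_def)
    finally have *: "(norm (\<phi> \<zeta>))\<^sup>2 + (norm (\<phi>' \<zeta>))\<^sup>2 + 1 \<le> (C * exp \<bar>Im \<zeta>\<bar>)\<^sup>2" .
    have "(norm (\<phi> \<zeta>))\<^sup>2 \<le> (C * exp \<bar>Im \<zeta>\<bar>)\<^sup>2" "(norm (\<phi>' \<zeta>))\<^sup>2 \<le> (C * exp \<bar>Im \<zeta>\<bar>)\<^sup>2"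
      using * zero_le_power2[of "norm (\<phi> \<zeta>)"] zero_le_power2[of "norm (\<phi>' \<zeta>)"] by linarith+
    then show ?thesis
      using C0 by (auto intro: power2_le_imp_le)
  qed
  show ?thesis
    by (rule that[OF C0]) (use main in auto)
qed

text \<open>Variation of constants: on \<alpha> e^(\<iota> \<zeta>) + \<beta> e^(-\<iota> \<zeta>)
  the amplitude is the constant 2 \<iota> \<alpha>. In general its derivative is e^(-\<iota>
  \<zeta>) times the second derivative of \<phi> plus \<phi>, which sees only the
  perturbation.\<close>

lemma amplitude_deriv:
  assumes "\<iota>\<^sup>2 = - 1" "\<zeta> \<notin> \<real>\<^sub>\<le>\<^sub>0"
  shows "((\<lambda>\<zeta>. exp (- (\<iota> * \<zeta>)) * (\<phi>' \<zeta> + \<iota> * \<phi> \<zeta>)) has_field_derivative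
    exp (- (\<iota> * \<zeta>)) * (\<kappa> / \<zeta>\<^sup>2 * \<phi> \<zeta> + g \<zeta>)) (at \<zeta>)"
proof -
  have "exp (- (\<iota> * \<zeta>)) * ((\<kappa> / \<zeta>\<^sup>2 - 1) * \<phi> \<zeta> + g \<zeta> + \<iota> * \<phi>' \<zeta>)
      + - \<iota> * exp (- (\<iota> * \<zeta>)) * (\<phi>' \<zeta> + \<iota> * \<phi> \<zeta>)
      = exp (- (\<iota> * \<zeta>)) * (\<kappa> / \<zeta>\<^sup>2 * \<phi> \<zeta> + g \<zeta> + (- 1 - \<iota>\<^sup>2) * \<phi> \<zeta>)"
    by (simp add: algebra_simps power2_eq_square)
  then have eq: "exp (- (\<iota> * \<zeta>)) * ((\<kappa> / \<zeta>\<^sup>2 - 1) * \<phi> \<zeta> + g \<zeta> + \<iota> * \<phi>' \<zeta>)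
      + - \<iota> * exp (- (\<iota> * \<zeta>)) * (\<phi>' \<zeta> + \<iota> * \<phi> \<zeta>)
      = exp (- (\<iota> * \<zeta>)) * (\<kappa> / \<zeta>\<^sup>2 * \<phi> \<zeta> + g \<zeta>)"
    using assms(1) by simp
  have 1: "((\<lambda>\<zeta>. exp (- (\<iota> * \<zeta>))) has_field_derivative (- \<iota> * exp (- (\<iota> * \<zeta>)))) (at \<zeta>)"
    by (auto intro!: derivative_eq_intros)
  have 2: "((\<lambda>\<zeta>. \<phi>' \<zeta> + \<iota> * \<phi> \<zeta>) has_field_derivative ((\<kappa> / \<zeta>\<^sup>2 - 1) * \<phi> \<zeta> + g \<zeta> + \<iota> * \<phi>' \<zeta>)) (at \<zeta>)"
    by (intro DERIV_add DERIV_cmult deriv_\<phi> deriv_\<phi>' assms(2))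
  from DERIV_mult[OF 1 2] show ?thesis
    by (rule DERIV_cong) (use eq in \<open>simp add: mult.commute add.commute\<close>)
qed

lemma amplitude_deriv_norm_le:
  assumes "1 \<le> norm \<zeta>" "\<zeta> \<notin> \<real>\<^sub>\<le>\<^sub>0" "norm (\<phi> \<zeta>) \<le> M"
  shows "norm (\<kappa> / \<zeta>\<^sup>2 * \<phi> \<zeta> + g \<zeta>) \<le> (norm \<kappa> * M + G) / (norm \<zeta>)\<^sup>2"
proof -
  have "norm (\<kappa> / \<zeta>\<^sup>2 * \<phi> \<zeta>) \<le> norm \<kappa> * M / (norm \<zeta>)\<^sup>2"
    using assms by (simp add: norm_mult norm_divide norm_power divide_right_mono mult_left_mono)
  with g_bound[OF assms(2,1)] show ?thesis
    by (intro order_trans[OF norm_triangle_ineq]) (simp add: add_divide_distrib)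
qed

lemma norm_cis_line:
  assumes "\<iota> = \<i> \<or> \<iota> = - \<i>"
  shows "norm (exp (- (\<iota> * (\<i> * of_real \<eta> + of_real t)))) = exp (Im \<iota> * \<eta>)"
    and "norm (exp (\<iota> * (\<i> * of_real \<eta> + of_real t))) = exp (- Im \<iota> * \<eta>)"
  using assms by auto

section \<open>Boundedness and decay when both amplitudes vanish along a sequence\<close>

context
  fixes R m :: "nat \<Rightarrow> real"
  assumes R_top: "filterlim R at_top sequentially"
    and m: "\<And>n. 0 < m n" "\<And>n. m n \<le> R n"
    and small: "\<And>\<iota>::complex. \<iota> = \<i> \<or> \<iota> = - \<i> \<Longrightarrow>
      (\<lambda>n. exp (- (m n / 2)) * (norm (\<phi> (R n - \<iota> * (m n / 2))) + norm (\<phi>' (R n - \<iota> * (m n / 2))))) \<longlonglongrightarrow> 0"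
begin

text \<open>At R n - \<iota> m n / 2 the factor e^(-\<iota> \<zeta>) has modulus e^(-m/2), so
  \<open>small\<close> says that the amplitude tends to 0 there. Moving vertically to the real axis,
  and then to height \<eta>, changes it by O(1 / R n) each time.\<close>

lemma amplitude_tendsto_0:
  assumes \<iota>: "\<iota> = \<i> \<or> \<iota> = - \<i>"
  defines "A \<equiv> \<lambda>\<zeta>. exp (- (\<iota> * \<zeta>)) * (\<phi>' \<zeta> + \<iota> * \<phi> \<zeta>)"
  shows "(\<lambda>n. A (\<i> * of_real \<eta> + of_real (R n))) \<longlonglongrightarrow> 0"
proof -
  have \<iota>2: "\<iota>\<^sup>2 = - 1" and \<iota>_norm: "norm \<iota> = 1" and \<iota>_Re: "Re \<iota> = 0" and \<iota>_Im: "\<bar>Im \<iota>\<bar> = 1"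
    using \<iota> by auto
  obtain C where C: "0 < C"
    and \<phi>_le: "\<And>\<zeta>. 1 \<le> norm \<zeta> \<Longrightarrow> 0 \<le> Re \<zeta> + \<bar>Im \<zeta>\<bar> \<Longrightarrow> norm (\<phi> \<zeta>) \<le> C * exp \<bar>Im \<zeta>\<bar>"
    using exp_Im_bound by metis
  define D where "D = norm \<kappa> * C + G"
  define D' where "D' = exp \<bar>\<eta>\<bar> * (norm \<kappa> * (C * exp \<bar>\<eta>\<bar>) + G) * \<bar>\<eta>\<bar>"
  have D0: "0 \<le> D" "0 \<le> D'"
    using C G_nonneg by (auto simp: D_def D'_def)
  have dA: "(A has_field_derivative exp (- (\<iota> * \<zeta>)) * (\<kappa> / \<zeta>\<^sup>2 * \<phi> \<zeta> + g \<zeta>)) (at \<zeta>)" if "\<zeta> \<notin> \<real>\<^sub>\<le>\<^sub>0" for \<zeta>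
    unfolding A_def by (rule amplitude_deriv[OF \<iota>2 that])
  have 1: "norm (A (R n - \<iota> * (m n / 2))) 
      \<le> exp (- (m n / 2)) * (norm (\<phi> (R n - \<iota> * (m n / 2))) + norm (\<phi>' (R n - \<iota> * (m n / 2))))" for n
  proof -
    have "norm (exp (- (\<iota> * (R n - \<iota> * (m n / 2))))) = exp (- (m n / 2))"
      using \<iota> by auto
    then show ?thesis
      unfolding A_def norm_mult using \<iota>_norm
      by (auto intro!: mult_left_mono order_trans[OF norm_triangle_ineq] simp: norm_mult)
  qed
  \<comment> \<open>On this segment |e^(-\<iota> \<zeta>)| = e^(-t) cancels the bound C e^t for
    \<phi>. The derivative of the amplitude is O(1 / R^2), and the length m / 2 is at most
    R.\<close>
  have 2: "norm (A (R n - \<iota> * (m n / 2)) - A (R n)) \<le> D / R n" if n: "2 \<le> R n" for n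
  proof -
    have "norm (A (R n + of_real (m n / 2) * (- \<iota>)) - A (R n + of_real 0 * (- \<iota>)))
        \<le> D / (R n)\<^sup>2 * (m n / 2) - D / (R n)\<^sup>2 * 0"
    proof (rule norm_diff_le_of_deriv_le[where k = "\<lambda>t. D / (R n)\<^sup>2 * t" and k' = "\<lambda>t. D / (R n)\<^sup>2"])
      fix t assume t: "0 \<le> t" "t \<le> m n / 2"
      define \<zeta> where "\<zeta> = R n + of_real t * (- \<iota>)"
      have \<zeta>: "Re \<zeta> = R n" "\<bar>Im \<zeta>\<bar> = t"
        using t \<iota>_Re \<iota>_Im by (auto simp: \<zeta>_def abs_mult)
      have slit: "\<zeta> \<notin> \<real>\<^sub>\<le>\<^sub>0" and n\<zeta>: "R n \<le> norm \<zeta>"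
        using n \<zeta> complex_Re_le_cmod[of \<zeta>] by (auto simp: complex_nonpos_Reals_iff)
      show "((\<lambda>t. A (R n + of_real t * (- \<iota>))) has_vector_derivative
          (exp (- (\<iota> * \<zeta>)) * (\<kappa> / \<zeta>\<^sup>2 * \<phi> \<zeta> + g \<zeta>)) * (- \<iota>)) (at t)"
        by (rule has_vector_derivative_along_line) (use dA[OF slit] in \<open>simp add: \<zeta>_def\<close>)
      show "((\<lambda>t. D / (R n)\<^sup>2 * t) has_real_derivative D / (R n)\<^sup>2) (at t)"
        by (rule DERIV_cmult_Id)
      have e: "norm (exp (- (\<iota> * \<zeta>))) = exp (- t)"
        using \<iota> by (auto simp: \<zeta>_def)
      have "norm (\<kappa> / \<zeta>\<^sup>2 * \<phi> \<zeta> + g \<zeta>) \<le> (norm \<kappa> * (C * exp t) + G) / (norm \<zeta>)\<^sup>2"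
        using amplitude_deriv_norm_le[OF _ slit \<phi>_le] n\<zeta> n \<zeta> t by simp
      also have "\<dots> \<le> (norm \<kappa> * (C * exp t) + G * exp t) / (R n)\<^sup>2"
        using n\<zeta> n t C G_nonneg by (intro frac_le add_mono mult_left_le power_mono) (auto simp: mult_le_cancel_left1)
      also have "\<dots> = D / (R n)\<^sup>2 * exp t"
        by (simp add: D_def algebra_simps)
      finally have "exp (- t) * norm (\<kappa> / \<zeta>\<^sup>2 * \<phi> \<zeta> + g \<zeta>) \<le> exp (- t) * (D / (R n)\<^sup>2 * exp t)"
        by (rule mult_left_mono) simp
      also have "\<dots> = D / (R n)\<^sup>2"
        by (simp add: exp_minus)
      finally show "norm ((exp (- (\<iota> * \<zeta>)) * (\<kappa> / \<zeta>\<^sup>2 * \<phi> \<zeta> + g \<zeta>)) * (- \<iota>)) \<le> D / (R n)\<^sup>2"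
        unfolding norm_mult e norm_minus_cancel \<iota>_norm by simp
    qed (use m(1)[of n] in auto)
    also have "\<dots> = D / (R n)\<^sup>2 * (m n / 2)"
      by simp
    also have "\<dots> \<le> D / (R n)\<^sup>2 * R n"
      using m(1)[of n] m(2)[of n] D0 by (intro mult_left_mono) (linarith, simp)
    also have "\<dots> = D / R n"
      using n by (simp add: power2_eq_square)
    finally show ?thesis
      by (simp add: mult.commute)
  qed
  \<comment> \<open>The height \<eta> is fixed while n grows, so constants may depend on it.\<close>
  have 3: "norm (A (\<i> * \<eta> + R n) - A (R n)) \<le> D' / R n" if n: "2 \<le> R n" for n
  proof -
    have "norm (A (R n + of_real 1 * (\<i> * \<eta>)) - A (R n + of_real 0 * (\<i> * \<eta>)))
        \<le> D' / (R n)\<^sup>2 * 1 - D' / (R n)\<^sup>2 * 0"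
    proof (rule norm_diff_le_of_deriv_le[where k = "\<lambda>t. D' / (R n)\<^sup>2 * t" and k' = "\<lambda>t. D' / (R n)\<^sup>2"])
      fix t :: real assume t: "0 \<le> t" "t \<le> 1"
      define \<zeta> where "\<zeta> = R n + of_real t * (\<i> * \<eta>)"
      have \<zeta>: "Re \<zeta> = R n" "\<bar>Im \<zeta>\<bar> \<le> \<bar>\<eta>\<bar>"
        using t mult_right_mono[of t 1 "\<bar>\<eta>\<bar>"] by (auto simp: \<zeta>_def abs_mult)
      have slit: "\<zeta> \<notin> \<real>\<^sub>\<le>\<^sub>0" and n\<zeta>: "R n \<le> norm \<zeta>"
        using n \<zeta> complex_Re_le_cmod[of \<zeta>] by (auto simp: complex_nonpos_Reals_iff)
      show "((\<lambda>t. A (R n + of_real t * (\<i> * \<eta>))) has_vector_derivative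
          (exp (- (\<iota> * \<zeta>)) * (\<kappa> / \<zeta>\<^sup>2 * \<phi> \<zeta> + g \<zeta>)) * (\<i> * \<eta>)) (at t)"
        by (rule has_vector_derivative_along_line) (use dA[OF slit] in \<open>simp add: \<zeta>_def\<close>)
      show "((\<lambda>t. D' / (R n)\<^sup>2 * t) has_real_derivative D' / (R n)\<^sup>2) (at t)"
        by (rule DERIV_cmult_Id)
      have "norm (exp (- (\<iota> * \<zeta>))) = exp (Im \<iota> * Im \<zeta>)"
        using \<iota> by auto
      also have "\<dots> \<le> exp \<bar>\<eta>\<bar>"
        using \<zeta> \<iota> by auto
      finally have e: "norm (exp (- (\<iota> * \<zeta>))) \<le> exp \<bar>\<eta>\<bar>" .
      have "norm (\<phi> \<zeta>) \<le> C * exp \<bar>Im \<zeta>\<bar>"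
        using \<phi>_le[of \<zeta>] n\<zeta> n \<zeta> by simp
      also have "\<dots> \<le> C * exp \<bar>\<eta>\<bar>"
        using \<zeta> C by simp
      finally have "norm (\<kappa> / \<zeta>\<^sup>2 * \<phi> \<zeta> + g \<zeta>) \<le> (norm \<kappa> * (C * exp \<bar>\<eta>\<bar>) + G) / (norm \<zeta>)\<^sup>2"
        using amplitude_deriv_norm_le[OF _ slit] n\<zeta> n by simp
      also have "\<dots> \<le> (norm \<kappa> * (C * exp \<bar>\<eta>\<bar>) + G) / (R n)\<^sup>2"
        using n\<zeta> n t C G_nonneg by (intro divide_left_mono power_mono mult_pos_pos) auto
      finally have "norm (exp (- (\<iota> * \<zeta>))) * norm (\<kappa> / \<zeta>\<^sup>2 * \<phi> \<zeta> + g \<zeta>) * \<bar>\<eta>\<bar>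
         \<le> exp \<bar>\<eta>\<bar> * ((norm \<kappa> * (C * exp \<bar>\<eta>\<bar>) + G) / (R n)\<^sup>2) * \<bar>\<eta>\<bar>"
        using e by (intro mult_right_mono mult_mono) auto
      then show "norm ((exp (- (\<iota> * \<zeta>)) * (\<kappa> / \<zeta>\<^sup>2 * \<phi> \<zeta> + g \<zeta>)) * (\<i> * \<eta>)) \<le> D' / (R n)\<^sup>2"
        unfolding D'_def by (simp add: norm_mult)
    qed auto
    also have "\<dots> \<le> D' / R n"
      using n D0 by (auto intro!: divide_left_mono simp: power2_eq_square)
    finally show ?thesis
      by (simp add: add.commute)
  qed
  have lim: "(\<lambda>n. exp (- (m n / 2)) * (norm (\<phi> (R n - \<iota> * (m n / 2))) + norm (\<phi>' (R n - \<iota> * (m n / 2))))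
      + D / R n + D' / R n) \<longlonglongrightarrow> 0"
    using tendsto_add[OF tendsto_add[OF small[OF \<iota>] tendsto_divide_0[OF tendsto_const[of D] filterlim_at_top_imp_at_infinity[OF R_top]]]
        tendsto_divide_0[OF tendsto_const[of D'] filterlim_at_top_imp_at_infinity[OF R_top]]]
    by simp
  show ?thesis
  proof (rule Lim_null_comparison[OF _ lim])
    have "eventually (\<lambda>n. 2 \<le> R n) sequentially"
      using R_top by (simp add: filterlim_at_top)
    then show "\<forall>\<^sub>F n in sequentially. norm (A (\<i> * \<eta> + R n))
        \<le> exp (- (m n / 2)) * (norm (\<phi> (R n - \<iota> * (m n / 2))) + norm (\<phi>' (R n - \<iota> * (m n / 2))))
          + D / R n + D' / R n"
    proof eventually_elim
      case (elim n)
      have "A (\<i> * \<eta> + R n) = A (R n - \<iota> * (m n / 2))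
          - (A (R n - \<iota> * (m n / 2)) - A (R n)) + (A (\<i> * \<eta> + R n) - A (R n))"
        by simp
      also have "norm \<dots> \<le> norm (A (R n - \<iota> * (m n / 2)))
          + norm (A (R n - \<iota> * (m n / 2)) - A (R n)) + norm (A (\<i> * \<eta> + R n) - A (R n))"
        by (intro order_trans[OF norm_triangle_ineq] add_right_mono norm_triangle_ineq4)
      finally show ?case
        using 1[of n] 2[OF elim] 3[OF elim] by linarith
    qed
  qed
qed

text \<open>The amplitudes \<open>e\<^bsup>-\<iota>\<zeta>\<^esup> (\<phi>' + \<iota>\<phi>)\<close>, \<open>\<iota> = \<i>\<close> or \<open>-\<i>\<close>, vanish at the right end of every horizontal line, where
  \<open>|e\<^bsup>-\<iota>\<zeta>\<^esup>|\<close> is constant; integrating their derivatives back along the line bounds \<open>\<phi>\<close> without a factor \<open>e\<^bsup>|Im \<zeta>|\<^esup>\<close>.\<close>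

lemma solution_le_on_line:
  assumes s: "2 \<le> s + \<bar>\<eta>\<bar>" and M: "\<And>t. s \<le> t \<Longrightarrow> norm (\<phi> (\<i> * of_real \<eta> + of_real t)) \<le> M"
  shows "norm (\<phi> (\<i> * of_real \<eta> + of_real s)) \<le> 2 * (norm \<kappa> * M + G) / (s + \<bar>\<eta>\<bar>)"
    and "norm (\<phi>' (\<i> * of_real \<eta> + of_real s)) \<le> 2 * (norm \<kappa> * M + G) / (s + \<bar>\<eta>\<bar>)"
proof -
  define X where "X = 2 * (norm \<kappa> * M + G)"
  define \<zeta> where "\<zeta> = \<i> * of_real \<eta> + complex_of_real s"
  have M0: "0 \<le> M"
    using order_trans[OF norm_ge_zero M[OF order_refl]] .
  then have X0: "0 \<le> X"
    using G_nonneg by (simp add: X_def)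
  have amp: "norm (\<phi>' \<zeta> + \<iota> * \<phi> \<zeta>) \<le> X / (s + \<bar>\<eta>\<bar>)" if \<iota>: "\<iota> = \<i> \<or> \<iota> = - \<i>" for \<iota>
  proof -
    define A where "A = (\<lambda>\<zeta>. exp (- (\<iota> * \<zeta>)) * (\<phi>' \<zeta> + \<iota> * \<phi> \<zeta>))"
    \<comment> \<open>A primitive of the majorant which is nonpositive, so that k T - k s is at most
      -k s for every right end T.\<close>
    define k where "k = (\<lambda>t. - (exp (Im \<iota> * \<eta>) * X) / (t + \<bar>\<eta>\<bar>))"
    have \<iota>2: "\<iota>\<^sup>2 = - 1"
      using \<iota> by auto
    have step: "norm (A (\<i> * \<eta> + of_real T * 1) - A (\<i> * \<eta> + of_real s * 1)) \<le> k T - k s" if T: "s \<le> T" for T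
    proof (rule norm_diff_le_of_deriv_le[where k' = "\<lambda>t. exp (Im \<iota> * \<eta>) * X / (t + \<bar>\<eta>\<bar>)\<^sup>2"])
      fix t assume t: "s \<le> t" "t \<le> T"
      define z where "z = \<i> * \<eta> + complex_of_real t"
      have z: "2 \<le> Re z + \<bar>Im z\<bar>" and Re_z: "Re z + \<bar>Im z\<bar> = t + \<bar>\<eta>\<bar>"
        using s t by (auto simp: z_def)
      note zz = norm_ge_one_of_sector[OF z]
      show "((\<lambda>t. A (\<i> * \<eta> + of_real t * 1)) has_vector_derivative
          (exp (- (\<iota> * z)) * (\<kappa> / z\<^sup>2 * \<phi> z + g z)) * 1) (at t)"
        by (rule has_vector_derivative_along_line)
          (use amplitude_deriv[OF \<iota>2 zz(2)] in \<open>simp add: z_def A_def\<close>)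
      have "t + \<bar>\<eta>\<bar> \<noteq> 0"
        using s t by linarith
      then show "(k has_real_derivative exp (Im \<iota> * \<eta>) * X / (t + \<bar>\<eta>\<bar>)\<^sup>2) (at t)"
        unfolding k_def by (auto intro!: derivative_eq_intros simp: power2_eq_square)
      have "norm (\<kappa> / z\<^sup>2 * \<phi> z + g z) \<le> (norm \<kappa> * M + G) * (1 / (norm z)\<^sup>2)"
        using amplitude_deriv_norm_le[OF zz(1,2), of M] M[OF t(1)] by (simp add: z_def)
      also have "\<dots> \<le> (norm \<kappa> * M + G) * (2 / (t + \<bar>\<eta>\<bar>)\<^sup>2)"
        using zz(3) M0 G_nonneg unfolding Re_z by (intro mult_left_mono) auto
      finally have "exp (Im \<iota> * \<eta>) * norm (\<kappa> / z\<^sup>2 * \<phi> z + g z) \<le> exp (Im \<iota> * \<eta>) * ((norm \<kappa> * M + G) * (2 / (t + \<bar>\<eta>\<bar>)\<^sup>2))"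
        by (rule mult_left_mono) simp
      then show "norm ((exp (- (\<iota> * z)) * (\<kappa> / z\<^sup>2 * \<phi> z + g z)) * 1) \<le> exp (Im \<iota> * \<eta>) * X / (t + \<bar>\<eta>\<bar>)\<^sup>2"
        unfolding norm_mult z_def norm_cis_line(1)[OF \<iota>] by (simp add: X_def algebra_simps)
    qed (use T in auto)
    have "eventually (\<lambda>n. s \<le> R n) sequentially"
      using R_top by (simp add: filterlim_at_top)
    then have ev: "eventually (\<lambda>n. norm (A \<zeta>) \<le> norm (A (\<i> * \<eta> + R n)) - k s) sequentially"
    proof eventually_elim
      case (elim n)
      have "0 < R n + \<bar>\<eta>\<bar>"
        using elim s by linarith
      then have "k (R n) \<le> 0"
        using X0 by (simp add: k_def)
      moreover have "norm (A \<zeta>) - norm (A (\<i> * \<eta> + R n)) \<le> norm (A (\<i> * \<eta> + R n) - A \<zeta>)"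
        using norm_triangle_ineq2[of "A \<zeta>" "A (\<i> * \<eta> + R n)"] by (simp add: norm_minus_commute)
      ultimately show ?case
        using step[OF elim] by (simp add: \<zeta>_def)
    qed
    have "norm (A \<zeta>) \<le> norm (0::complex) - k s"
      by (rule tendsto_lowerbound[OF _ ev])
        (unfold A_def, intro tendsto_diff tendsto_norm tendsto_const amplitude_tendsto_0[OF \<iota>], simp)
    then have "norm (A \<zeta>) \<le> exp (Im \<iota> * \<eta>) * (X / (s + \<bar>\<eta>\<bar>))"
      by (simp add: k_def)
    then show ?thesis
      unfolding A_def norm_mult \<zeta>_def norm_cis_line(1)[OF \<iota>]
      by (rule mult_left_le_imp_le) simp
  qed
  have i1: "norm (\<phi>' \<zeta> + \<i> * \<phi> \<zeta>) \<le> X / (s + \<bar>\<eta>\<bar>)" and i2: "norm (\<phi>' \<zeta> + - \<i> * \<phi> \<zeta>) \<le> X / (s + \<bar>\<eta>\<bar>)"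
    using amp by blast+
  have "2 * norm (\<phi> \<zeta>) = norm (2 * \<i> * \<phi> \<zeta>)"
    by (simp add: norm_mult)
  also have "2 * \<i> * \<phi> \<zeta> = (\<phi>' \<zeta> + \<i> * \<phi> \<zeta>) - (\<phi>' \<zeta> + - \<i> * \<phi> \<zeta>)"
    by simp
  finally have "norm (\<phi> \<zeta>) \<le> X / (s + \<bar>\<eta>\<bar>)"
    using i1 i2 norm_triangle_ineq4[of "\<phi>' \<zeta> + \<i> * \<phi> \<zeta>" "\<phi>' \<zeta> + - \<i> * \<phi> \<zeta>"] by linarith
  then show "norm (\<phi> (\<i> * of_real \<eta> + of_real s)) \<le> 2 * (norm \<kappa> * M + G) / (s + \<bar>\<eta>\<bar>)"
    by (simp add: \<zeta>_def X_def)
  have "2 * norm (\<phi>' \<zeta>) = norm (2 * \<phi>' \<zeta>)"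
    by (simp add: norm_mult)
  also have "2 * \<phi>' \<zeta> = (\<phi>' \<zeta> + \<i> * \<phi> \<zeta>) + (\<phi>' \<zeta> + - \<i> * \<phi> \<zeta>)"
    by simp
  finally have "norm (\<phi>' \<zeta>) \<le> X / (s + \<bar>\<eta>\<bar>)"
    using i1 i2 norm_triangle_ineq[of "\<phi>' \<zeta> + \<i> * \<phi> \<zeta>" "\<phi>' \<zeta> + - \<i> * \<phi> \<zeta>"] by linarith
  then show "norm (\<phi>' (\<i> * of_real \<eta> + of_real s)) \<le> 2 * (norm \<kappa> * M + G) / (s + \<bar>\<eta>\<bar>)"
    by (simp add: \<zeta>_def X_def)
qed

text \<open>Let M be the supremum of |\<phi>| on a horizontal half-line; it is finite, as the bound
  of \<open>exp_Im_bound\<close> depends on the height only. Then \<open>solution_le_on_line\<close>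
  bounds M by 2 (|\<kappa>| M + G) / t1, and t1 = 4 |\<kappa>| + 4 is large enough to absorb the
  term with M.\<close>

lemma solution_bounded:
  assumes "4 * norm \<kappa> + 4 \<le> Re \<zeta> + \<bar>Im \<zeta>\<bar>"
  shows "norm (\<phi> \<zeta>) \<le> G"
proof -
  define t1 where "t1 = 4 * norm \<kappa> + 4"
  have t1: "4 \<le> t1"
    by (simp add: t1_def)
  define \<eta> s where "\<eta> = Im \<zeta>" and "s = t1 - \<bar>\<eta>\<bar>"
  define S where "S = (\<lambda>t. norm (\<phi> (\<i> * of_real \<eta> + of_real t))) ` {s..}"
  obtain C where C: "0 < C"
    and \<phi>_le: "\<And>\<zeta>. 1 \<le> norm \<zeta> \<Longrightarrow> 0 \<le> Re \<zeta> + \<bar>Im \<zeta>\<bar> \<Longrightarrow> norm (\<phi> \<zeta>) \<le> C * exp \<bar>Im \<zeta>\<bar>"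
    using exp_Im_bound by metis
  have bdd: "bdd_above S"
  proof (rule bdd_aboveI)
    fix y assume "y \<in> S"
    then obtain t where t: "s \<le> t" and y: "y = norm (\<phi> (\<i> * of_real \<eta> + of_real t))"
      by (auto simp: S_def)
    have "2 \<le> Re (\<i> * of_real \<eta> + complex_of_real t) + \<bar>Im (\<i> * of_real \<eta> + complex_of_real t)\<bar>"
      using t t1 by (simp add: s_def)
    from \<phi>_le[OF norm_ge_one_of_sector(1)[OF this]] this show "y \<le> C * exp \<bar>\<eta>\<bar>"
      by (simp add: y)
  qed
  have le: "norm (\<phi> (\<i> * of_real \<eta> + of_real t)) \<le> Sup S" if "s \<le> t" for t
    using bdd that by (intro cSup_upper) (auto simp: S_def)
  then have S0: "0 \<le> Sup S"
    using order_trans[OF norm_ge_zero le[OF order_refl]] by blast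
  have "Sup S \<le> 2 * (norm \<kappa> * Sup S + G) / t1"
  proof (rule cSup_least)
    fix y assume "y \<in> S"
    then obtain t where t: "s \<le> t" and y: "y = norm (\<phi> (\<i> * of_real \<eta> + of_real t))"
      by (auto simp: S_def)
    have "y \<le> 2 * (norm \<kappa> * Sup S + G) / (t + \<bar>\<eta>\<bar>)"
      unfolding y using t t1 le by (intro solution_le_on_line(1)) (auto simp: s_def)
    also have "\<dots> \<le> 2 * (norm \<kappa> * Sup S + G) / t1"
      using t t1 S0 G_nonneg by (intro divide_left_mono mult_pos_pos) (auto simp: s_def)
    finally show "y \<le> 2 * (norm \<kappa> * Sup S + G) / t1" .
  qed (auto simp: S_def)
  then have "Sup S * t1 \<le> 2 * (norm \<kappa> * Sup S + G)"
    using t1 by (simp add: field_simps)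
  then have "Sup S * (2 * norm \<kappa> + 3) \<le> 2 * G - Sup S"
    by (simp add: t1_def algebra_simps)
  moreover have "Sup S * 3 \<le> Sup S * (2 * norm \<kappa> + 3)"
    using S0 by (intro mult_left_mono) auto
  ultimately have "Sup S \<le> G"
    using S0 G_nonneg by linarith
  moreover have "norm (\<phi> \<zeta>) \<le> Sup S"
  proof -
    have "\<zeta> = \<i> * of_real \<eta> + of_real (Re \<zeta>)"
      by (simp add: complex_eq_iff \<eta>_def)
    then show ?thesis
      using le[of "Re \<zeta>"] assms by (simp add: s_def t1_def \<eta>_def)
  qed
  ultimately show ?thesis
    by linarith
qed

text \<open>Inserting the bound G into \<open>solution_le_on_line\<close> on the real axis gives
  decay of order 1 / s.\<close>

lemma solution_tendsto_0:
  shows "((\<lambda>s. \<phi> (of_real s)) \<longlongrightarrow> 0) at_top" "((\<lambda>s. \<phi>' (of_real s)) \<longlongrightarrow> 0) at_top"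
proof -
  define X where "X = 2 * (norm \<kappa> * G + G)"
  have lim: "((\<lambda>s. X / s) \<longlongrightarrow> 0) at_top"
    by (rule tendsto_divide_0[OF tendsto_const filterlim_at_top_imp_at_infinity[OF filterlim_ident]])
  have bound: "norm (\<phi> (of_real s)) \<le> X / s \<and> norm (\<phi>' (of_real s)) \<le> X / s"
    if "4 * norm \<kappa> + 4 \<le> s" for s :: real
  proof -
    have "2 \<le> s"
      using that norm_ge_zero[of \<kappa>] by linarith
    moreover have "norm (\<phi> (\<i> * of_real 0 + of_real t)) \<le> G" if "s \<le> t" for t
      using solution_bounded[of "of_real t"] \<open>4 * norm \<kappa> + 4 \<le> s\<close> that by simp
    ultimately show ?thesis
      using solution_le_on_line[of s 0 G] by (simp add: X_def)
  qed
  show "((\<lambda>s. \<phi> (of_real s)) \<longlongrightarrow> 0) at_top" "((\<lambda>s. \<phi>' (of_real s)) \<longlongrightarrow> 0) at_top"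
    by (rule Lim_null_comparison[OF _ lim], use bound in \<open>auto simp: eventually_at_top_linorder\<close>)+
qed

end

text \<open>On the real axis the leading terms in the derivative of the energy cancel, which leaves
  the integrable rate |\<kappa>| / t^2. So the energy at a is at most e^|\<kappa>| times the energy
  at any b >= a, and the latter tends to 0.\<close>

lemma homogeneous_eq_0:
  assumes g0: "\<And>\<zeta>. g \<zeta> = 0"
    and lim: "((\<lambda>s. \<phi> (of_real s)) \<longlongrightarrow> 0) at_top" "((\<lambda>s. \<phi>' (of_real s)) \<longlongrightarrow> 0) at_top"
    and a: "1 \<le> a"
  shows "\<phi> (of_real a) = 0"
proof -
  define u where "u = (\<lambda>t::real. \<phi> t)"
  define v where "v = (\<lambda>t::real. \<phi>' t)"
  define v' where "v' = (\<lambda>t::real. (\<kappa> / (of_real t)\<^sup>2 - 1) * u t)"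
  define E where "E = (\<lambda>t. (norm (u t))\<^sup>2 + (norm (v t))\<^sup>2)"
  have slit: "complex_of_real t \<notin> \<real>\<^sub>\<le>\<^sub>0" if "t \<ge> 1" for t
    using that by (auto simp: complex_nonpos_Reals_iff)
  have du: "(u has_vector_derivative v t) (at t)" if "t \<ge> 1" for t
    using has_vector_derivative_along_line[of \<phi> "\<phi>' t" 0 t 1] deriv_\<phi>[OF slit[OF that]]
    by (simp add: u_def v_def)
  have dv: "(v has_vector_derivative v' t) (at t)" if "t \<ge> 1" for t
    using has_vector_derivative_along_line[of \<phi>' _ 0 t 1] deriv_\<phi>'[OF slit[OF that]]
    by (simp add: u_def v_def v'_def g0)
  have bound: "E a \<le> E b * exp (norm \<kappa>)" if b: "a \<le> b" for b
  proof -
    have "E a \<le> E b * exp ((- norm \<kappa> / b) - (- norm \<kappa> / a))"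
    proof (rule exp_bound_of_deriv_ge[where E' = "\<lambda>t. 2 * Re (cnj (u t) * v t) + 2 * Re (cnj (v t) * v' t)"
        and k' = "\<lambda>t. norm \<kappa> / t\<^sup>2"])
      fix t assume t: "a \<le> t" "t \<le> b"
      with a have t1: "1 \<le> t" by simp
      show "(E has_real_derivative 2 * Re (cnj (u t) * v t) + 2 * Re (cnj (v t) * v' t)) (at t)"
        unfolding E_def
        by (intro DERIV_add has_real_derivative_cmod_sq du dv t1)
      show "((\<lambda>t. - norm \<kappa> / t) has_real_derivative norm \<kappa> / t\<^sup>2) (at t)"
        using t1 by (auto intro!: derivative_eq_intros simp: power2_eq_square)
      define P where "P = Re (cnj (v t) * (u t + v' t))"
      have "Re (cnj (u t) * v t) = Re (cnj (v t) * u t)"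
        by simp
      then have "2 * Re (cnj (u t) * v t) + 2 * Re (cnj (v t) * v' t) = 2 * P"
        by (simp add: P_def distrib_left del: cnj.sel complex_cnj)
      moreover have "- (norm \<kappa> / t\<^sup>2 * E t) \<le> 2 * P"
      proof -
        have "u t + v' t = \<kappa> / (of_real t)\<^sup>2 * u t"
          by (simp add: v'_def algebra_simps)
        then have "\<bar>P\<bar> \<le> norm (cnj (v t) * (\<kappa> / (of_real t)\<^sup>2 * u t))"
          unfolding P_def using abs_Re_le_cmod by metis
        also have "\<dots> = norm \<kappa> / t\<^sup>2 * (norm (u t) * norm (v t))"
          by (simp add: norm_mult norm_divide norm_power)
        finally have "2 * \<bar>P\<bar> \<le> 2 * (norm \<kappa> / t\<^sup>2 * (norm (u t) * norm (v t)))"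
          by linarith
        also have "\<dots> = norm \<kappa> / t\<^sup>2 * (2 * norm (u t) * norm (v t))"
          by simp
        also have "\<dots> \<le> norm \<kappa> / t\<^sup>2 * E t"
          using sum_squares_bound[of "norm (u t)" "norm (v t)"] unfolding E_def
          by (intro mult_left_mono) auto
        finally show ?thesis
          by linarith
      qed
      ultimately show "- (norm \<kappa> / t\<^sup>2 * E t) \<le> 2 * Re (cnj (u t) * v t) + 2 * Re (cnj (v t) * v' t)"
        by linarith
    qed (use b in auto)
    also have "\<dots> \<le> E b * exp (norm \<kappa>)"
    proof (intro mult_left_mono)
      have "norm \<kappa> / a \<le> norm \<kappa>" "0 \<le> norm \<kappa> / b"
        using a b by (auto simp: divide_le_eq mult_le_cancel_left1)
      then show "exp ((- norm \<kappa> / b) - (- norm \<kappa> / a)) \<le> exp (norm \<kappa>)"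
        by simp
    qed (simp add: E_def)
    finally show ?thesis .
  qed
  have "((\<lambda>b. E b * exp (norm \<kappa>)) \<longlongrightarrow> ((norm (0::complex))\<^sup>2 + (norm (0::complex))\<^sup>2) * exp (norm \<kappa>)) at_top"
    unfolding E_def u_def v_def by (intro tendsto_intros lim)
  then have "((\<lambda>b. E b * exp (norm \<kappa>)) \<longlongrightarrow> 0) at_top"
    by simp
  then have "E a \<le> 0"
    by (rule tendsto_lowerbound) (use bound in \<open>auto simp: eventually_at_top_linorder\<close>)
  then show ?thesis
    unfolding E_def u_def by (simp add: add_nonneg_eq_0_iff sum_power2_le_zero_iff)
qed

end

section \<open>Entire solutions with few zeros\<close>

text \<open>\<open>\<mu>\<close> and \<open>s\<close> are parameters because subtracting a power of
  \<zeta> changes them and keeps \<nu>; for \<open>s = 0\<close> this is Bessel's equation in the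
  variable z.\<close>

definition bessel_eq :: "complex \<Rightarrow> complex \<Rightarrow> complex \<Rightarrow> (complex \<Rightarrow> complex) \<Rightarrow> bool" where
  "bessel_eq \<nu> \<mu> s f \<longleftrightarrow> f holomorphic_on UNIV \<and>
     (\<forall>z. (deriv ^^ 2) f z + (exp (2 * z) - \<nu>\<^sup>2) * f z = s * exp ((\<mu> + 1) * z))"

text \<open>The substitution \<open>\<zeta> = e\<^sup>z\<close>, with the factor \<open>\<zeta>\<^bsup>1/2\<^esup>\<close> that removes the first derivative from
  Bessel's equation.\<close>

definition slit :: "(complex \<Rightarrow> complex) \<Rightarrow> complex \<Rightarrow> complex" where
  "slit f \<zeta> = exp (Ln \<zeta> / 2) * f (Ln \<zeta>)"

definition slit' :: "(complex \<Rightarrow> complex) \<Rightarrow> complex \<Rightarrow> complex" where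
  "slit' f \<zeta> = exp (Ln \<zeta> / 2) * (f (Ln \<zeta>) / 2 + deriv f (Ln \<zeta>)) / \<zeta>"

lemma entire_DERIV:
  assumes "f holomorphic_on UNIV"
  shows "(f has_field_derivative deriv f z) (at z)"
  using holomorphic_derivI[OF assms open_UNIV] by simp

lemma entire_deriv:
  assumes "f holomorphic_on UNIV"
  shows "deriv f holomorphic_on UNIV"
  using holomorphic_deriv[OF assms open_UNIV] .

lemma slit_deriv:
  assumes f: "f holomorphic_on UNIV" and \<zeta>: "\<zeta> \<notin> \<real>\<^sub>\<le>\<^sub>0"
  shows "(slit f has_field_derivative slit' f \<zeta>) (at \<zeta>)"
proof -
  have \<zeta>0: "\<zeta> \<noteq> 0"
    using \<zeta> by auto
  have 1: "((\<lambda>\<zeta>. f (Ln \<zeta>)) has_field_derivative deriv f (Ln \<zeta>) * inverse \<zeta>) (at \<zeta>)"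
    by (rule DERIV_chain2[OF entire_DERIV[OF f] has_field_derivative_Ln[OF \<zeta>]])
  have 2: "((\<lambda>\<zeta>. exp (Ln \<zeta> / 2)) has_field_derivative exp (Ln \<zeta> / 2) * (inverse \<zeta> / 2)) (at \<zeta>)"
    by (intro DERIV_fun_exp DERIV_cdivide has_field_derivative_Ln \<zeta>)
  show ?thesis
    unfolding slit_def
    by (rule DERIV_cong[OF DERIV_mult[OF 2 1]]) (use \<zeta>0 in \<open>simp add: slit'_def field_simps\<close>)
qed

lemma slit'_deriv:
  assumes f: "bessel_eq \<nu> \<mu> s f" and \<zeta>: "\<zeta> \<notin> \<real>\<^sub>\<le>\<^sub>0"
  shows "(slit' f has_field_derivative
    ((\<nu>\<^sup>2 - 1/4) / \<zeta>\<^sup>2 - 1) * slit f \<zeta> + s * exp ((\<mu> - 1/2) * Ln \<zeta>)) (at \<zeta>)"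
proof -
  have hol: "f holomorphic_on UNIV"
    and ode: "deriv (deriv f) z + (exp (2 * z) - \<nu>\<^sup>2) * f z = s * exp ((\<mu> + 1) * z)" for z
    using f by (auto simp: bessel_eq_def numeral_2_eq_2)
  have \<zeta>0: "\<zeta> \<noteq> 0"
    using \<zeta> by auto
  define w where "w = Ln \<zeta>"
  have ew: "exp w = \<zeta>"
    using \<zeta>0 by (simp add: w_def)
  have 1: "((\<lambda>\<zeta>. f (Ln \<zeta>) / 2 + deriv f (Ln \<zeta>)) has_field_derivative
      (deriv f w * inverse \<zeta>) / 2 + deriv (deriv f) w * inverse \<zeta>) (at \<zeta>)"
    unfolding w_def
    by (intro DERIV_add DERIV_cdivide DERIV_chain2[OF entire_DERIV has_field_derivative_Ln[OF \<zeta>]]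
        hol entire_deriv)
  have 2: "((\<lambda>\<zeta>. exp (Ln \<zeta> / 2)) has_field_derivative exp (w / 2) * (inverse \<zeta> / 2)) (at \<zeta>)"
    unfolding w_def by (intro DERIV_fun_exp DERIV_cdivide has_field_derivative_Ln \<zeta>)
  have dd: "deriv (deriv f) w = s * exp ((\<mu> + 1) * w) - (\<zeta>\<^sup>2 - \<nu>\<^sup>2) * f w"
  proof -
    have "exp (2 * w) = \<zeta>\<^sup>2"
      by (simp add: exp_double ew)
    then show ?thesis
      using ode[of w] by (simp only:) (simp add: algebra_simps)
  qed
  have ee: "exp ((\<mu> - 1/2) * w) * \<zeta>\<^sup>2 = exp (w / 2) * exp ((\<mu> + 1) * w)"
    unfolding ew [symmetric] exp_double [symmetric] exp_add [symmetric] by (simp add: algebra_simps)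
  show ?thesis
    unfolding slit'_def
  proof (rule DERIV_cong[OF DERIV_divide[OF DERIV_mult[OF 2 1] DERIV_ident \<zeta>0]])
    have "exp (w / 2) * (inverse \<zeta> / 2) * (f w / 2 + deriv f w) 
        + (deriv f w * inverse \<zeta> / 2 + deriv (deriv f) w * inverse \<zeta>) * exp (w / 2)
        = exp (w / 2) / \<zeta> * (f w / 4 + deriv f w + deriv (deriv f) w)"
      using \<zeta>0 by (simp add: field_simps)
    then have "((exp (w / 2) * (inverse \<zeta> / 2) * (f w / 2 + deriv f w) 
        + (deriv f w * inverse \<zeta> / 2 + deriv (deriv f) w * inverse \<zeta>) * exp (w / 2)) * \<zeta>
        - exp (w / 2) * (f w / 2 + deriv f w) * 1) / (\<zeta> * \<zeta>)
        = exp (w / 2) * (deriv (deriv f) w - f w / 4) / \<zeta>\<^sup>2"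
      using \<zeta>0 by (simp add: field_simps power2_eq_square)
    also have "\<dots> = ((\<nu>\<^sup>2 - 1/4) / \<zeta>\<^sup>2 - 1) * (exp (w / 2) * f w) + s * (exp (w / 2) * exp ((\<mu> + 1) * w)) / \<zeta>\<^sup>2"
      unfolding dd using \<zeta>0 by (simp add: field_simps)
    also have "\<dots> = ((\<nu>\<^sup>2 - 1/4) / \<zeta>\<^sup>2 - 1) * (exp (w / 2) * f w) + s * exp ((\<mu> - 1/2) * w)"
      unfolding ee [symmetric] using \<zeta>0 by simp
    finally show "((exp (w / 2) * (inverse \<zeta> / 2) * (f (Ln \<zeta>) / 2 + deriv f (Ln \<zeta>)) 
        + (deriv f w * inverse \<zeta> / 2 + deriv (deriv f) w * inverse \<zeta>) * exp (Ln \<zeta> / 2)) * \<zeta>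
        - exp (Ln \<zeta> / 2) * (f (Ln \<zeta>) / 2 + deriv f (Ln \<zeta>)) * 1) / (\<zeta> * \<zeta>)
        = ((\<nu>\<^sup>2 - 1/4) / \<zeta>\<^sup>2 - 1) * slit f \<zeta> + s * exp ((\<mu> - 1/2) * Ln \<zeta>)"
      by (simp add: w_def slit_def)
  qed
qed

lemma norm_exp_mult_Ln:
  assumes "1 \<le> norm \<zeta>"
  shows "norm (exp (a * Ln \<zeta>)) \<le> exp (pi * \<bar>Im a\<bar>) * norm \<zeta> powr Re a"
    and "exp (- pi * \<bar>Im a\<bar>) * norm \<zeta> powr Re a \<le> norm (exp (a * Ln \<zeta>))"
proof -
  have \<zeta>0: "\<zeta> \<noteq> 0"
    using assms by auto
  have eq: "norm (exp (a * Ln \<zeta>)) = exp (- Im a * Im (Ln \<zeta>)) * norm \<zeta> powr Re a"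
    using \<zeta>0 by (simp add: powr_def exp_add [symmetric] algebra_simps)
  have "\<bar>Im a * Im (Ln \<zeta>)\<bar> \<le> \<bar>Im a\<bar> * pi"
    unfolding abs_mult using Im_Ln_le_pi[OF \<zeta>0] mpi_less_Im_Ln[OF \<zeta>0]
    by (intro mult_left_mono) (auto simp: abs_le_iff)
  then have "- (pi * \<bar>Im a\<bar>) \<le> - Im a * Im (Ln \<zeta>)" "- Im a * Im (Ln \<zeta>) \<le> pi * \<bar>Im a\<bar>"
    by (auto simp: abs_le_iff mult.commute)
  then show "norm (exp (a * Ln \<zeta>)) \<le> exp (pi * \<bar>Im a\<bar>) * norm \<zeta> powr Re a"
    and "exp (- pi * \<bar>Im a\<bar>) * norm \<zeta> powr Re a \<le> norm (exp (a * Ln \<zeta>))"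
    unfolding eq by (auto intro!: mult_right_mono)
qed

text \<open>The right-hand side becomes s \<zeta>^(\<mu> - 1/2), which is O(|\<zeta>|^-2) by Re
  \<mu> <= -3/2; the factor e^(pi |Im \<mu>|) accounts for the argument of \<zeta>.\<close>

lemma slit_solution_slit:
  assumes f: "bessel_eq \<nu> \<mu> s f" and \<mu>: "Re \<mu> \<le> - 3/2"
  shows "slit_solution (slit f) (slit' f) (\<lambda>\<zeta>. s * exp ((\<mu> - 1/2) * Ln \<zeta>)) (\<nu>\<^sup>2 - 1/4)
    (norm s * exp (pi * \<bar>Im \<mu>\<bar>))"
proof
  fix \<zeta> :: complex assume \<zeta>: "\<zeta> \<notin> \<real>\<^sub>\<le>\<^sub>0"
  show "(slit f has_field_derivative slit' f \<zeta>) (at \<zeta>)"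
    using slit_deriv \<zeta> f by (auto simp: bessel_eq_def)
  show "(slit' f has_field_derivative ((\<nu>\<^sup>2 - 1/4) / \<zeta>\<^sup>2 - 1) * slit f \<zeta> + s * exp ((\<mu> - 1/2) * Ln \<zeta>)) (at \<zeta>)"
    by (rule slit'_deriv[OF f \<zeta>])
  assume 1: "1 \<le> norm \<zeta>"
  have "norm \<zeta> powr Re (\<mu> - 1/2) \<le> norm \<zeta> powr (- 2)"
    using 1 \<mu> by (intro powr_mono) auto
  also have "\<dots> = 1 / (norm \<zeta>)\<^sup>2"
    using 1 by (simp add: powr_minus divide_inverse flip: powr_numeral)
  finally have "norm s * (exp (pi * \<bar>Im (\<mu> - 1/2)\<bar>) * norm \<zeta> powr Re (\<mu> - 1/2))
      \<le> norm s * (exp (pi * \<bar>Im (\<mu> - 1/2)\<bar>) * (1 / (norm \<zeta>)\<^sup>2))"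
    by (intro mult_left_mono) auto
  then show "norm (s * exp ((\<mu> - 1/2) * Ln \<zeta>)) \<le> norm s * exp (pi * \<bar>Im \<mu>\<bar>) / (norm \<zeta>)\<^sup>2"
    using mult_left_mono[OF norm_exp_mult_Ln(1)[OF 1, of "\<mu> - 1/2"], of "norm s"] by (simp add: norm_mult)
qed

section \<open>Polynomially many zeros and zero-free discs\<close>

text \<open>Distinct zeros suffice for finding zero-free discs, and a polynomial bound survives
  translations. Finiteness is stated separately because \<open>card\<close> of an infinite set is
  0.\<close>

definition few_zeros :: "(complex \<Rightarrow> complex) \<Rightarrow> bool" where
  "few_zeros f \<longleftrightarrow> (\<exists>K::nat. \<forall>\<^sub>F r in at_top.
     finite {z. norm z \<le> r \<and> f z = 0} \<and> real (card {z. norm z \<le> r \<and> f z = 0}) \<le> r ^ K)"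

lemma few_zeros_shift:
  assumes "few_zeros f" and c: "c \<noteq> 0"
  shows "few_zeros (\<lambda>z. c * f (z + a))"
proof -
  obtain K :: nat where K: "\<forall>\<^sub>F r in at_top.
     finite {z. norm z \<le> r \<and> f z = 0} \<and> real (card {z. norm z \<le> r \<and> f z = 0}) \<le> r ^ K"
    using assms(1) by (auto simp: few_zeros_def)
  have top: "filterlim (\<lambda>r. r + norm a) at_top at_top"
    using filterlim_tendsto_add_at_top[OF tendsto_const[of "norm a"] filterlim_ident] by (simp add: add.commute)
  \<comment> \<open>Eventually r + |a| <= 2 r <= r^2, which is where the exponent doubles.\<close>
  have "\<forall>\<^sub>F r in at_top. finite {z. norm z \<le> r \<and> c * f (z + a) = 0} \<and>
      real (card {z. norm z \<le> r \<and> c * f (z + a) = 0}) \<le> r ^ (2 * K)"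
    using eventually_compose_filterlim[OF K top] eventually_ge_at_top[of 2] eventually_ge_at_top[of "norm a"]
  proof eventually_elim
    case (elim r)
    let ?B = "{z. norm z \<le> r + norm a \<and> f z = 0}"
    have img: "(\<lambda>z. z + a) ` {z. norm z \<le> r \<and> c * f (z + a) = 0} \<subseteq> ?B"
      using c by (auto intro: order_trans[OF norm_triangle_ineq])
    have inj: "inj_on (\<lambda>z. z + a) {z. norm z \<le> r \<and> c * f (z + a) = 0}"
      by (auto simp: inj_on_def)
    have fin: "finite {z. norm z \<le> r \<and> c * f (z + a) = 0}"
      using inj_on_finite[OF inj img] elim by simp
    have "real (card {z. norm z \<le> r \<and> c * f (z + a) = 0}) \<le> real (card ?B)"
      using card_inj_on_le[OF inj img] elim by simp
    also have "\<dots> \<le> (r + norm a) ^ K"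
      using elim by simp
    also have "\<dots> \<le> (r ^ 2) ^ K"
    proof (rule power_mono)
      have "r + norm a \<le> 2 * r" using elim by simp
      also have "\<dots> \<le> r * r" using elim by (intro mult_right_mono) auto
      finally show "r + norm a \<le> r ^ 2" by (simp add: power2_eq_square)
    qed (use elim in auto)
    finally show ?case
      using fin by (simp add: power_mult)
  qed
  then show ?thesis
    unfolding few_zeros_def by blast
qed

text \<open>Pigeonhole: [n, n + 1] is cut into more cells than there are zeros in |z| <= n + 2, so
  the open disc having some cell as a diameter contains no zero.\<close>

lemma zero_free_discs:
  assumes "few_zeros f"
  obtains K :: nat where "\<forall>\<^sub>F n in sequentially. \<exists>c. real n \<le> c \<and> c \<le> real n + 1 \<and>
    (\<forall>z. dist z (of_real c) < 1 / (2 * real n ^ K) \<longrightarrow> f z \<noteq> 0)"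
proof -
  obtain K :: nat where K: "\<forall>\<^sub>F r in at_top.
     finite {z. norm z \<le> r \<and> f z = 0} \<and> real (card {z. norm z \<le> r \<and> f z = 0}) \<le> r ^ K"
    using assms(1) by (auto simp: few_zeros_def)
  have top: "filterlim (\<lambda>n. real n + 2) at_top sequentially"
    using filterlim_tendsto_add_at_top[OF tendsto_const[of 2] filterlim_real_sequentially] by (simp add: add.commute)
  have "\<forall>\<^sub>F n in sequentially. \<exists>c. real n \<le> c \<and> c \<le> real n + 1 \<and>
    (\<forall>z. dist z (of_real c) < 1 / (2 * real n ^ (2 * K + 1)) \<longrightarrow> f z \<noteq> 0)"
    using eventually_compose_filterlim[OF K top] eventually_ge_at_top[of "3::nat"]
  proof eventually_elim
    case (elim n)
    define Z where "Z = {z. norm z \<le> real n + 2 \<and> f z = 0}"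
    \<comment> \<open>The power 2 K + 1 makes N > n^(2 K) >= (n + 2)^K for n >= 3, which exceeds the
      number of zeros.\<close>
    define N where "N = n ^ (2 * K + 1)"
    have N0: "1 \<le> N"
      using elim(2) by (simp add: N_def)
    have finZ: "finite Z"
      using elim(1) by (simp add: Z_def)
    have "real (card Z) \<le> (real n + 2) ^ K"
      using elim(1) by (simp add: Z_def)
    also have "(real n + 2) ^ K \<le> (real n ^ 2) ^ K"
    proof (rule power_mono)
      have "real n + 2 \<le> 3 * real n" using elim(2) by simp
      also have "\<dots> \<le> real n * real n" using elim(2) by (intro mult_right_mono) auto
      finally show "real n + 2 \<le> real n ^ 2" by (simp add: power2_eq_square)
    qed auto
    also have "(real n ^ 2) ^ K < real N"
      using elim(2) by (simp add: N_def power_mult)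
    finally have card: "card Z < N"
      by simp
    define c where "c = (\<lambda>j::nat. real n + (2 * real j + 1) / (2 * real N))"
    have "\<exists>j<N. \<forall>z. dist z (of_real (c j)) < 1 / (2 * real N) \<longrightarrow> f z \<noteq> 0"
    proof (rule ccontr)
      assume "\<not> ?thesis"
      then obtain z where z: "\<And>j. j < N \<Longrightarrow> dist (z j) (of_real (c j)) < 1 / (2 * real N)"
        "\<And>j. j < N \<Longrightarrow> f (z j) = 0"
        by metis
      \<comment> \<open>The open discs lie over disjoint intervals of the real axis, so zeros chosen
        in them are distinct.\<close>
      have Re_z: "real n + real j / N < Re (z j)" "Re (z j) < real n + (real j + 1) / N" if "j < N" for j
      proof -
        have "\<bar>Re (z j) - c j\<bar> < 1 / (2 * real N)"
          using z(1)[OF that] abs_Re_le_cmod[of "z j - of_real (c j)"] by (simp add: dist_norm)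
        then have "c j - 1 / (2 * real N) < Re (z j)" "Re (z j) < c j + 1 / (2 * real N)"
          by (auto simp: abs_less_iff)
        moreover have "c j - 1 / (2 * real N) = real n + real j / N" "c j + 1 / (2 * real N) = real n + (real j + 1) / N"
          using N0 by (auto simp: c_def field_simps)
        ultimately show "real n + real j / N < Re (z j)" "Re (z j) < real n + (real j + 1) / N"
          by auto
      qed
      have lt: "Re (z i) < Re (z j)" if "i < j" "j < N" for i j
      proof -
        have "(real i + 1) / N \<le> real j / N"
          using that by (intro divide_right_mono) auto
        then show ?thesis
          using Re_z(2)[of i] Re_z(1)[of j] that by linarith
      qed
      have inj: "inj_on z {..<N}"
      proof (rule inj_onI)
        fix i j assume "i \<in> {..<N}" "j \<in> {..<N}" "z i = z j"
        then show "i = j"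
          using lt[of i j] lt[of j i] by (cases i j rule: linorder_cases) auto
      qed
      have "z ` {..<N} \<subseteq> Z"
      proof safe
        fix j assume j: "j < N"
        have "1 / (2 * real N) \<le> 1" 
          using N0 by simp
        moreover have "(2 * real j + 1) / (2 * real N) \<le> 1"
          using j by simp
        moreover have "0 \<le> (2 * real j + 1) / (2 * real N)"
          by simp
        moreover have "norm (z j) \<le> norm (complex_of_real (c j)) + dist (z j) (of_real (c j))"
          using norm_triangle_sub[of "z j" "complex_of_real (c j)"] by (simp add: dist_norm)
        ultimately have "norm (z j) \<le> real n + 2"
          using z(1)[OF j] unfolding norm_of_real c_def by linarith
        then show "z j \<in> Z"
          using z(2)[OF j] by (simp add: Z_def)
      qed
      then have "N \<le> card Z"
        using card_inj_on_le[OF inj _ finZ] by simp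
      with card show False by simp
    qed
    then obtain j where j: "j < N" "\<forall>z. dist z (of_real (c j)) < 1 / (2 * real N) \<longrightarrow> f z \<noteq> 0"
      by blast
    have "(2 * real j + 1) / (2 * real N) \<le> 1" "0 \<le> (2 * real j + 1) / (2 * real N)"
      using j by auto
    then show ?case
      using j by (intro exI[of _ "c j"]) (auto simp: c_def N_def)
  qed
  then show ?thesis
    by (rule that)
qed

section \<open>The normal family of m-th roots\<close>

text \<open>Makes any fixed power of R equal to e^(o(m)). As ln R >= ln 2, the hypothesis also
  forces m to infinity.\<close>

lemma ln_over_tendsto_0:
  fixes R m :: "nat \<Rightarrow> real"
  assumes R: "\<And>n. 2 \<le> R n" and m: "\<And>n. 0 < m n" and lim: "(\<lambda>n. ln (R n) / m n) \<longlonglongrightarrow> 0"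
  shows "(\<lambda>n. (a + b * ln (R n)) / m n) \<longlonglongrightarrow> 0"
proof -
  have "(\<lambda>n. 1 / m n) \<longlonglongrightarrow> 0"
  proof (rule Lim_null_comparison)
    show "(\<lambda>n. 1 / ln 2 * (ln (R n) / m n)) \<longlonglongrightarrow> 0"
      by (rule tendsto_mult_right_zero[OF lim])
    show "\<forall>\<^sub>F n in sequentially. norm (1 / m n) \<le> 1 / ln 2 * (ln (R n) / m n)"
    proof (intro always_eventually allI)
      fix n
      have "ln 2 \<le> ln (R n)"
        using R[of n] by simp
      then have "1 / m n \<le> (ln (R n) / ln 2) / m n"
        using m[of n] by (intro divide_right_mono) (auto simp: field_simps)
      then show "norm (1 / m n) \<le> 1 / ln 2 * (ln (R n) / m n)"
        using m[of n] by simp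
    qed
  qed
  from tendsto_add[OF tendsto_mult_right_zero[OF this, of a] tendsto_mult_right_zero[OF lim, of b]]
  show ?thesis
    by (simp add: add_divide_distrib)
qed

text \<open>On the zero-free discs the normalised roots \<open>q n = \<psi>(R + m u)\<^bsup>1/m\<^esup>\<close> form a normal family. A limit \<open>q\<close>
  satisfies \<open>|q(u)| \<le> exp |Im u|\<close>, hence \<open>|q(0)| \<le> 1\<close>; and \<open>|q| \<ge> 1\<close>, since the
  inhomogeneity of the equation is not exponentially small. By the minimum principle \<open>|q| = 1\<close>.\<close>

lemma subexponential_on_zero_free_discs:
  fixes R m :: "nat \<Rightarrow> real" and \<psi> \<psi>' :: "complex \<Rightarrow> complex" and C N :: real
  assumes d1: "\<And>\<zeta>. \<zeta> \<notin> \<real>\<^sub>\<le>\<^sub>0 \<Longrightarrow> (\<psi> has_field_derivative \<psi>' \<zeta>) (at \<zeta>)"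
    and d2: "\<And>\<zeta>. \<zeta> \<notin> \<real>\<^sub>\<le>\<^sub>0 \<Longrightarrow> (\<psi>' has_field_derivative (\<kappa> / \<zeta>\<^sup>2 - 1) * \<psi> \<zeta> + s * exp (\<alpha> * Ln \<zeta>)) (at \<zeta>)"
    and s: "s \<noteq> 0"
    and C: "0 < C" "0 \<le> N"
    and bound: "\<And>\<zeta>. 1 \<le> Re \<zeta> \<Longrightarrow> norm (\<psi> \<zeta>) \<le> C * norm \<zeta> powr N * exp \<bar>Im \<zeta>\<bar>"
    and R: "\<And>n. 2 \<le> R n" and m: "\<And>n. 0 < m n" "\<And>n. m n \<le> R n / 2"
    and lim: "(\<lambda>n. ln (R n) / m n) \<longlonglongrightarrow> 0"
    and nz: "\<And>n \<zeta>. dist (of_real (R n)) \<zeta> < m n \<Longrightarrow> \<psi> \<zeta> \<noteq> 0"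
  obtains r :: "nat \<Rightarrow> nat" where "strict_mono r"
    "\<And>n \<zeta>. dist (of_real (R (r n))) \<zeta> \<le> 3/4 * m (r n) \<Longrightarrow> norm (\<psi> \<zeta>) \<le> exp (m (r n) / 8)"
proof -
  \<comment> \<open>Rescaling of the disc of radius m n about R n to the unit disc.\<close>
  define Z where "Z = (\<lambda>n u. of_real (R n) + of_real (m n) * u :: complex)"
  have Z: "1 \<le> Re (Z n u)" "norm (Z n u) \<le> 2 * R n" "\<bar>Im (Z n u)\<bar> = m n * \<bar>Im u\<bar>" 
    "Z n u \<notin> \<real>\<^sub>\<le>\<^sub>0" "dist (of_real (R n)) (Z n u) < m n" "R n / 2 \<le> norm (Z n u)" if "norm u < 1" for n u
  proof -
    have mu: "norm (of_real (m n) * u) < m n"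
      using that m(1)[of n] by (simp add: norm_mult)
    then show 1: "dist (of_real (R n)) (Z n u) < m n"
      by (simp add: Z_def dist_norm)
    have "R n / 2 \<le> Re (Z n u)"
      using mu abs_Re_le_cmod[of "of_real (m n) * u"] m[of n] R[of n] by (simp add: Z_def)
    then show re: "1 \<le> Re (Z n u)" and "R n / 2 \<le> norm (Z n u)"
      using R[of n] complex_Re_le_cmod[of "Z n u"] by auto
    show "norm (Z n u) \<le> 2 * R n"
      using norm_triangle_ineq[of "of_real (R n)" "of_real (m n) * u"] mu m(2)[of n] R[of n] by (simp add: Z_def)
    show "\<bar>Im (Z n u)\<bar> = m n * \<bar>Im u\<bar>"
      using m(1)[of n] by (simp add: Z_def abs_mult)
    show "Z n u \<notin> \<real>\<^sub>\<le>\<^sub>0"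
      using re by (auto simp: complex_nonpos_Reals_iff)
  qed
  have hol: "(\<lambda>u. \<psi> (Z n u)) holomorphic_on ball 0 1" for n
  proof -
    have "\<psi> holomorphic_on (- \<real>\<^sub>\<le>\<^sub>0)"
      using d1 by (auto simp: holomorphic_on_open closed_nonpos_Reals_complex open_Compl intro: holomorphic_onI)
    then have "\<psi> \<circ> Z n holomorphic_on ball 0 1"
      by (intro holomorphic_on_compose_gen) (use Z(4) in \<open>auto simp: Z_def intro!: holomorphic_intros\<close>)
    then show ?thesis
      by (simp add: o_def)
  qed
  \<comment> \<open>The disc is contractible and \<psi> has no zero there, so a logarithm exists; it
    supplies the root with real exponent m.\<close>
  have "\<exists>l. l holomorphic_on ball 0 1 \<and> (\<forall>u\<in>ball 0 1. \<psi> (Z n u) = exp (l u))" for n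
    using contractible_imp_holomorphic_log[OF hol[of n] convex_imp_contractible[OF convex_ball]] nz[OF Z(5)]
    by (metis mem_ball_0)
  then obtain l where l: "\<And>n. l n holomorphic_on ball 0 1" "\<And>n u. norm u < 1 \<Longrightarrow> \<psi> (Z n u) = exp (l n u)"
    by (metis mem_ball_0)
  define q where "q = (\<lambda>n u. exp (l n u / of_real (m n)))"
  have q_hol: "q n holomorphic_on ball 0 1" for n
    unfolding q_def using m(1)[of n] l(1)[of n] by (auto intro!: holomorphic_intros)
  have q_pow: "norm (\<psi> (Z n u)) = norm (q n u) powr m n" if "norm u < 1" for n u
    using m(1)[of n] by (simp add: q_def l(2)[OF that] powr_def)
  \<comment> \<open>The logarithm of the factor C (2 R)^N, divided by m.\<close>
  define \<epsilon> where "\<epsilon> = (\<lambda>n. (ln C + N * ln 2 + N * ln (R n)) / m n)"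
  have \<epsilon>_lim: "\<epsilon> \<longlonglongrightarrow> 0"
    unfolding \<epsilon>_def by (rule ln_over_tendsto_0[OF R m(1) lim])
  have q_le: "norm (q n u) \<le> exp (\<epsilon> n + \<bar>Im u\<bar>)" if u: "norm u < 1" for n u
  proof -
    have "norm (\<psi> (Z n u)) \<le> C * norm (Z n u) powr N * exp (m n * \<bar>Im u\<bar>)"
      using bound[OF Z(1)[OF u, of n]] by (simp add: Z(3)[OF u])
    also have "\<dots> \<le> C * (2 * R n) powr N * exp (m n * \<bar>Im u\<bar>)"
      using C Z(2)[OF u, of n] by (intro mult_right_mono mult_left_mono powr_mono2) auto
    also have "\<dots> = exp (m n * (\<epsilon> n + \<bar>Im u\<bar>))"
    proof -
      have "m n * \<epsilon> n = ln C + N * ln 2 + N * ln (R n)"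
        using m(1)[of n] by (simp add: \<epsilon>_def)
      then have "exp (m n * \<epsilon> n) = C * (2 * R n) powr N"
        using C R[of n] by (simp add: powr_def exp_add ln_mult distrib_left)
      then show ?thesis
        by (simp add: distrib_left exp_add)
    qed
    finally have "exp (Re (l n u)) \<le> exp (m n * (\<epsilon> n + \<bar>Im u\<bar>))"
      by (simp add: l(2)[OF u])
    then have "Re (l n u) / m n \<le> \<epsilon> n + \<bar>Im u\<bar>"
      using m(1)[of n] by (simp add: field_simps)
    then show ?thesis
      by (simp add: q_def)
  qed
  obtain E where E: "\<And>n. \<epsilon> n \<le> E"
    using convergent_imp_bounded[OF \<epsilon>_lim] by (metis bounded_iff abs_le_D1 rangeI real_norm_def)
  obtain g r where g_hol: "g holomorphic_on ball 0 1" and r: "strict_mono (r :: nat \<Rightarrow> nat)"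
    and g_lim: "\<And>u. u \<in> ball 0 1 \<Longrightarrow> (\<lambda>n. q (r n) u) \<longlonglongrightarrow> g u"
    and g_unif: "\<And>K. compact K \<Longrightarrow> K \<subseteq> ball 0 1 \<Longrightarrow> uniform_limit K (q \<circ> r) g sequentially"
  proof (rule Montel[where S = "ball (0::complex) 1" and \<H> = "range q" and \<F> = q])
    show "\<exists>B. \<forall>h\<in>range q. \<forall>z\<in>K. cmod (h z) \<le> B" if K: "compact K" "K \<subseteq> ball 0 1" for K
    proof (intro exI ballI)
      fix h z assume "h \<in> range q" "z \<in> K"
      then obtain n where h: "h = q n" and z: "norm z < 1"
        using K by auto
      have "norm (q n z) \<le> exp (\<epsilon> n + \<bar>Im z\<bar>)"
        by (rule q_le[OF z])
      also have "\<dots> \<le> exp (E + 1)"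
        using E[of n] z abs_Im_le_cmod[of z] by simp
      finally show "norm (h z) \<le> exp (E + 1)"
        by (simp add: h)
    qed
  qed (use q_hol in auto)
  have r_top: "filterlim r at_top sequentially"
    using r by (rule filterlim_subseq)
  have g_le: "norm (g u) \<le> exp \<bar>Im u\<bar>" if u: "norm u < 1" for u
  proof (rule tendsto_le[OF trivial_limit_sequentially])
    show "(\<lambda>n. norm (q (r n) u)) \<longlonglongrightarrow> norm (g u)"
      using g_lim u by (intro tendsto_norm) simp
    have "(\<lambda>n. exp (\<epsilon> (r n) + \<bar>Im u\<bar>)) \<longlonglongrightarrow> exp (0 + \<bar>Im u\<bar>)"
      by (intro tendsto_intros filterlim_compose[OF \<epsilon>_lim r_top])
    then show "(\<lambda>n. exp (\<epsilon> (r n) + \<bar>Im u\<bar>)) \<longlonglongrightarrow> exp \<bar>Im u\<bar>"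
      by simp
  qed (use q_le[OF u] in auto)
  \<comment> \<open>If |g u0| < 1, then \<psi> is exponentially small in m on a disc of radius
    \<rho> m about the point \<zeta>0 that corresponds to u0. By Cauchy's inequality so is its
    second derivative, and the equation would make s \<zeta>0^\<alpha> equally small, against
    |\<zeta>0| <= 2 R and ln R = o(m).\<close>
  have g_ge: "1 \<le> norm (g u0)" if u0: "norm u0 < 1" for u0
  proof (rule ccontr)
    assume "\<not> 1 \<le> norm (g u0)"
    then obtain \<theta> where \<theta>: "norm (g u0) < \<theta>" "\<theta> < 1"
      using dense by (metis not_le)
    have \<theta>0: "0 < \<theta>"
      using \<theta> norm_ge_zero[of "g u0"] by linarith
    have cont: "isCont g u0"
      using g_hol u0 by (metis holomorphic_on_imp_continuous_on continuous_on_interior interior_ball mem_ball_0)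
    then obtain d where d: "0 < d" "\<And>u. dist u u0 < d \<Longrightarrow> norm (g u) < \<theta>"
      using order_tendstoD(2)[OF tendsto_norm[OF isContD[OF cont]] \<theta>(1)] \<theta>(1)
      unfolding eventually_at by (metis (no_types, lifting) UNIV_I)
    define \<rho> where "\<rho> = min (d / 2) ((1 - norm u0) / 2)"
    have \<rho>: "0 < \<rho>" "\<rho> < d" "norm u0 + \<rho> < 1"
      using d u0 by (auto simp: \<rho>_def min_def field_simps)
    have sub: "cball u0 \<rho> \<subseteq> ball 0 1"
    proof
      fix u assume "u \<in> cball u0 \<rho>"
      then have "norm (u - u0) \<le> \<rho>" by (simp add: dist_norm norm_minus_commute)
      then have "norm u < 1" using \<rho> norm_triangle_sub[of u u0] by linarith
      then show "u \<in> ball 0 1" by simp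
    qed
    define \<theta>' where "\<theta>' = (1 + \<theta>) / 2"
    have \<theta>': "\<theta> < \<theta>'" "\<theta>' < 1" "0 < \<theta>'"
      using \<theta> \<theta>0 by (auto simp: \<theta>'_def)
    have ev_q: "\<forall>\<^sub>F n in sequentially. \<forall>u\<in>cball u0 \<rho>. norm (q (r n) u) \<le> \<theta>'"
    proof -
      have "\<forall>\<^sub>F n in sequentially. \<forall>u\<in>cball u0 \<rho>. dist ((q \<circ> r) n u) (g u) < \<theta>' - \<theta>"
        by (rule uniform_limitD[OF g_unif[OF compact_cball sub]]) (use \<theta>' in simp)
      then show ?thesis
      proof eventually_elim
        case (elim n)
        show ?case
        proof
          fix u assume u: "u \<in> cball u0 \<rho>"
          then have "norm (g u) < \<theta>"
            using d(2)[of u] \<rho> by (simp add: dist_commute)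
          moreover have "norm (q (r n) u - g u) < \<theta>' - \<theta>"
            using elim u by (auto simp: dist_norm)
          ultimately show "norm (q (r n) u) \<le> \<theta>'"
            using norm_triangle_sub[of "q (r n) u" "g u"] by linarith
        qed
      qed
    qed
    \<comment> \<open>Collects Cauchy's constant 2 / \<rho>^2 and the bound 1 + |\<kappa>| for the
      coefficient of \<psi>.\<close>
    define c1 where "c1 = 2 / \<rho>\<^sup>2 + 1 + norm \<kappa>"
    have c1: "0 < c1"
      unfolding c1_def by (intro add_pos_nonneg) (use \<rho> in auto)
    define A where "A = ln c1 - ln (norm s) + pi * \<bar>Im \<alpha>\<bar> + \<bar>Re \<alpha>\<bar> * ln 2"
    have lim2: "(\<lambda>n. (A + \<bar>Re \<alpha>\<bar> * ln (R (r n))) / m (r n)) \<longlonglongrightarrow> 0"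
      using filterlim_compose[OF ln_over_tendsto_0[OF R m(1) lim] r_top] .
    have "\<forall>\<^sub>F n in sequentially. 1 \<le> m (r n)"
    proof -
      have "\<forall>\<^sub>F n in sequentially. ln (R (r n)) / m (r n) < ln 2"
        using order_tendstoD(2)[OF filterlim_compose[OF lim r_top], of "ln 2"] by simp
      then show ?thesis
      proof eventually_elim
        case (elim n)
        have "ln 2 \<le> ln (R (r n))"
          using R[of "r n"] by simp
        also have "ln (R (r n)) < ln 2 * m (r n)"
          using elim m(1)[of "r n"] by (simp add: divide_less_eq)
        finally show ?case by simp
      qed
    qed
    with ev_q have ev: "\<forall>\<^sub>F n in sequentially. - ln \<theta>' \<le> (A + \<bar>Re \<alpha>\<bar> * ln (R (r n))) / m (r n)"
    proof eventually_elim
      case (elim n)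
      define k where "k = r n"
      define \<zeta>0 where "\<zeta>0 = Z k u0"
      have mk: "1 \<le> m k"
        using elim by (simp add: k_def)
      define B where "B = \<theta>' powr m k"
      have \<psi>_le: "norm (\<psi> \<zeta>) \<le> B" if "dist \<zeta>0 \<zeta> \<le> \<rho> * m k" for \<zeta>
      proof -
        define u where "u = (\<zeta> - of_real (R k)) / of_real (m k)"
        have \<zeta>: "\<zeta> = Z k u"
          using mk by (simp add: u_def Z_def)
        have "norm (of_real (m k) * (u0 - u)) \<le> \<rho> * m k"
          using that by (simp add: \<zeta> \<zeta>0_def Z_def dist_norm algebra_simps)
        then have uin: "u \<in> cball u0 \<rho>"
          using mk by (simp add: norm_mult dist_norm mult.commute)
        then have "norm u < 1"
          using sub by auto
        then have "norm (\<psi> \<zeta>) = norm (q k u) powr m k"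
          unfolding \<zeta> by (rule q_pow)
        also have "\<dots> \<le> \<theta>' powr m k"
          using elim uin mk by (intro powr_mono2) (auto simp: k_def)
        finally show ?thesis by (simp add: B_def)
      qed
      have slit: "\<zeta> \<notin> \<real>\<^sub>\<le>\<^sub>0" if "dist \<zeta>0 \<zeta> \<le> \<rho> * m k" for \<zeta>
      proof -
        have "norm (\<zeta> - \<zeta>0) \<le> \<rho> * m k"
          using that by (simp add: dist_norm norm_minus_commute)
        moreover have "norm (\<zeta>0 - of_real (R k)) = m k * norm u0"
          using mk by (simp add: \<zeta>0_def Z_def norm_mult)
        moreover have "norm (\<zeta> - of_real (R k)) \<le> norm (\<zeta> - \<zeta>0) + norm (\<zeta>0 - of_real (R k))"
          using norm_triangle_ineq[of "\<zeta> - \<zeta>0" "\<zeta>0 - of_real (R k)"] by simp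
        moreover have "\<rho> * m k + m k * norm u0 \<le> m k"
          using \<rho> mk mult_right_mono[of "norm u0 + \<rho>" 1 "m k"] by (simp add: algebra_simps)
        ultimately have "norm (\<zeta> - of_real (R k)) \<le> m k"
          by linarith
        then have "\<bar>Re \<zeta> - R k\<bar> \<le> m k"
          using abs_Re_le_cmod[of "\<zeta> - of_real (R k)"] by simp
        then have "0 < Re \<zeta>"
          using m(2)[of k] R[of k] by (simp add: abs_le_iff)
        then show ?thesis
          by (auto simp: complex_nonpos_Reals_iff)
      qed
      have \<rho>m: "0 < \<rho> * m k"
        using \<rho> mk by simp
      have ode: "(deriv ^^ 2) \<psi> \<zeta>0 = (\<kappa> / \<zeta>0\<^sup>2 - 1) * \<psi> \<zeta>0 + s * exp (\<alpha> * Ln \<zeta>0)"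
      proof -
        have "\<forall>\<^sub>F \<zeta> in nhds \<zeta>0. deriv \<psi> \<zeta> = \<psi>' \<zeta>"
          unfolding eventually_nhds_metric using d1 slit \<rho>m
          by (intro exI[of _ "\<rho> * m k"]) (auto simp: dist_commute intro!: DERIV_imp_deriv)
        then have "deriv (deriv \<psi>) \<zeta>0 = deriv \<psi>' \<zeta>0"
          by (rule deriv_cong_ev) simp
        also have "\<dots> = (\<kappa> / \<zeta>0\<^sup>2 - 1) * \<psi> \<zeta>0 + s * exp (\<alpha> * Ln \<zeta>0)"
          using d2[OF slit[of \<zeta>0]] \<rho>m by (intro DERIV_imp_deriv) simp
        finally show ?thesis by (simp add: numeral_2_eq_2)
      qed
      have "norm ((deriv ^^ 2) \<psi> \<zeta>0) \<le> fact 2 * B / (\<rho> * m k)\<^sup>2"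
      proof (rule Cauchy_inequality[OF _ _ \<rho>m])
        have d1': "\<psi> field_differentiable at \<zeta>" if "dist \<zeta>0 \<zeta> \<le> \<rho> * m k" for \<zeta>
          using d1[OF slit[OF that]] by (auto simp: field_differentiable_def)
        show "\<psi> holomorphic_on ball \<zeta>0 (\<rho> * m k)"
          using d1' by (auto simp: holomorphic_on_def intro: field_differentiable_at_within)
        show "continuous_on (cball \<zeta>0 (\<rho> * m k)) \<psi>"
          using d1' by (intro continuous_at_imp_continuous_on) (auto intro: field_differentiable_imp_continuous_at)
        show "norm (\<psi> x) \<le> B" if "norm (\<zeta>0 - x) = \<rho> * m k" for x
          using \<psi>_le that by (simp add: dist_norm)
      qed
      also have "\<dots> = 2 / \<rho>\<^sup>2 * B * (1 / (m k)\<^sup>2)"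
        by (simp add: power_mult_distrib)
      also have "\<dots> \<le> 2 / \<rho>\<^sup>2 * B * 1"
        using mk by (intro mult_left_mono) (auto simp: B_def)
      finally have "norm ((deriv ^^ 2) \<psi> \<zeta>0) \<le> 2 / \<rho>\<^sup>2 * B"
        by simp
      moreover have one: "1 \<le> norm \<zeta>0"
        using Z(1)[OF u0, of k] complex_Re_le_cmod[of \<zeta>0] by (simp add: \<zeta>0_def)
      moreover have "norm ((\<kappa> / \<zeta>0\<^sup>2 - 1) * \<psi> \<zeta>0) \<le> (norm \<kappa> + 1) * B"
      proof -
        have "norm (\<kappa> / \<zeta>0\<^sup>2) \<le> norm \<kappa>"
          using one by (simp add: norm_divide norm_power divide_le_eq mult_le_cancel_left1)
        then have "norm (\<kappa> / \<zeta>0\<^sup>2 - 1) \<le> norm \<kappa> + 1"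
          using norm_triangle_ineq4[of "\<kappa> / \<zeta>0\<^sup>2" 1] by simp
        then show ?thesis
          unfolding norm_mult using \<psi>_le[of \<zeta>0] \<rho>m by (intro mult_mono) auto
      qed
      moreover have "s * exp (\<alpha> * Ln \<zeta>0) = (deriv ^^ 2) \<psi> \<zeta>0 - (\<kappa> / \<zeta>0\<^sup>2 - 1) * \<psi> \<zeta>0"
        by (simp add: ode)
      ultimately have "norm (s * exp (\<alpha> * Ln \<zeta>0)) \<le> 2 / \<rho>\<^sup>2 * B + (norm \<kappa> + 1) * B"
        using norm_triangle_ineq4[of "(deriv ^^ 2) \<psi> \<zeta>0" "(\<kappa> / \<zeta>0\<^sup>2 - 1) * \<psi> \<zeta>0"] by simp
      also have "\<dots> = c1 * B"
        by (simp add: c1_def algebra_simps)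
      finally have up: "norm s * norm (exp (\<alpha> * Ln \<zeta>0)) \<le> c1 * B"
        by (simp add: norm_mult)
      have "exp (- pi * \<bar>Im \<alpha>\<bar>) * (2 * R k) powr (- \<bar>Re \<alpha>\<bar>) \<le> exp (- pi * \<bar>Im \<alpha>\<bar>) * norm \<zeta>0 powr Re \<alpha>"
      proof (intro mult_left_mono)
        have "(2 * R k) powr (- \<bar>Re \<alpha>\<bar>) \<le> norm \<zeta>0 powr (- \<bar>Re \<alpha>\<bar>)"
          using Z(2)[OF u0, of k] one by (intro powr_mono2') (auto simp: \<zeta>0_def)
        also have "\<dots> \<le> norm \<zeta>0 powr Re \<alpha>"
          using one by (intro powr_mono) auto
        finally show "(2 * R k) powr (- \<bar>Re \<alpha>\<bar>) \<le> norm \<zeta>0 powr Re \<alpha>" .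
      qed auto
      also have "\<dots> \<le> norm (exp (\<alpha> * Ln \<zeta>0))"
        by (rule norm_exp_mult_Ln(2)[OF one])
      finally have "norm s * (exp (- pi * \<bar>Im \<alpha>\<bar>) * (2 * R k) powr (- \<bar>Re \<alpha>\<bar>)) \<le> c1 * B"
        using up mult_left_mono[of _ "norm (exp (\<alpha> * Ln \<zeta>0))" "norm s"] by (meson norm_ge_zero order_trans)
      moreover have "norm s * (exp (- pi * \<bar>Im \<alpha>\<bar>) * (2 * R k) powr (- \<bar>Re \<alpha>\<bar>))
          = exp (ln (norm s) - pi * \<bar>Im \<alpha>\<bar> - \<bar>Re \<alpha>\<bar> * (ln 2 + ln (R k)))"
      proof -
        have "(2 * R k) powr (- \<bar>Re \<alpha>\<bar>) = exp (- (\<bar>Re \<alpha>\<bar> * (ln 2 + ln (R k))))"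
          using R[of k] by (simp add: powr_def ln_mult)
        moreover have "norm s = exp (ln (norm s))"
          using s by simp
        ultimately have "norm s * (exp (- pi * \<bar>Im \<alpha>\<bar>) * (2 * R k) powr (- \<bar>Re \<alpha>\<bar>))
            = exp (ln (norm s)) * (exp (- pi * \<bar>Im \<alpha>\<bar>) * exp (- (\<bar>Re \<alpha>\<bar> * (ln 2 + ln (R k)))))"
          by simp
        also have "\<dots> = exp (ln (norm s) - pi * \<bar>Im \<alpha>\<bar> - \<bar>Re \<alpha>\<bar> * (ln 2 + ln (R k)))"
          by (simp only: mult_exp_exp) (simp add: algebra_simps)
        finally show ?thesis .
      qed
      moreover have "c1 * B = exp (ln c1 + m k * ln \<theta>')"
        using c1 \<theta>' by (simp add: B_def powr_def exp_add)
      ultimately have "ln (norm s) - pi * \<bar>Im \<alpha>\<bar> - \<bar>Re \<alpha>\<bar> * (ln 2 + ln (R k)) \<le> ln c1 + m k * ln \<theta>'"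
        by simp
      then have "- ln \<theta>' * m k \<le> A + \<bar>Re \<alpha>\<bar> * ln (R k)"
        by (simp add: A_def algebra_simps)
      then show ?case
        using mk by (simp add: k_def pos_le_divide_eq)
    qed
    have "- ln \<theta>' \<le> 0"
      by (rule tendsto_lowerbound[OF lim2 ev]) simp
    with \<theta>' show False
      by simp
  qed
  \<comment> \<open>|g 0| = 1 while |g| >= 1 throughout, so 1 / g attains its maximum modulus at the
    centre.\<close>
  have "(\<lambda>u. inverse (g u)) constant_on ball 0 1"
  proof (rule maximum_modulus_principle[where U = "ball 0 1" and \<xi> = 0])
    have "g u \<noteq> 0" if "u \<in> ball 0 1" for u
      using g_ge[of u] that by auto
    then show "(\<lambda>u. inverse (g u)) holomorphic_on ball 0 1"
      using g_hol by (intro holomorphic_intros)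
    have "norm (g 0) = 1"
      using g_le[of 0] g_ge[of 0] by simp
    then show "norm (inverse (g u)) \<le> norm (inverse (g 0))" if "u \<in> ball 0 1" for u
      using g_ge[of u] that by (simp add: norm_inverse inverse_le_1_iff)
  qed auto
  then have g_1: "norm (g u) = 1" if "norm u < 1" for u
  proof -
    obtain y where "\<forall>v\<in>ball 0 1. inverse (g v) = y"
      using \<open>(\<lambda>u. inverse (g u)) constant_on ball 0 1\<close> by (auto simp: constant_on_def)
    then have "inverse (g u) = inverse (g 0)"
      using that by (metis centre_in_ball mem_ball_0 zero_less_one)
    then have "g u = g 0" by simp
    then show ?thesis
      using g_le[of 0] g_ge[of 0] by simp
  qed
  \<comment> \<open>The tolerance gives |q| <= 1 + (e^(1/8) - 1) on the disc of radius 3/4, whence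
    |\<psi>| <= e^(m/8).\<close>
  have "\<forall>\<^sub>F n in sequentially. \<forall>u\<in>cball 0 (3/4). dist ((q \<circ> r) n u) (g u) < exp (1/8) - 1"
    by (rule uniform_limitD[OF g_unif]) auto
  then obtain n0 where n0: "\<And>n u. n0 \<le> n \<Longrightarrow> norm u \<le> 3/4 \<Longrightarrow> norm (q (r n) u - g u) < exp (1/8) - 1"
    unfolding eventually_sequentially by (metis comp_apply dist_norm mem_cball_0)
  show ?thesis
  proof (rule that[of "\<lambda>n. r (n + n0)"])
    show "strict_mono (\<lambda>n. r (n + n0))"
      using r by (auto simp: strict_mono_def)
    fix n and \<zeta> :: complex assume dist: "dist (of_real (R (r (n + n0)))) \<zeta> \<le> 3/4 * m (r (n + n0))"
    define k where "k = r (n + n0)"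
    define u where "u = (\<zeta> - of_real (R k)) / of_real (m k)"
    have \<zeta>: "\<zeta> = Z k u"
      using m(1)[of k] by (simp add: u_def Z_def)
    have "norm (of_real (m k) * u) \<le> 3/4 * m k"
      using dist by (simp add: \<zeta> Z_def dist_norm k_def [symmetric])
    then have u: "norm u \<le> 3/4"
      using m(1)[of k] by (simp add: norm_mult mult.commute)
    have "norm (q k u) \<le> exp (1/8)"
      using n0[of "n + n0" u] u g_1[of u] norm_triangle_sub[of "q k u" "g u"] by (simp add: k_def)
    then have "norm (\<psi> \<zeta>) \<le> exp (1/8) powr m k"
      unfolding \<zeta> using q_pow[of u k] u m(1)[of k] by (auto intro!: powr_mono2)
    then show "norm (\<psi> \<zeta>) \<le> exp (m (r (n + n0)) / 8)"
      by (simp add: powr_def k_def)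
  qed
qed

section \<open>The period of the equation and its formal solution\<close>

lemma bessel_eqI:
  assumes "\<And>z. (f has_field_derivative f' z) (at z)" "\<And>z. (f' has_field_derivative f'' z) (at z)"
    and "\<And>z. f'' z + (exp (2 * z) - \<nu>\<^sup>2) * f z = s * exp ((\<mu> + 1) * z)"
  shows "bessel_eq \<nu> \<mu> s f"
proof -
  have "deriv f = f'" "deriv f' = f''"
    using assms(1,2) by (auto simp: fun_eq_iff intro: DERIV_imp_deriv)
  moreover have "f holomorphic_on UNIV"
    using assms(1) by (auto simp: holomorphic_on_open)
  ultimately show ?thesis
    using assms(3) by (simp add: bessel_eq_def numeral_2_eq_2)
qed

lemma bessel_eqD:
  assumes "bessel_eq \<nu> \<mu> s f"
  shows "f holomorphic_on UNIV" "(f has_field_derivative deriv f z) (at z)"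
    "(deriv f has_field_derivative deriv (deriv f) z) (at z)"
    "deriv (deriv f) z + (exp (2 * z) - \<nu>\<^sup>2) * f z = s * exp ((\<mu> + 1) * z)"
  using assms entire_DERIV entire_deriv by (auto simp: bessel_eq_def numeral_2_eq_2)

lemma bessel_eq_diff:
  assumes f: "bessel_eq \<nu> \<mu> s f" and g: "bessel_eq \<nu> \<mu> t g"
  shows "bessel_eq \<nu> \<mu> (s - t) (\<lambda>z. f z - g z)"
proof (rule bessel_eqI)
  show "((\<lambda>z. f z - g z) has_field_derivative deriv f z - deriv g z) (at z)" for z
    by (intro DERIV_diff bessel_eqD(2)[OF f] bessel_eqD(2)[OF g])
  show "((\<lambda>z. deriv f z - deriv g z) has_field_derivative deriv (deriv f) z - deriv (deriv g) z) (at z)" for z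
    by (intro DERIV_diff bessel_eqD(3)[OF f] bessel_eqD(3)[OF g])
  show "deriv (deriv f) z - deriv (deriv g) z + (exp (2 * z) - \<nu>\<^sup>2) * (f z - g z) = (s - t) * exp ((\<mu> + 1) * z)" for z
    using bessel_eqD(4)[OF f, of z] bessel_eqD(4)[OF g, of z] by (simp add: algebra_simps)
qed

text \<open>e^(2 z) has period pi i, and the factor undoes the multiplier e^((\<mu> + 1) pi i) that
  the translation puts on the right-hand side.\<close>

lemma bessel_eq_shift_pi:
  assumes f: "bessel_eq \<nu> \<mu> s f"
  shows "bessel_eq \<nu> \<mu> s (\<lambda>z. exp (- ((\<mu> + 1) * (pi * \<i>))) * f (z + pi * \<i>))"
proof (rule bessel_eqI)
  let ?c = "exp (- ((\<mu> + 1) * (pi * \<i>)))"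
  have 1: "((\<lambda>z. z + pi * \<i>) has_field_derivative 1) (at z)" for z :: complex
    by (auto intro!: derivative_eq_intros)
  show "((\<lambda>z. ?c * f (z + pi * \<i>)) has_field_derivative ?c * deriv f (z + pi * \<i>)) (at z)" for z
    using DERIV_cmult[OF DERIV_chain2[OF bessel_eqD(2)[OF f] 1]] by simp
  show "((\<lambda>z. ?c * deriv f (z + pi * \<i>)) has_field_derivative ?c * deriv (deriv f) (z + pi * \<i>)) (at z)" for z
    using DERIV_cmult[OF DERIV_chain2[OF bessel_eqD(3)[OF f] 1]] by simp
  fix z
  have e: "exp (2 * (z + pi * \<i>)) = exp (2 * z)"
    by (simp add: exp_add distrib_left mult.assoc[symmetric])
  have "?c * deriv (deriv f) (z + pi * \<i>) + (exp (2 * z) - \<nu>\<^sup>2) * (?c * f (z + pi * \<i>))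
      = ?c * (deriv (deriv f) (z + pi * \<i>) + (exp (2 * (z + pi * \<i>)) - \<nu>\<^sup>2) * f (z + pi * \<i>))"
    unfolding e by (simp add: algebra_simps)
  also have "\<dots> = s * (?c * exp ((\<mu> + 1) * (z + pi * \<i>)))"
    unfolding bessel_eqD(4)[OF f] by (simp add: mult_ac)
  also have "?c * exp ((\<mu> + 1) * (z + pi * \<i>)) = exp ((\<mu> + 1) * z)"
    unfolding mult_exp_exp by (simp add: algebra_simps)
  finally show "?c * deriv (deriv f) (z + pi * \<i>) + (exp (2 * z) - \<nu>\<^sup>2) * (?c * f (z + pi * \<i>)) = s * exp ((\<mu> + 1) * z)" .
qed

text \<open>For large \<zeta> the term e^(2 z) f dominates, so s \<zeta>^(\<mu> - 1) leads the
  formal solution; the remainder solves an equation of the same kind with \<mu> lowered by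
  2.\<close>

lemma remove_leading_term:
  assumes f: "bessel_eq \<nu> \<mu> s f"
  shows "bessel_eq \<nu> (\<mu> - 2) (- s * ((\<mu> - 1)\<^sup>2 - \<nu>\<^sup>2)) (\<lambda>z. f z - s * exp ((\<mu> - 1) * z))"
proof (rule bessel_eqI)
  show "((\<lambda>z. f z - s * exp ((\<mu> - 1) * z)) has_field_derivative
      deriv f z - s * ((\<mu> - 1) * exp ((\<mu> - 1) * z))) (at z)" for z
    by (auto intro!: derivative_eq_intros bessel_eqD(2)[OF f])
  show "((\<lambda>z. deriv f z - s * ((\<mu> - 1) * exp ((\<mu> - 1) * z))) has_field_derivative
      deriv (deriv f) z - s * ((\<mu> - 1)\<^sup>2 * exp ((\<mu> - 1) * z))) (at z)" for z
    by (auto intro!: derivative_eq_intros bessel_eqD(3)[OF f] simp: power2_eq_square)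
  fix z
  have e: "exp ((\<mu> + 1) * z) = exp (2 * z) * exp ((\<mu> - 1) * z)"
    by (simp add: mult_exp_exp algebra_simps)
  have e': "exp ((\<mu> - 2 + 1) * z) = exp ((\<mu> - 1) * z)"
    by simp
  have dd: "deriv (deriv f) z = s * exp ((\<mu> + 1) * z) - (exp (2 * z) - \<nu>\<^sup>2) * f z"
    using bessel_eqD(4)[OF f, of z] by (simp add: algebra_simps)
  show "deriv (deriv f) z - s * ((\<mu> - 1)\<^sup>2 * exp ((\<mu> - 1) * z)) + (exp (2 * z) - \<nu>\<^sup>2) * (f z - s * exp ((\<mu> - 1) * z))
      = - s * ((\<mu> - 1)\<^sup>2 - \<nu>\<^sup>2) * exp ((\<mu> - 2 + 1) * z)"
    unfolding dd e e' by (simp only: ring_distribs) (simp add: algebra_simps)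
qed

text \<open>h and s' are chosen before f: two solutions of the same equation get the same finite
  sum, so their difference is the difference of the remainders.\<close>

lemma remove_leading_terms:
  "\<exists>h s'. \<forall>f. bessel_eq \<nu> \<mu> s f \<longrightarrow>
    bessel_eq \<nu> (\<mu> - 2 * of_nat N) s' (\<lambda>z. f z - (\<Sum>k<N. h k * exp ((\<mu> - 1 - 2 * of_nat k) * z)))"
proof (induction N)
  case 0
  show ?case by auto
next
  case (Suc N)
  then obtain h s' where IH: "\<And>f. bessel_eq \<nu> \<mu> s f \<Longrightarrow>
    bessel_eq \<nu> (\<mu> - 2 * of_nat N) s' (\<lambda>z. f z - (\<Sum>k<N. h k * exp ((\<mu> - 1 - 2 * of_nat k) * z)))"
    by blast
  define h' where "h' = h(N := s')"
  have *: "(\<Sum>k<Suc N. h' k * exp ((\<mu> - 1 - 2 * of_nat k) * z)) =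
      (\<Sum>k<N. h k * exp ((\<mu> - 1 - 2 * of_nat k) * z)) + s' * exp ((\<mu> - 2 * of_nat N - 1) * z)" for z
    by (simp add: h'_def algebra_simps)
  have "bessel_eq \<nu> (\<mu> - 2 * of_nat (Suc N)) (- s' * ((\<mu> - 2 * of_nat N - 1)\<^sup>2 - \<nu>\<^sup>2))
     (\<lambda>z. f z - (\<Sum>k<Suc N. h' k * exp ((\<mu> - 1 - 2 * of_nat k) * z)))" if "bessel_eq \<nu> \<mu> s f" for f
    using remove_leading_term[OF IH[OF that]] unfolding * by (simp add: algebra_simps)
  then show ?case
    by blast
qed

lemma slit_exp_sum:
  "slit (\<lambda>z. \<Sum>k<N. h k * exp ((\<mu> - 1 - 2 * of_nat k) * z)) \<zeta> = (\<Sum>k<N. h k * exp ((\<mu> - 1/2 - 2 * of_nat k) * Ln \<zeta>))"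
proof -
  have "exp (Ln \<zeta> / 2) * (h k * exp ((\<mu> - 1 - 2 * of_nat k) * Ln \<zeta>)) = h k * exp ((\<mu> - 1/2 - 2 * of_nat k) * Ln \<zeta>)" for k
    by (simp add: mult.left_commute mult_exp_exp) (simp add: algebra_simps)
  then show ?thesis
    by (simp only: slit_def sum_distrib_left)
qed

lemma slit_exp_sum_le:
  assumes "1 \<le> norm \<zeta>"
  shows "norm (slit (\<lambda>z. \<Sum>k<N. h k * exp ((\<mu> - 1 - 2 * of_nat k) * z)) \<zeta>)
    \<le> (\<Sum>k<N. norm (h k)) * exp (pi * \<bar>Im \<mu>\<bar>) * norm \<zeta> powr \<bar>Re \<mu>\<bar>"
proof -
  have "norm (h k * exp ((\<mu> - 1/2 - 2 * of_nat k) * Ln \<zeta>)) \<le> norm (h k) * (exp (pi * \<bar>Im \<mu>\<bar>) * norm \<zeta> powr \<bar>Re \<mu>\<bar>)" for k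
  proof -
    have "norm (exp ((\<mu> - 1/2 - 2 * of_nat k) * Ln \<zeta>)) \<le> exp (pi * \<bar>Im \<mu>\<bar>) * norm \<zeta> powr Re (\<mu> - 1/2 - 2 * of_nat k)"
      using norm_exp_mult_Ln(1)[OF assms, of "\<mu> - 1/2 - 2 * of_nat k"] by simp
    also have "\<dots> \<le> exp (pi * \<bar>Im \<mu>\<bar>) * norm \<zeta> powr \<bar>Re \<mu>\<bar>"
      using assms by (intro mult_left_mono powr_mono) auto
    finally show ?thesis
      by (simp add: norm_mult mult_left_mono)
  qed
  then show ?thesis
    unfolding slit_exp_sum by (intro order_trans[OF norm_sum]) (auto simp: sum_distrib_right mult.assoc intro!: sum_mono)
qed

text \<open>The exponential function carries zero-free discs about real c to zero-free
  neighbourhoods of R = e^c. Up to constants, m is at least R divided by a power of log R.\<close>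

lemma zero_free_disc_sequence:
  assumes "few_zeros f"
  obtains R m :: "nat \<Rightarrow> real" where "filterlim R at_top sequentially" "\<And>n. 2 \<le> R n"
    "\<And>n. 0 < m n" "\<And>n. m n \<le> R n / 2" "(\<lambda>n. ln (R n) / m n) \<longlonglongrightarrow> 0"
    "\<And>n \<zeta>. dist (of_real (R n)) \<zeta> < m n \<Longrightarrow> slit f \<zeta> \<noteq> 0"
proof -
  obtain K :: nat where "\<forall>\<^sub>F n in sequentially. \<exists>c. real n \<le> c \<and> c \<le> real n + 1 \<and>
    (\<forall>z. dist z (of_real c) < 1 / (2 * real n ^ K) \<longrightarrow> f z \<noteq> 0)"
    using zero_free_discs[OF assms] by blast
  then obtain n0 where n0: "\<And>n. n0 \<le> n \<Longrightarrow> \<exists>c. real n \<le> c \<and> c \<le> real n + 1 \<and>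
    (\<forall>z. dist z (of_real c) < 1 / (2 * real n ^ K) \<longrightarrow> f z \<noteq> 0)"
    by (auto simp: eventually_sequentially)
  \<comment> \<open>The offset skips the finitely many exceptional n and gives j >= 1.\<close>
  define j where "j = (\<lambda>n. n + (n0 + 1))"
  have j1: "1 \<le> j n" for n by (simp add: j_def)
  have "\<exists>c. real (j n) \<le> c \<and> c \<le> real (j n) + 1 \<and>
    (\<forall>z. dist z (of_real c) < 1 / (2 * real (j n) ^ K) \<longrightarrow> f z \<noteq> 0)" for n
    using n0[of "j n"] by (simp add: j_def)
  then obtain c where c: "\<And>n. real (j n) \<le> c n" "\<And>n. c n \<le> real (j n) + 1"
    "\<And>n z. dist z (of_real (c n)) < 1 / (2 * real (j n) ^ K) \<Longrightarrow> f z \<noteq> 0"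
    by metis
  define R where "R = (\<lambda>n. exp (c n))"
  \<comment> \<open>The factor 4, twice the 2 in the radius for z, pays for |Ln(1 + w)| <= 2
    |w|.\<close>
  define m where "m = (\<lambda>n. R n / (4 * real (j n) ^ K))"
  have R0: "0 < R n" for n by (simp add: R_def)
  have jK: "1 \<le> real (j n) ^ K" for n
    using j1[of n] by (intro one_le_power) simp
  have j_top: "filterlim (\<lambda>n. real (j n)) at_top sequentially"
    unfolding j_def by (rule filterlim_compose[OF filterlim_real_sequentially filterlim_add_const_nat_at_top])
  have lim: "(\<lambda>n. ln (R n) / m n) \<longlonglongrightarrow> 0"
  proof (rule Lim_null_comparison)
    have "(\<lambda>n. (real (j n) + 1) ^ (K + 1) / exp (real (j n) + 1)) \<longlonglongrightarrow> 0"
    proof (rule filterlim_compose[OF tendsto_power_div_exp_0])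
      show "filterlim (\<lambda>n. real (j n) + 1) at_top sequentially"
        using filterlim_tendsto_add_at_top[OF tendsto_const[of 1] j_top] by (simp add: add.commute)
    qed
    from tendsto_mult_right_zero[OF this]
    show "(\<lambda>n. (4 * exp 1) * ((real (j n) + 1) ^ (K + 1) / exp (real (j n) + 1))) \<longlonglongrightarrow> 0" .
    show "\<forall>\<^sub>F n in sequentially. norm (ln (R n) / m n) \<le> (4 * exp 1) * ((real (j n) + 1) ^ (K + 1) / exp (real (j n) + 1))"
    proof (intro always_eventually allI)
      fix n
      have c0: "0 \<le> c n"
        using c(1)[of n] by simp
      have "ln (R n) / m n = 4 * (c n * real (j n) ^ K) / exp (c n)"
        by (simp add: R_def m_def)
      also have "\<dots> \<le> 4 * ((real (j n) + 1) * (real (j n) + 1) ^ K) / exp (real (j n))"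
        using c[of n] c0 by (intro frac_le mult_left_mono mult_mono power_mono) auto
      also have "\<dots> = (4 * exp 1) * ((real (j n) + 1) ^ (K + 1) / exp (real (j n) + 1))"
        by (simp add: exp_add)
      finally show "norm (ln (R n) / m n) \<le> (4 * exp 1) * ((real (j n) + 1) ^ (K + 1) / exp (real (j n) + 1))"
        using c0 R0[of n] jK[of n] by (simp add: R_def m_def)
    qed
  qed
  show ?thesis
  proof (rule that[OF _ _ _ _ lim])
    show "filterlim R at_top sequentially"
      unfolding R_def
      by (intro filterlim_compose[OF exp_at_top] filterlim_at_top_mono[OF j_top] always_eventually allI c(1))
    show "2 \<le> R n" for n
    proof -
      have "1 \<le> c n"
        using c(1)[of n] j1[of n] by linarith
      then show ?thesis
        using exp_ge_add_one_self[of "c n"] unfolding R_def by linarith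
    qed
    show "0 < m n" for n
      unfolding m_def using R0[of n] jK[of n] by (intro divide_pos_pos) linarith+
    show "m n \<le> R n / 2" for n
      using R0[of n] jK[of n] unfolding m_def by (intro divide_left_mono) linarith+
    fix n and \<zeta> :: complex assume d: "dist (of_real (R n)) \<zeta> < m n"
    define w where "w = (\<zeta> - R n) / R n"
    have \<zeta>: "\<zeta> = of_real (R n) * (1 + w)"
      using R0[of n] by (simp add: w_def field_simps)
    have "norm (\<zeta> - R n) < m n"
      using d by (simp add: dist_norm norm_minus_commute)
    then have w: "norm w < 1 / (4 * real (j n) ^ K)"
      using R0[of n] by (simp add: w_def norm_divide m_def field_simps)
    also have "\<dots> \<le> 1 / 4"
      using jK[of n] by (intro divide_left_mono) linarith+
    finally have w': "norm w < 1 / 4" .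
    have "1 + w \<noteq> 0"
    proof
      assume "1 + w = 0"
      then have "w = - 1" by (simp add: add_eq_0_iff)
      with w' show False by simp
    qed
    then have "Ln \<zeta> = of_real (c n) + Ln (1 + w)"
      unfolding \<zeta> using R0[of n] by (simp add: Ln_times_of_real R_def Ln_of_real del: exp_of_real)
    then have "dist (Ln \<zeta>) (of_real (c n)) = norm (Ln (1 + w))"
      by (simp add: dist_norm)
    also have "\<dots> \<le> 2 * norm w"
      using w' by (intro norm_Ln_le) simp
    also have "\<dots> < 1 / (2 * real (j n) ^ K)"
      using w by (simp add: field_simps)
    finally show "slit f \<zeta> \<noteq> 0"
      using c(3) by (simp add: slit_def)
  qed
qed

text \<open>\<open>subexponential_on_zero_free_discs\<close> is applied to f with its nonzero s, the
  results on \<open>slit_solution\<close> to the remainder e with its decaying right-hand side. The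
  two differ by a term of power growth, which on the discs is eventually at most a constant times
  e^(m/8).\<close>

lemma few_zeros_imp_bounded:
  assumes f: "bessel_eq \<nu> \<mu> s f" and s: "s \<noteq> 0" and few: "few_zeros f"
    and e: "bessel_eq \<nu> \<mu>' s' (\<lambda>z. f z - (\<Sum>k<N. h k * exp ((\<mu> - 1 - 2 * of_nat k) * z)))" and \<mu>': "Re \<mu>' \<le> - 3/2"
  defines "e \<equiv> \<lambda>z. f z - (\<Sum>k<N. h k * exp ((\<mu> - 1 - 2 * of_nat k) * z))"
  shows "\<exists>T G. \<forall>\<zeta>. T \<le> Re \<zeta> + \<bar>Im \<zeta>\<bar> \<longrightarrow> norm (slit e \<zeta>) \<le> G"
    and "((\<lambda>x. slit e (of_real x)) \<longlongrightarrow> 0) at_top" "((\<lambda>x. slit' e (of_real x)) \<longlongrightarrow> 0) at_top"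
proof -
  define P where "P = (\<lambda>z. \<Sum>k<N. h k * exp ((\<mu> - 1 - 2 * of_nat k) * z))"
  define H where "H = (\<Sum>k<N. norm (h k)) * exp (pi * \<bar>Im \<mu>\<bar>)"
  have H0: "0 \<le> H"
    by (simp add: H_def sum_nonneg)
  have e_eq: "bessel_eq \<nu> \<mu>' s' e"
    using e unfolding e_def .
  interpret S: slit_solution "slit e" "slit' e" "\<lambda>\<zeta>. s' * exp ((\<mu>' - 1/2) * Ln \<zeta>)" "\<nu>\<^sup>2 - 1/4"
    "norm s' * exp (pi * \<bar>Im \<mu>'\<bar>)"
    by (rule slit_solution_slit[OF e_eq \<mu>'])
  have split: "slit f \<zeta> = slit e \<zeta> + slit P \<zeta>" for \<zeta>
    by (simp add: slit_def e_def P_def distrib_left [symmetric])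
  have P_le: "norm (slit P \<zeta>) \<le> H * norm \<zeta> powr \<bar>Re \<mu>\<bar>" if "1 \<le> norm \<zeta>" for \<zeta>
    using slit_exp_sum_le[OF that] unfolding P_def H_def .
  obtain C where C: "0 < C"
    and C_le: "\<And>\<zeta>. 1 \<le> norm \<zeta> \<Longrightarrow> 0 \<le> Re \<zeta> + \<bar>Im \<zeta>\<bar> \<Longrightarrow> norm (slit e \<zeta>) \<le> C * exp \<bar>Im \<zeta>\<bar>"
    using S.exp_Im_bound by metis
  have f_le: "norm (slit f \<zeta>) \<le> (C + H) * norm \<zeta> powr \<bar>Re \<mu>\<bar> * exp \<bar>Im \<zeta>\<bar>" if "1 \<le> Re \<zeta>" for \<zeta>
  proof -
    have one: "1 \<le> norm \<zeta>"
      using that complex_Re_le_cmod[of \<zeta>] by linarith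
    have pw: "1 \<le> norm \<zeta> powr \<bar>Re \<mu>\<bar>"
      using one by (intro ge_one_powr_ge_zero) auto
    have "norm (slit e \<zeta>) \<le> C * exp \<bar>Im \<zeta>\<bar>"
      using C_le[OF one] that by simp
    also have "\<dots> \<le> C * norm \<zeta> powr \<bar>Re \<mu>\<bar> * exp \<bar>Im \<zeta>\<bar>"
      using C pw by (intro mult_right_mono) (auto simp: mult_le_cancel_left1)
    finally have 1: "norm (slit e \<zeta>) \<le> C * norm \<zeta> powr \<bar>Re \<mu>\<bar> * exp \<bar>Im \<zeta>\<bar>" .
    have "norm (slit P \<zeta>) \<le> H * norm \<zeta> powr \<bar>Re \<mu>\<bar> * 1"
      using P_le[OF one] by simp
    also have "\<dots> \<le> H * norm \<zeta> powr \<bar>Re \<mu>\<bar> * exp \<bar>Im \<zeta>\<bar>"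
      using H0 by (intro mult_left_mono) auto
    finally show ?thesis
      unfolding split using 1 by (intro order_trans[OF norm_triangle_ineq]) (simp add: algebra_simps)
  qed
  obtain R m :: "nat \<Rightarrow> real" where R_top: "filterlim R at_top sequentially" and R2: "\<And>n. 2 \<le> R n"
    and m: "\<And>n. 0 < m n" "\<And>n. m n \<le> R n / 2" and lim: "(\<lambda>n. ln (R n) / m n) \<longlonglongrightarrow> 0"
    and nz: "\<And>n \<zeta>. dist (of_real (R n)) \<zeta> < m n \<Longrightarrow> slit f \<zeta> \<noteq> 0"
  proof (rule zero_free_disc_sequence[OF few])
    fix R m :: "nat \<Rightarrow> real"
    assume "filterlim R at_top sequentially" "\<And>n. 2 \<le> R n" "\<And>n. 0 < m n" "\<And>n. m n \<le> R n / 2"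
      "(\<lambda>n. ln (R n) / m n) \<longlonglongrightarrow> 0" "\<And>n \<zeta>. dist (of_real (R n)) \<zeta> < m n \<Longrightarrow> slit f \<zeta> \<noteq> 0"
    then show thesis
      by (rule that)
  qed
  have CH: "0 < C + H"
    using C H0 by simp
  obtain r :: "nat \<Rightarrow> nat" where r: "strict_mono r"
    and sub: "\<And>n \<zeta>. dist (of_real (R (r n))) \<zeta> \<le> 3/4 * m (r n) \<Longrightarrow> norm (slit f \<zeta>) \<le> exp (m (r n) / 8)"
  proof (rule subexponential_on_zero_free_discs[where \<psi> = "slit f" and \<psi>' = "slit' f" and N = "\<bar>Re \<mu>\<bar>"
        and C = "C + H" and R = R and m = m and \<kappa> = "\<nu>\<^sup>2 - 1/4" and s = s and \<alpha> = "\<mu> - 1/2"])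
    show "(slit f has_field_derivative slit' f \<zeta>) (at \<zeta>)" if "\<zeta> \<notin> \<real>\<^sub>\<le>\<^sub>0" for \<zeta>
      by (rule slit_deriv[OF bessel_eqD(1)[OF f] that])
    show "(slit' f has_field_derivative ((\<nu>\<^sup>2 - 1/4) / \<zeta>\<^sup>2 - 1) * slit f \<zeta> + s * exp ((\<mu> - 1/2) * Ln \<zeta>)) (at \<zeta>)"
      if "\<zeta> \<notin> \<real>\<^sub>\<le>\<^sub>0" for \<zeta>
      by (rule slit'_deriv[OF f that])
    show "slit f \<zeta> \<noteq> 0" if "dist (of_real (R n)) \<zeta> < m n" for n \<zeta>
      by (rule nz[OF that])
    fix r :: "nat \<Rightarrow> nat"
    assume "strict_mono r"
      "\<And>n \<zeta>. dist (of_real (R (r n))) \<zeta> \<le> 3/4 * m (r n) \<Longrightarrow> norm (slit f \<zeta>) \<le> exp (m (r n) / 8)"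
    then show thesis
      by (rule that)
  qed (rule s CH abs_ge_zero R2 m lim | (rule f_le, assumption))+
  have r_top: "filterlim r at_top sequentially"
    using r by (rule filterlim_subseq)
  have R'_top: "filterlim (\<lambda>n. R (r n)) at_top sequentially"
    by (rule filterlim_compose[OF R_top r_top])
  have lim': "(\<lambda>n. (a + b * ln (R (r n))) / m (r n)) \<longlonglongrightarrow> 0" for a b
    by (rule filterlim_compose[OF ln_over_tendsto_0[OF R2 m(1) lim] r_top])
  have lim1: "(\<lambda>n. 1 / m (r n)) \<longlonglongrightarrow> 0"
    using lim'[of 1 0] by simp
  have m'_le: "m (r n) \<le> R (r n)" for n
    using m(2)[of "r n"] R2[of "r n"] by linarith
  \<comment> \<open>Discs of radius m/4 about these points stay within 3/4 m of R. There e is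
    O(e^(m/8)), Cauchy's inequality handles its derivative, and e^(-m/2) e^(m/8) tends to 0.\<close>
  have small: "(\<lambda>n. exp (- (m (r n) / 2)) * (norm (slit e (R (r n) - \<iota> * (m (r n) / 2)))
      + norm (slit' e (R (r n) - \<iota> * (m (r n) / 2))))) \<longlonglongrightarrow> 0" if \<iota>: "\<iota> = \<i> \<or> \<iota> = - \<i>" for \<iota> :: complex
  proof (rule Lim_null_comparison)
    show "(\<lambda>n. (1 + H) * (4 * (1 / m (r n))) * (1 + 4 * (1 / m (r n)))) \<longlonglongrightarrow> 0"
      using tendsto_mult[OF tendsto_mult[OF tendsto_const[of "1 + H"] tendsto_mult[OF tendsto_const[of 4] lim1]]
          tendsto_add[OF tendsto_const[of 1] tendsto_mult[OF tendsto_const[of 4] lim1]]] by simp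
    have "\<forall>\<^sub>F n in sequentially. (\<bar>Re \<mu>\<bar> * ln 2 + \<bar>Re \<mu>\<bar> * ln (R (r n))) / m (r n) < 1 / 8"
      by (rule order_tendstoD(2)[OF lim']) simp
    then show "\<forall>\<^sub>F n in sequentially. norm (exp (- (m (r n) / 2)) * (norm (slit e (R (r n) - \<iota> * (m (r n) / 2)))
      + norm (slit' e (R (r n) - \<iota> * (m (r n) / 2))))) \<le> (1 + H) * (4 * (1 / m (r n))) * (1 + 4 * (1 / m (r n)))"
    proof eventually_elim
      case (elim n)
      define k where "k = r n"
      define \<zeta>0 where "\<zeta>0 = R k - \<iota> * (m k / 2)"
      define B where "B = (1 + H) * exp (m k / 8)"
      have mk: "0 < m k" using m(1) .
      have pw: "(2 * R k) powr \<bar>Re \<mu>\<bar> \<le> exp (m k / 8)"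
      proof -
        have "\<bar>Re \<mu>\<bar> * ln 2 + \<bar>Re \<mu>\<bar> * ln (R k) \<le> m k / 8"
          using elim mk by (simp add: k_def field_simps)
        then show ?thesis
          using R2[of k] by (simp add: powr_def ln_mult distrib_left)
      qed
      have near: "dist (of_real (R k)) \<zeta> \<le> 3/4 * m k" if "dist \<zeta>0 \<zeta> \<le> m k / 4" for \<zeta>
      proof -
        have "dist (of_real (R k)) \<zeta>0 = m k / 2"
          using \<iota> mk by (auto simp: \<zeta>0_def dist_norm norm_mult)
        then show ?thesis
          using dist_triangle[of "of_real (R k)" \<zeta> \<zeta>0] that by linarith
      qed
      have geo: "1 \<le> Re \<zeta>" "1 \<le> norm \<zeta>" "norm \<zeta> \<le> 2 * R k" "\<zeta> \<notin> \<real>\<^sub>\<le>\<^sub>0" if "dist \<zeta>0 \<zeta> \<le> m k / 4" for \<zeta>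
      proof -
        have n: "norm (\<zeta> - R k) \<le> 3/4 * m k"
          using near[OF that] by (simp add: dist_norm norm_minus_commute)
        have "\<bar>Re \<zeta> - R k\<bar> \<le> 3/4 * m k"
          using abs_Re_le_cmod[of "\<zeta> - R k"] n by simp
        then show re: "1 \<le> Re \<zeta>"
          using m(2)[of k] R2[of k] unfolding abs_le_iff by linarith
        then show "1 \<le> norm \<zeta>"
          using complex_Re_le_cmod[of \<zeta>] by linarith
        show "norm \<zeta> \<le> 2 * R k"
          using norm_triangle_sub[of \<zeta> "of_real (R k)"] n m(2)[of k] R2[of k] by simp
        show "\<zeta> \<notin> \<real>\<^sub>\<le>\<^sub>0"
          using re by (auto simp: complex_nonpos_Reals_iff)
      qed
      have e_le: "norm (slit e \<zeta>) \<le> B" if "dist \<zeta>0 \<zeta> \<le> m k / 4" for \<zeta>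
      proof -
        have "norm (slit P \<zeta>) \<le> H * norm \<zeta> powr \<bar>Re \<mu>\<bar>"
          by (rule P_le[OF geo(2)[OF that]])
        also have "\<dots> \<le> H * (2 * R k) powr \<bar>Re \<mu>\<bar>"
          using H0 geo[OF that] by (intro mult_left_mono powr_mono2) auto
        also have "\<dots> \<le> H * exp (m k / 8)"
          by (rule mult_left_mono[OF pw H0])
        finally have "norm (slit P \<zeta>) \<le> H * exp (m k / 8)" .
        moreover have "norm (slit f \<zeta>) \<le> exp (m k / 8)"
          using sub[of n \<zeta>] near[OF that] by (simp add: k_def)
        moreover have "norm (slit e \<zeta>) \<le> norm (slit f \<zeta>) + norm (slit P \<zeta>)"
          using norm_triangle_ineq4[of "slit f \<zeta>" "slit P \<zeta>"] split[of \<zeta>] by simp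
        ultimately show ?thesis
          by (simp add: B_def algebra_simps)
      qed
      have e'_le: "norm (slit' e \<zeta>0) \<le> B * (4 / m k)"
      proof -
        have diff: "slit e field_differentiable at \<zeta>" if "dist \<zeta>0 \<zeta> \<le> m k / 4" for \<zeta>
          using S.deriv_\<phi>[OF geo(4)[OF that]] by (auto simp: field_differentiable_def)
        have "norm ((deriv ^^ 1) (slit e) \<zeta>0) \<le> fact 1 * B / (m k / 4) ^ 1"
        proof (rule Cauchy_inequality)
          show "slit e holomorphic_on ball \<zeta>0 (m k / 4)"
            using diff by (auto simp: holomorphic_on_def intro: field_differentiable_at_within)
          show "continuous_on (cball \<zeta>0 (m k / 4)) (slit e)"
            using diff by (intro continuous_at_imp_continuous_on) (auto intro: field_differentiable_imp_continuous_at)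
          show "norm (slit e x) \<le> B" if "norm (\<zeta>0 - x) = m k / 4" for x
            using e_le that by (simp add: dist_norm)
        qed (use mk in simp)
        moreover have "deriv (slit e) \<zeta>0 = slit' e \<zeta>0"
          using S.deriv_\<phi>[OF geo(4)[of \<zeta>0]] mk by (intro DERIV_imp_deriv) simp
        ultimately show ?thesis
          by simp
      qed
      have "norm (slit e \<zeta>0) + norm (slit' e \<zeta>0) \<le> B * (1 + 4 / m k)"
        using e_le[of \<zeta>0] e'_le mk by (simp add: algebra_simps)
      then have "exp (- (m k / 2)) * (norm (slit e \<zeta>0) + norm (slit' e \<zeta>0)) \<le> exp (- (m k / 2)) * (B * (1 + 4 / m k))"
        by (rule mult_left_mono) simp
      also have "\<dots> = (1 + H) * (exp (- (m k / 2)) * exp (m k / 8)) * (1 + 4 / m k)"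
        by (simp only: B_def mult_ac)
      also have "exp (- (m k / 2)) * exp (m k / 8) = exp (- (3 / 8 * m k))"
        by (simp add: mult_exp_exp)
      also have "(1 + H) * exp (- (3 / 8 * m k)) * (1 + 4 / m k) \<le> (1 + H) * (4 / m k) * (1 + 4 / m k)"
      proof (intro mult_right_mono mult_left_mono)
        have "m k / 4 \<le> exp (3 / 8 * m k)"
          using exp_ge_add_one_self[of "3 / 8 * m k"] mk by linarith
        then have "inverse (exp (3 / 8 * m k)) \<le> inverse (m k / 4)"
          using mk by (intro le_imp_inverse_le) auto
        then show "exp (- (3 / 8 * m k)) \<le> 4 / m k"
          by (simp add: exp_minus)
      qed (use H0 mk in auto)
      finally show ?case
        by (simp add: k_def \<zeta>0_def)
    qed
  qed
  show "\<exists>T G. \<forall>\<zeta>. T \<le> Re \<zeta> + \<bar>Im \<zeta>\<bar> \<longrightarrow> norm (slit e \<zeta>) \<le> G"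
    using S.solution_bounded[OF R'_top m(1) m'_le small] by blast
  show "((\<lambda>x. slit e (of_real x)) \<longlongrightarrow> 0) at_top" "((\<lambda>x. slit' e (of_real x)) \<longlongrightarrow> 0) at_top"
    using S.solution_tendsto_0[OF R'_top m(1) m'_le small] by blast+
qed

text \<open>For s = 0 the equation is the same for every \<mu>, and -2 meets the hypothesis of
  \<open>slit_solution_slit\<close>. So d vanishes for real z >= 0 by
  \<open>homogeneous_eq_0\<close>, and everywhere by the identity theorem.\<close>

lemma slit_solution_tendsto_0_eq_0:
  assumes d: "bessel_eq \<nu> \<mu> 0 d"
    and lim: "((\<lambda>x. slit d (of_real x)) \<longlongrightarrow> 0) at_top" "((\<lambda>x. slit' d (of_real x)) \<longlongrightarrow> 0) at_top"
  shows "d z = 0"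
proof -
  have d': "bessel_eq \<nu> (- 2) 0 d"
    using d by (simp add: bessel_eq_def)
  interpret S: slit_solution "slit d" "slit' d" "\<lambda>\<zeta>. 0 * exp ((- 2 - 1/2) * Ln \<zeta>)" "\<nu>\<^sup>2 - 1/4"
    "norm (0::complex) * exp (pi * \<bar>Im (- 2)\<bar>)"
    by (rule slit_solution_slit[OF d']) simp
  have zero: "d (of_real x) = 0" if "0 \<le> x" for x
  proof -
    have "slit d (of_real (exp x)) = 0"
      using that by (intro S.homogeneous_eq_0 lim) auto
    then show ?thesis
      by (simp add: slit_def Ln_of_real del: exp_of_real)
  qed
  show ?thesis
  proof (rule analytic_continuation[where f = d and w = z and S = UNIV and U = "complex_of_real ` {0..}" and \<xi> = "0::complex"])
    show "d holomorphic_on UNIV"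
      using d by (rule bessel_eqD)
    show "(0::complex) islimpt complex_of_real ` {0..}"
      unfolding islimpt_approachable
    proof (intro allI impI)
      fix e :: real assume "0 < e"
      then show "\<exists>x'\<in>complex_of_real ` {0..}. x' \<noteq> 0 \<and> dist x' (0::complex) < e"
        by (intro bexI[of _ "of_real (e / 2)"]) (auto simp: norm_divide simp del: of_real_divide)
    qed
  qed (use zero in auto)
qed

lemma bessel_eq_0_iff:
  assumes "bessel_eq \<nu> \<mu> s f" "\<And>z. f z = 0"
  shows "s = 0"
proof -
  have "f = (\<lambda>_. 0)"
    using assms(2) by auto
  then have "s * exp ((\<mu> + 1) * 0) = 0"
    using bessel_eqD(4)[OF assms(1), of 0] by simp
  then show ?thesis
    by simp
qed

section \<open>Growth near \<zeta> = 0 and reduction to a Laurent polynomial\<close>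

lemma norm_exp_mult_le:
  assumes "\<bar>Im z\<bar> \<le> pi / 2"
  shows "norm (exp (a * z)) \<le> exp (pi * \<bar>Im a\<bar>) * exp (\<bar>Re a\<bar> * \<bar>Re z\<bar>)"
proof -
  have "Re a * Re z \<le> \<bar>Re a\<bar> * \<bar>Re z\<bar>"
    by (metis abs_ge_self abs_mult)
  moreover have "- (Im a * Im z) \<le> \<bar>Im a\<bar> * \<bar>Im z\<bar>"
    by (metis abs_ge_minus_self abs_mult)
  moreover have "\<bar>Im a\<bar> * \<bar>Im z\<bar> \<le> \<bar>Im a\<bar> * pi"
    using assms by (intro mult_left_mono) auto
  ultimately have "Re (a * z) \<le> pi * \<bar>Im a\<bar> + \<bar>Re a\<bar> * \<bar>Re z\<bar>"
    by (simp add: mult.commute)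
  then show ?thesis
    unfolding mult_exp_exp norm_exp_eq_Re by simp
qed

text \<open>The pointwise inequality of \<open>growth_left\<close>: U, V, W are the moduli of f and
  its first two derivatives, X and Y come from differentiating U^2 and V^2, and S e bounds the
  right-hand side of the equation.\<close>

lemma energy_arith:
  fixes S c n U V W X Y e :: real
  assumes "0 \<le> S" "0 \<le> c" "0 \<le> n" and "V * W \<le> V * (S * e + (1 + n) * U)" "\<bar>Y\<bar> \<le> V * W" "\<bar>X\<bar> \<le> U * V"
  shows "- ((2 + n + S + 2 * c) * (U\<^sup>2 + V\<^sup>2 + e\<^sup>2)) \<le> 2 * X + 2 * Y + - (2 * c) * e\<^sup>2"
proof -
  have "(2 + n) * (2 * U * V) \<le> (2 + n) * (U\<^sup>2 + V\<^sup>2)"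
    using assms by (intro mult_left_mono sum_squares_bound) auto
  moreover have "S * (2 * V * e) \<le> S * (V\<^sup>2 + e\<^sup>2)"
    using assms by (intro mult_left_mono sum_squares_bound)
  moreover have "0 \<le> S * U\<^sup>2 + (2 + n) * e\<^sup>2 + 2 * c * (U\<^sup>2 + V\<^sup>2)"
    using assms by (intro add_nonneg_nonneg mult_nonneg_nonneg) auto
  ultimately show ?thesis
    using assms(4-6) unfolding abs_le_iff by (simp add: algebra_simps)
qed

text \<open>For Re z <= 0 the coefficient e^(2 z) - \<nu>^2 is bounded, so the energy grows at most
  exponentially as Re z decreases. The summand exp(-2 c t) of the energy controls the right-hand
  side. The strip is one period of e^(2 z).\<close>

lemma growth_left:
  assumes f: "bessel_eq \<nu> \<mu> s f"
  shows "\<exists>C k. \<forall>z. Re z \<le> 0 \<and> \<bar>Im z\<bar> \<le> pi / 2 \<longrightarrow> norm (f z) \<le> C * exp (k * \<bar>Re z\<bar>)"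
proof -
  define c where "c = \<bar>Re (\<mu> + 1)\<bar>"
  define S where "S = norm s * exp (pi * \<bar>Im \<mu>\<bar>)"
  define k where "k = 2 + (norm \<nu>)\<^sup>2 + S + 2 * c"
  have S0: "0 \<le> S" and c0: "0 \<le> c"
    by (auto simp: S_def c_def)
  have cf: "continuous_on UNIV f" "continuous_on UNIV (deriv f)"
    by (rule holomorphic_on_imp_continuous_on[OF bessel_eqD(1)[OF f]]
        holomorphic_on_imp_continuous_on[OF entire_deriv[OF bessel_eqD(1)[OF f]]])+
  have ci: "continuous_on {- (pi/2)..pi/2} (\<lambda>y. \<i> * complex_of_real y)"
    by (intro continuous_intros)
  define F where "F = (\<lambda>y::real. (norm (f (\<i> * of_real y)))\<^sup>2 + (norm (deriv f (\<i> * of_real y)))\<^sup>2 + 1)"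
  have "compact (F ` {- (pi/2)..pi/2})"
    unfolding F_def
    by (rule compact_continuous_image[OF _ compact_Icc], intro continuous_on_add continuous_on_power continuous_on_norm
        continuous_on_const continuous_on_compose2[OF cf(1) ci] continuous_on_compose2[OF cf(2) ci]) auto
  then have "bounded (F ` {- (pi/2)..pi/2})"
    by (rule compact_imp_bounded)
  then obtain B where B': "\<forall>x\<in>F ` {- (pi/2)..pi/2}. norm x \<le> B"
    unfolding bounded_iff ..
  have B: "F y \<le> B" if "\<bar>y\<bar> \<le> pi/2" for y
  proof -
    have "y \<in> {- (pi/2)..pi/2}"
      using that unfolding abs_le_iff by simp
    then have "norm (F y) \<le> B"
      using B' by blast
    then show ?thesis
      by simp
  qed
  have B1: "1 \<le> B"
  proof -
    have "1 \<le> F 0"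
      unfolding F_def by simp
    also have "\<dots> \<le> B"
      using B[of 0] by simp
    finally show ?thesis .
  qed
  have main: "norm (f z) \<le> sqrt B * exp (k / 2 * \<bar>Re z\<bar>)" if z: "Re z \<le> 0" "\<bar>Im z\<bar> \<le> pi / 2" for z
  proof -
    define p where "p = \<i> * of_real (Im z)"
    define u where "u = (\<lambda>t::real. f (p + of_real t * 1))"
    define v where "v = (\<lambda>t::real. deriv f (p + of_real t * 1))"
    define v' where "v' = (\<lambda>t::real. deriv (deriv f) (p + of_real t * 1))"
    define E where "E = (\<lambda>t. (norm (u t))\<^sup>2 + (norm (v t))\<^sup>2 + exp (- (2 * c) * t))"
    have du: "(u has_vector_derivative v t) (at t)" for t
      unfolding u_def v_def
      using has_vector_derivative_along_line[OF bessel_eqD(2)[OF f], where p = p and t = t and d = 1] by simp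
    have dv: "(v has_vector_derivative v' t) (at t)" for t
      unfolding v_def v'_def
      using has_vector_derivative_along_line[OF bessel_eqD(3)[OF f], where p = p and t = t and d = 1] by simp
    have "E (Re z) \<le> E 0 * exp (k * 0 - k * Re z)"
    proof (rule exp_bound_of_deriv_ge[where k' = "\<lambda>t. k" and E' = "\<lambda>t. 2 * Re (cnj (u t) * v t) 
          + 2 * Re (cnj (v t) * v' t) + - (2 * c) * exp (- (2 * c) * t)"])
      fix t assume t: "Re z \<le> t" "t \<le> 0"
      show "(E has_real_derivative 2 * Re (cnj (u t) * v t) + 2 * Re (cnj (v t) * v' t)
          + - (2 * c) * exp (- (2 * c) * t)) (at t)"
        unfolding E_def
        by (intro DERIV_add has_real_derivative_cmod_sq du dv) (auto intro!: derivative_eq_intros)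
      show "((*) k has_real_derivative k) (at t)"
        by (rule DERIV_cmult_Id)
      define w where "w = p + complex_of_real t * 1"
      define e where "e = exp (- c * t)"
      have w: "Re w = t" "Im w = Im z"
        by (auto simp: w_def p_def)
      have e2: "exp (- (2 * c) * t) = e\<^sup>2"
        by (simp add: e_def exp_double [symmetric] algebra_simps)
      have v'_eq: "v' t = s * exp ((\<mu> + 1) * w) - (exp (2 * w) - \<nu>\<^sup>2) * u t"
        using bessel_eqD(4)[OF f, of w] by (simp add: v'_def u_def w_def algebra_simps)
      have "norm (exp ((\<mu> + 1) * w)) \<le> exp (pi * \<bar>Im (\<mu> + 1)\<bar>) * exp (\<bar>Re (\<mu> + 1)\<bar> * \<bar>Re w\<bar>)"
        by (rule norm_exp_mult_le) (use z w in simp)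
      also have "\<dots> = exp (pi * \<bar>Im \<mu>\<bar>) * e"
        using t by (simp add: w e_def c_def)
      finally have "norm s * norm (exp ((\<mu> + 1) * w)) \<le> norm s * (exp (pi * \<bar>Im \<mu>\<bar>) * e)"
        by (rule mult_left_mono) simp
      then have rhs: "norm (s * exp ((\<mu> + 1) * w)) \<le> S * e"
        by (simp add: S_def norm_mult)
      have "norm (exp (2 * w) - \<nu>\<^sup>2) \<le> 1 + (norm \<nu>)\<^sup>2"
        using norm_triangle_ineq4[of "exp (2 * w)" "\<nu>\<^sup>2"] t w by (simp add: norm_power) (smt (verit) exp_le_one_iff)
      then have "norm ((exp (2 * w) - \<nu>\<^sup>2) * u t) \<le> (1 + (norm \<nu>)\<^sup>2) * norm (u t)"
        unfolding norm_mult by (rule mult_right_mono) simp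
      with rhs have "norm (v' t) \<le> S * e + (1 + (norm \<nu>)\<^sup>2) * norm (u t)"
        unfolding v'_eq by (intro order_trans[OF norm_triangle_ineq4] add_mono)
      then have 1: "norm (v t) * norm (v' t) \<le> norm (v t) * (S * e + (1 + (norm \<nu>)\<^sup>2) * norm (u t))"
        by (rule mult_left_mono) simp
      have 2: "\<bar>Re (cnj (v t) * v' t)\<bar> \<le> norm (v t) * norm (v' t)" "\<bar>Re (cnj (u t) * v t)\<bar> \<le> norm (u t) * norm (v t)"
        using abs_Re_le_cmod[of "cnj (v t) * v' t"] abs_Re_le_cmod[of "cnj (u t) * v t"]
        by (simp_all only: norm_mult complex_mod_cnj)
      show "- (k * E t) \<le> 2 * Re (cnj (u t) * v t) + 2 * Re (cnj (v t) * v' t) + - (2 * c) * exp (- (2 * c) * t)"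
        unfolding E_def e2 k_def by (rule energy_arith[OF S0 c0 _ 1 2]) simp
    qed (use z in auto)
    also have "\<dots> \<le> B * exp (k * \<bar>Re z\<bar>)"
    proof (rule mult_mono)
      show "E 0 \<le> B"
        using B[OF z(2)] by (simp add: E_def u_def v_def p_def F_def)
    qed (use z B1 in auto)
    finally have E_le: "E (Re z) \<le> B * exp (k * \<bar>Re z\<bar>)" .
    have "p + of_real (Re z) * 1 = z"
      by (simp add: p_def complex_eq_iff)
    then have "(norm (f z))\<^sup>2 \<le> E (Re z)"
      by (simp add: E_def u_def add_nonneg_nonneg)
    also have "\<dots> \<le> B * exp (k * \<bar>Re z\<bar>)"
      by (rule E_le)
    also have "\<dots> = (sqrt B * exp (k / 2 * \<bar>Re z\<bar>))\<^sup>2"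
      using B1 by (simp add: power_mult_distrib exp_double [symmetric])
    finally show ?thesis
      using B1 by (intro power2_le_imp_le[of "norm (f z)"]) auto
  qed
  show ?thesis
    using main by blast
qed

text \<open>With \<omega> = e^(2 z), the principal logarithm gives H off the negative axis; off the
  positive axis the branch Ln(-\<omega>) + pi i gives the same function, by periodicity.\<close>

lemma periodic_extension:
  fixes k :: "complex \<Rightarrow> complex"
  assumes hol: "k holomorphic_on UNIV" and per: "\<And>z. k (z + pi * \<i>) = k z"
  obtains H where "H holomorphic_on (- {0})" "\<And>z. H (exp (2 * z)) = k z"
proof -
  define H where "H = (\<lambda>\<omega>. k (Ln \<omega> / 2))"
  have per_nat: "k (z + of_nat n * (pi * \<i>)) = k z" for z n
  proof (induction n)
    case (Suc n)
    show ?case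
      using per[of "z + of_nat n * (pi * \<i>)"] Suc by (simp add: algebra_simps)
  qed auto
  have per_int: "k (z + of_int n * (pi * \<i>)) = k z" for z n
  proof (cases "0 \<le> n")
    case True
    then show ?thesis using per_nat[of z "nat n"] by simp
  next
    case False
    then show ?thesis using per_nat[of "z + of_int n * (pi * \<i>)" "nat (- n)"] by simp
  qed
  have H: "H (exp (2 * z)) = k z" for z
  proof -
    have "exp (Ln (exp (2 * z))) = exp (2 * z)"
      by simp
    then obtain n :: int where "Ln (exp (2 * z)) = 2 * z + (of_int (2 * n) * pi) * \<i>"
      unfolding exp_eq by auto
    then have "Ln (exp (2 * z)) / 2 = z + of_int n * (pi * \<i>)"
      by simp
    then show ?thesis
      unfolding H_def using per_int by metis
  qed
  have 1: "H holomorphic_on - \<real>\<^sub>\<le>\<^sub>0"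
    unfolding H_def
    by (rule holomorphic_on_compose_gen[OF _ hol, unfolded o_def]) (auto intro!: holomorphic_intros)
  have 2: "H holomorphic_on {\<omega>. - \<omega> \<notin> \<real>\<^sub>\<le>\<^sub>0}"
  proof (rule holomorphic_transform)
    show "(\<lambda>\<omega>. k ((Ln (- \<omega>) + pi * \<i>) / 2)) holomorphic_on {\<omega>. - \<omega> \<notin> \<real>\<^sub>\<le>\<^sub>0}"
      by (rule holomorphic_on_compose_gen[OF _ hol, unfolded o_def]) (auto intro!: holomorphic_intros)
    fix \<omega> :: complex assume "\<omega> \<in> {\<omega>. - \<omega> \<notin> \<real>\<^sub>\<le>\<^sub>0}"
    then have "\<omega> \<noteq> 0" by auto
    then have "exp (Ln (- \<omega>) + pi * \<i>) = \<omega>"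
      by (simp add: exp_add)
    moreover have "2 * ((Ln (- \<omega>) + pi * \<i>) / 2) = Ln (- \<omega>) + pi * \<i>"
      by simp
    ultimately have "exp (2 * ((Ln (- \<omega>) + pi * \<i>) / 2)) = \<omega>"
      by (simp only:)
    then show "k ((Ln (- \<omega>) + pi * \<i>) / 2) = H \<omega>"
      using H by metis
  qed
  have "open {\<omega>::complex. - \<omega> \<notin> \<real>\<^sub>\<le>\<^sub>0}"
  proof -
    have "{\<omega>::complex. - \<omega> \<notin> \<real>\<^sub>\<le>\<^sub>0} = uminus -` (- \<real>\<^sub>\<le>\<^sub>0)" by auto
    then show ?thesis
      by (auto intro!: open_vimage continuous_intros)
  qed
  with 1 2 have "H holomorphic_on (- \<real>\<^sub>\<le>\<^sub>0 \<union> {\<omega>. - \<omega> \<notin> \<real>\<^sub>\<le>\<^sub>0})"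
    by (intro holomorphic_on_Un) auto
  moreover have "- {0} \<subseteq> - \<real>\<^sub>\<le>\<^sub>0 \<union> {\<omega>::complex. - \<omega> \<notin> \<real>\<^sub>\<le>\<^sub>0}"
    by (auto simp: complex_nonpos_Reals_iff complex_eq_iff)
  ultimately have "H holomorphic_on - {0}"
    by (rule holomorphic_on_subset)
  with H show ?thesis
    using that by blast
qed

text \<open>Multiplication by \<omega>^M removes the singularity at 0; then Liouville's theorem for
  polynomial growth applies.\<close>

lemma laurent_polynomial_of_growth:
  fixes H :: "complex \<Rightarrow> complex"
  assumes hol: "H holomorphic_on (- {0})"
    and large: "\<And>\<omega>. A \<le> norm \<omega> \<Longrightarrow> norm (H \<omega>) \<le> C * norm \<omega> powr c"
    and small: "\<And>\<omega>. \<omega> \<noteq> 0 \<Longrightarrow> norm \<omega> \<le> 1 \<Longrightarrow> norm (H \<omega>) \<le> C' * norm \<omega> powr (- c')"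
  obtains M :: nat and Q :: "complex poly" where "\<And>\<omega>. \<omega> \<noteq> 0 \<Longrightarrow> \<omega> ^ M * H \<omega> = poly Q \<omega>"
proof -
  define M where "M = nat \<lceil>c'\<rceil>"
  have c'_le: "c' \<le> real M"
    unfolding M_def by linarith
  define n where "n = M + nat \<lceil>c\<rceil>"
  have c_le: "real M + c \<le> real n"
    unfolding n_def by linarith
  have "(\<lambda>\<omega>. \<omega> ^ M * H \<omega>) holomorphic_on (UNIV - {0})"
    using hol by (auto intro!: holomorphic_intros simp: Compl_eq_Diff_UNIV)
  moreover have "\<exists>B. \<forall>\<^sub>F \<omega> in at 0. norm (\<omega> ^ M * H \<omega>) \<le> B"
  proof (intro exI)
    show "\<forall>\<^sub>F \<omega> in at 0. norm (\<omega> ^ M * H \<omega>) \<le> \<bar>C'\<bar>"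
      unfolding eventually_at
    proof (intro exI[of _ 1] conjI ballI impI)
      fix \<omega> :: complex assume \<omega>: "\<omega> \<noteq> 0 \<and> dist \<omega> 0 < 1"
      then have \<omega>0: "0 < norm \<omega>" and \<omega>1: "norm \<omega> \<le> 1" by auto
      have "norm (\<omega> ^ M * H \<omega>) \<le> norm \<omega> ^ M * (C' * norm \<omega> powr (- c'))"
        unfolding norm_mult norm_power using small \<omega>0 \<omega>1 by (intro mult_left_mono) auto
      also have "\<dots> = C' * norm \<omega> powr (real M - c')"
        using \<omega>0 by (simp add: powr_diff powr_minus powr_realpow field_simps)
      also have "\<dots> \<le> \<bar>C'\<bar> * 1"
        using \<omega>0 \<omega>1 c'_le by (intro mult_mono powr_le1) auto
      finally show "norm (\<omega> ^ M * H \<omega>) \<le> \<bar>C'\<bar>" by simp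
    qed auto
  qed
  ultimately obtain g where g: "g holomorphic_on UNIV" "\<And>\<omega>. \<omega> \<noteq> 0 \<Longrightarrow> g \<omega> = \<omega> ^ M * H \<omega>"
    using holomorphic_on_extend_bounded[of "\<lambda>\<omega>. \<omega> ^ M * H \<omega>" UNIV 0] by auto
  have bnd: "norm (g \<omega>) \<le> \<bar>C\<bar> * norm \<omega> ^ n" if "max 1 A \<le> norm \<omega>" for \<omega> :: complex
  proof -
    have \<omega>1: "1 \<le> norm \<omega>" and \<omega>A: "A \<le> norm \<omega>" and \<omega>0: "\<omega> \<noteq> 0"
      using that by auto
    have "norm (g \<omega>) \<le> norm \<omega> ^ M * (C * norm \<omega> powr c)"
      unfolding g(2)[OF \<omega>0] norm_mult norm_power using large[OF \<omega>A] by (intro mult_left_mono) auto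
    also have "\<dots> = C * norm \<omega> powr (real M + c)"
      using \<omega>0 by (simp add: powr_add powr_realpow)
    also have "\<dots> \<le> \<bar>C\<bar> * norm \<omega> powr (real n)"
      using \<omega>1 c_le by (intro mult_mono powr_mono) auto
    finally show ?thesis
      using \<omega>0 by (simp add: powr_realpow)
  qed
  have liou: "g \<omega> = (\<Sum>k\<le>n. (deriv ^^ k) g 0 / fact k * \<omega> ^ k)" for \<omega>
    by (rule Liouville_polynomial[OF g(1), of "max 1 A" "\<bar>C\<bar>" n]) (rule bnd)
  define Q where "Q = (\<Sum>k\<le>n. monom ((deriv ^^ k) g 0 / fact k) k)"
  have "g \<omega> = poly Q \<omega>" for \<omega>
    using liou[of \<omega>] by (simp add: Q_def poly_sum poly_monom)
  then show ?thesis
    using that[of M Q] g(2) by simp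
qed

lemma slit'_diff:
  assumes "f holomorphic_on UNIV" "g holomorphic_on UNIV"
  shows "slit' (\<lambda>z. f z - g z) \<zeta> = slit' f \<zeta> - slit' g \<zeta>"
proof -
  have "deriv (\<lambda>z. f z - g z) = (\<lambda>w. deriv f w - deriv g w)"
    by (intro ext DERIV_imp_deriv DERIV_diff entire_DERIV assms)
  then show ?thesis
    by (simp only: slit'_def) (simp add: algebra_simps diff_divide_distrib add_divide_distrib)
qed

lemma few_zeros_imp_exp_polynomial:
  assumes f: "bessel_eq \<nu> \<mu> s f" and s: "s \<noteq> 0" and few: "few_zeros f"
  obtains M :: nat and Q :: "complex poly" where
    "\<And>z. f z = exp ((\<mu> - 1 - 2 * of_nat M) * z) * poly Q (exp (2 * z))"
proof -
  obtain N0 :: nat where N0: "\<bar>Re \<mu>\<bar> \<le> real N0"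
    using real_arch_simple by blast
  \<comment> \<open>Enough terms for Re \<mu> - 2 N <= -3/2.\<close>
  define N where "N = N0 + 1"
  have N: "Re (\<mu> - 2 * of_nat N) \<le> - 3/2"
    using N0 by (simp add: N_def)
  obtain h s' where h: "\<And>f. bessel_eq \<nu> \<mu> s f \<Longrightarrow>
    bessel_eq \<nu> (\<mu> - 2 * of_nat N) s' (\<lambda>z. f z - (\<Sum>k<N. h k * exp ((\<mu> - 1 - 2 * of_nat k) * z)))"
    using remove_leading_terms[of \<nu> \<mu> s N] by blast
  define P where "P z = (\<Sum>k<N. h k * exp ((\<mu> - 1 - 2 * of_nat k) * z))" for z
  define c where "c = exp (- ((\<mu> + 1) * (pi * \<i>)))"
  define f1 where "f1 = (\<lambda>z. c * f (z + pi * \<i>))"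
  have f1: "bessel_eq \<nu> \<mu> s f1"
    unfolding f1_def c_def by (rule bessel_eq_shift_pi[OF f])
  have few1: "few_zeros f1"
    unfolding f1_def by (rule few_zeros_shift[OF few]) (simp add: c_def)
  note b = few_zeros_imp_bounded[OF f s few h[OF f] N, folded P_def]
  note b1 = few_zeros_imp_bounded[OF f1 s few1 h[OF f1] N, folded P_def]
  have e_hol: "(\<lambda>z. f z - P z) holomorphic_on UNIV" "(\<lambda>z. f1 z - P z) holomorphic_on UNIV"
    using bessel_eqD(1)[OF h[OF f]] bessel_eqD(1)[OF h[OF f1]] unfolding P_def by auto
  \<comment> \<open>P is common to both remainders and drops out, so the difference inherits their
    decay.\<close>
  have d_eq: "(\<lambda>z. f z - f1 z) = (\<lambda>z. (f z - P z) - (f1 z - P z))"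
    by auto
  have diff0: "f z - f1 z = 0" for z
  proof (rule slit_solution_tendsto_0_eq_0[of \<nu> \<mu> "\<lambda>z. f z - f1 z"])
    show "bessel_eq \<nu> \<mu> 0 (\<lambda>z. f z - f1 z)"
      using bessel_eq_diff[OF f f1] by simp
    have "slit (\<lambda>z. f z - f1 z) \<zeta> = slit (\<lambda>z. f z - P z) \<zeta> - slit (\<lambda>z. f1 z - P z) \<zeta>" for \<zeta>
      by (simp add: slit_def algebra_simps)
    then show "((\<lambda>x. slit (\<lambda>z. f z - f1 z) (of_real x)) \<longlongrightarrow> 0) at_top"
      using tendsto_diff[OF b(2) b1(2)] by simp
    have "slit' (\<lambda>z. f z - f1 z) \<zeta> = slit' (\<lambda>z. f z - P z) \<zeta> - slit' (\<lambda>z. f1 z - P z) \<zeta>" for \<zeta>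
      unfolding d_eq by (rule slit'_diff[OF e_hol])
    then show "((\<lambda>x. slit' (\<lambda>z. f z - f1 z) (of_real x)) \<longlongrightarrow> 0) at_top"
      using tendsto_diff[OF b(3) b1(3)] by simp
  qed
  have per_f: "f z = c * f (z + pi * \<i>)" for z
    using diff0[of z] unfolding f1_def by (rule eq_iff_diff_eq_0[THEN iffD2])
  \<comment> \<open>Since e^(-(\<mu> - 1) pi i) = e^(-(\<mu> + 1) pi i), this factor turns the
    multiplier of f into the period pi i.\<close>
  define k where "k = (\<lambda>z. exp (- ((\<mu> - 1) * z)) * f z)"
  have k_hol: "k holomorphic_on UNIV"
    unfolding k_def using bessel_eqD(1)[OF f] by (auto intro!: holomorphic_intros)
  have k_per: "k (z + pi * \<i>) = k z" for z
  proof -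
    have "- ((\<mu> - 1) * (z + pi * \<i>)) = - ((\<mu> - 1) * z) + - ((\<mu> + 1) * (pi * \<i>)) + 2 * of_real pi * \<i>"
      by (simp add: algebra_simps)
    then have "exp (- ((\<mu> - 1) * (z + pi * \<i>))) = exp (- ((\<mu> - 1) * z)) * c"
      by (simp only: exp_add c_def exp_two_pi_i mult_1_right)
    then show ?thesis
      by (simp add: k_def per_f[of z])
  qed
  obtain H where H: "H holomorphic_on (- {0})" "\<And>z. H (exp (2 * z)) = k z"
    using periodic_extension[OF k_hol k_per] by blast
  have half_Ln: "H \<omega> = k (Ln \<omega> / 2)" "Re (Ln \<omega> / 2) = ln (norm \<omega>) / 2" "\<bar>Im (Ln \<omega> / 2)\<bar> \<le> pi / 2" if "\<omega> \<noteq> 0" for \<omega>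
  proof -
    show "H \<omega> = k (Ln \<omega> / 2)"
      using H(2)[of "Ln \<omega> / 2"] that by simp
    show "Re (Ln \<omega> / 2) = ln (norm \<omega>) / 2"
      using that by simp
    show "\<bar>Im (Ln \<omega> / 2)\<bar> \<le> pi / 2"
      using mpi_less_Im_Ln[OF that] Im_Ln_le_pi[OF that] by (simp add: abs_le_iff)
  qed
  have k_le: "norm (k z) \<le> exp (pi * \<bar>Im \<mu>\<bar>) * exp (\<bar>Re (\<mu> - 1)\<bar> * \<bar>Re z\<bar>) * norm (f z)" if "\<bar>Im z\<bar> \<le> pi / 2" for z
  proof -
    have "\<bar>Im (- (\<mu> - 1))\<bar> = \<bar>Im \<mu>\<bar>" "\<bar>Re (- (\<mu> - 1))\<bar> = \<bar>Re (\<mu> - 1)\<bar>"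
      by (simp_all only: uminus_complex.sel abs_minus_cancel) simp
    moreover have "- ((\<mu> - 1) * z) = - (\<mu> - 1) * z"
      by (rule mult_minus_left[symmetric])
    ultimately have "norm (exp (- ((\<mu> - 1) * z))) \<le> exp (pi * \<bar>Im \<mu>\<bar>) * exp (\<bar>Re (\<mu> - 1)\<bar> * \<bar>Re z\<bar>)"
      using norm_exp_mult_le[OF that, of "- (\<mu> - 1)"] by (simp only:)
    then show ?thesis
      unfolding k_def norm_mult by (rule mult_right_mono) simp
  qed
  obtain T G where TG: "\<And>\<zeta>. T \<le> Re \<zeta> + \<bar>Im \<zeta>\<bar> \<Longrightarrow> norm (slit (\<lambda>z. f z - P z) \<zeta>) \<le> G"
    using b(1) by blast
  define H0 where "H0 = (\<Sum>k<N. norm (h k)) * exp (pi * \<bar>Im \<mu>\<bar>)"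
  have H0: "0 \<le> H0"
    by (simp add: H0_def sum_nonneg)
  define c1 where "c1 = \<bar>Re \<mu>\<bar> + 1 + 2 * real N"
  \<comment> \<open>e^z maps the half-strip into Re \<zeta> >= 0, where |\<zeta>| <= Re \<zeta> +
    |Im \<zeta>|, so the bound on the sector covers it.\<close>
  have f_right: "norm (f z) \<le> (\<bar>G\<bar> + H0) * exp (c1 * Re z)" if z: "\<bar>Im z\<bar> \<le> pi / 2" "0 \<le> Re z" "T \<le> exp (Re z)" for z
  proof -
    define \<zeta> where "\<zeta> = exp z"
    have "\<bar>Im z\<bar> < pi"
      using z(1) pi_gt_zero by linarith
    then have Ln_\<zeta>: "Ln \<zeta> = z"
      unfolding \<zeta>_def by (intro Ln_exp) (auto simp: abs_less_iff)
    have "0 \<le> cos (Im z)"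
      using z(1) by (intro cos_ge_zero) (auto simp: abs_le_iff)
    then have "0 \<le> Re \<zeta>"
      by (simp add: \<zeta>_def Re_exp)
    then have "norm \<zeta> \<le> Re \<zeta> + \<bar>Im \<zeta>\<bar>"
      using cmod_le[of \<zeta>] by simp
    then have "T \<le> Re \<zeta> + \<bar>Im \<zeta>\<bar>"
      using z(3) by (simp add: \<zeta>_def)
    then have "norm (exp (z / 2)) * norm (f z - P z) \<le> G"
      using TG[of \<zeta>] by (simp add: slit_def Ln_\<zeta> norm_mult)
    moreover have "1 * norm (f z - P z) \<le> norm (exp (z / 2)) * norm (f z - P z)"
      using z(2) by (intro mult_right_mono) auto
    ultimately have "norm (f z - P z) \<le> \<bar>G\<bar> * 1"
      by simp
    also have "\<dots> \<le> \<bar>G\<bar> * exp (c1 * Re z)"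
      using z(2) by (intro mult_left_mono) (auto simp: c1_def)
    finally have 1: "norm (f z - P z) \<le> \<bar>G\<bar> * exp (c1 * Re z)" .
    have "norm (h k * exp ((\<mu> - 1 - 2 * of_nat k) * z)) \<le> norm (h k) * (exp (pi * \<bar>Im \<mu>\<bar>) * exp (c1 * Re z))" if k: "k < N" for k
    proof -
      have "norm (exp ((\<mu> - 1 - 2 * of_nat k) * z)) \<le> exp (pi * \<bar>Im (\<mu> - 1 - 2 * of_nat k)\<bar>) * exp (\<bar>Re (\<mu> - 1 - 2 * of_nat k)\<bar> * \<bar>Re z\<bar>)"
        by (rule norm_exp_mult_le[OF z(1)])
      also have "\<dots> \<le> exp (pi * \<bar>Im \<mu>\<bar>) * exp (c1 * Re z)"
      proof -
        have "\<bar>Re (\<mu> - 1 - 2 * of_nat k)\<bar> \<le> c1"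
          using k by (simp add: c1_def)
        then have "\<bar>Re (\<mu> - 1 - 2 * of_nat k)\<bar> * \<bar>Re z\<bar> \<le> c1 * \<bar>Re z\<bar>"
          by (rule mult_right_mono) simp
        then show ?thesis
          using z(2) by (intro mult_mono) auto
      qed
      finally show ?thesis
        by (simp add: norm_mult mult_left_mono)
    qed
    then have "norm (P z) \<le> H0 * exp (c1 * Re z)"
      unfolding P_def H0_def
      by (intro order_trans[OF norm_sum]) (auto simp: sum_distrib_right mult.assoc intro!: sum_mono)
    with 1 have "norm (f z - P z) + norm (P z) \<le> (\<bar>G\<bar> + H0) * exp (c1 * Re z)"
      by (simp add: algebra_simps)
    then show ?thesis
      using norm_triangle_ineq[of "f z - P z" "P z"] by simp
  qed
  obtain C2 k2 where f_left: "\<And>z. Re z \<le> 0 \<Longrightarrow> \<bar>Im z\<bar> \<le> pi / 2 \<Longrightarrow> norm (f z) \<le> C2 * exp (k2 * \<bar>Re z\<bar>)"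
    using growth_left[OF f] by blast
  define a where "a = \<bar>Re (\<mu> - 1)\<bar>"
  \<comment> \<open>The exponents are halved because |\<omega>| = e^(2 Re z).\<close>
  obtain M :: nat and Q :: "complex poly" where Q: "\<And>\<omega>. \<omega> \<noteq> 0 \<Longrightarrow> \<omega> ^ M * H \<omega> = poly Q \<omega>"
  proof (rule laurent_polynomial_of_growth[OF H(1), where A = "max 1 (T\<^sup>2)"
        and C = "exp (pi * \<bar>Im \<mu>\<bar>) * (\<bar>G\<bar> + H0)" and c = "(a + c1) / 2"
        and C' = "exp (pi * \<bar>Im \<mu>\<bar>) * C2" and c' = "(a + k2) / 2"])
    fix \<omega> :: complex assume "max 1 (T\<^sup>2) \<le> norm \<omega>"
    then have \<omega>1: "1 \<le> norm \<omega>" and \<omega>T: "T\<^sup>2 \<le> norm \<omega>"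
      by auto
    then have \<omega>0: "\<omega> \<noteq> 0"
      by auto
    define z where "z = Ln \<omega> / 2"
    have Re_z: "Re z = ln (norm \<omega>) / 2" and Im_z: "\<bar>Im z\<bar> \<le> pi / 2" and Hz: "H \<omega> = k z"
      using half_Ln[OF \<omega>0] by (auto simp: z_def)
    have Re0: "0 \<le> Re z"
      using \<omega>1 by (simp add: Re_z)
    have "(exp (Re z))\<^sup>2 = norm \<omega>"
      using \<omega>0 by (simp add: Re_z exp_double [symmetric])
    with \<omega>T have "T\<^sup>2 \<le> (exp (Re z))\<^sup>2"
      by (simp only:)
    then have "T \<le> exp (Re z)"
      by (rule power2_le_imp_le) (rule exp_ge_zero)
    then have fz: "norm (f z) \<le> (\<bar>G\<bar> + H0) * exp (c1 * Re z)"
      by (rule f_right[OF Im_z Re0])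
    have "norm (H \<omega>) \<le> exp (pi * \<bar>Im \<mu>\<bar>) * exp (a * \<bar>Re z\<bar>) * ((\<bar>G\<bar> + H0) * exp (c1 * Re z))"
      unfolding Hz a_def
      by (rule order_trans[OF k_le[OF Im_z]], rule mult_left_mono[OF fz]) (intro mult_nonneg_nonneg exp_ge_zero)
    also have "\<dots> = exp (pi * \<bar>Im \<mu>\<bar>) * (\<bar>G\<bar> + H0) * (exp (a * Re z) * exp (c1 * Re z))"
      using Re0 by simp
    also have "exp (a * Re z) * exp (c1 * Re z) = norm \<omega> powr ((a + c1) / 2)"
      unfolding mult_exp_exp using \<omega>0 by (simp add: powr_def Re_z algebra_simps add_divide_distrib)
    finally show "norm (H \<omega>) \<le> exp (pi * \<bar>Im \<mu>\<bar>) * (\<bar>G\<bar> + H0) * norm \<omega> powr ((a + c1) / 2)" .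
  next
    fix \<omega> :: complex assume \<omega>0: "\<omega> \<noteq> 0" and \<omega>1: "norm \<omega> \<le> 1"
    define z where "z = Ln \<omega> / 2"
    have Re_z: "Re z = ln (norm \<omega>) / 2" and Im_z: "\<bar>Im z\<bar> \<le> pi / 2" and Hz: "H \<omega> = k z"
      using half_Ln[OF \<omega>0] by (auto simp: z_def)
    have Re0: "Re z \<le> 0"
      using \<omega>1 \<omega>0 by (simp add: Re_z)
    have "norm (H \<omega>) \<le> exp (pi * \<bar>Im \<mu>\<bar>) * exp (a * \<bar>Re z\<bar>) * (C2 * exp (k2 * \<bar>Re z\<bar>))"
      unfolding Hz a_def
      by (rule order_trans[OF k_le[OF Im_z]], rule mult_left_mono[OF f_left[OF Re0 Im_z]])
        (intro mult_nonneg_nonneg exp_ge_zero)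
    also have "\<dots> = exp (pi * \<bar>Im \<mu>\<bar>) * C2 * (exp (- (a * Re z)) * exp (- (k2 * Re z)))"
      using Re0 by simp
    also have "exp (- (a * Re z)) * exp (- (k2 * Re z)) = norm \<omega> powr (- ((a + k2) / 2))"
      unfolding mult_exp_exp using \<omega>0 by (simp add: powr_def Re_z algebra_simps add_divide_distrib)
    finally show "norm (H \<omega>) \<le> exp (pi * \<bar>Im \<mu>\<bar>) * C2 * norm \<omega> powr (- ((a + k2) / 2))" .
  next
    fix M :: nat and Q :: "complex poly"
    assume "\<And>\<omega>. \<omega> \<noteq> 0 \<Longrightarrow> \<omega> ^ M * H \<omega> = poly Q \<omega>"
    then show thesis
      by (rule that)
  qed
  show ?thesis
  proof (rule that)
    fix z
    have "exp (2 * z) ^ M * k z = poly Q (exp (2 * z))"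
      using Q[of "exp (2 * z)"] H(2)[of z] by simp
    then have "exp (of_nat M * (2 * z)) * (exp (- ((\<mu> - 1) * z)) * f z) = poly Q (exp (2 * z))"
      by (simp only: exp_of_nat_mult k_def)
    then have "exp ((\<mu> - 1 - 2 * of_nat M) * z) * poly Q (exp (2 * z))
        = (exp ((\<mu> - 1 - 2 * of_nat M) * z) * exp (of_nat M * (2 * z)) * exp (- ((\<mu> - 1) * z))) * f z"
      by (simp only: mult.assoc)
    also have "exp ((\<mu> - 1 - 2 * of_nat M) * z) * exp (of_nat M * (2 * z)) * exp (- ((\<mu> - 1) * z)) = 1"
      unfolding mult_exp_exp by (simp add: algebra_simps)
    finally show "f z = exp ((\<mu> - 1 - 2 * of_nat M) * z) * poly Q (exp (2 * z))"
      by simp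
  qed
qed

text \<open>Comparing coefficients in the differential equation: the leading coefficient of \<open>Q\<close> is \<open>s\<close>, the others
  follow downwards, and the equation at the lowest power forces the recursion to terminate.\<close>

lemma exp_polynomial_solution:
  assumes f: "bessel_eq \<nu> \<mu> s f" and s: "s \<noteq> 0"
    and Q: "\<And>z. f z = exp ((\<mu> - 1 - 2 * of_nat M) * z) * poly Q (exp (2 * z))"
  obtains p :: nat where "\<mu> + \<nu> = of_nat (2 * p + 1) \<or> \<mu> - \<nu> = of_nat (2 * p + 1)"
    "\<And>z. f z = s * (exp ((\<mu> - 1) * z) * (\<Sum>k\<le>p. (-1) ^ k * lommel_coeff \<mu> \<nu> k / exp z ^ (2 * k)))"
proof -
  define b where "b = \<mu> - 1 - 2 * of_nat M"
  \<comment> \<open>\<theta> = b + 2 x d/dx is d/dz transported to polynomials by Q -> e^(b z)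
    Q(e^(2 z)); it is diagonal on monomials.\<close>
  define \<theta> where "\<theta> = (\<lambda>Q::complex poly. smult b Q + smult 2 (pCons 0 (pderiv Q)))"
  have deriv: "((\<lambda>z. exp (b * z) * poly Q (exp (2 * z))) has_field_derivative
      exp (b * z) * poly (\<theta> Q) (exp (2 * z))) (at z)" for Q z
  proof -
    have "((\<lambda>z. poly Q (exp (2 * z))) has_field_derivative poly (pderiv Q) (exp (2 * z)) * (2 * exp (2 * z))) (at z)"
      by (rule DERIV_chain2[OF poly_DERIV]) (auto intro!: derivative_eq_intros)
    moreover have "((\<lambda>z. exp (b * z)) has_field_derivative b * exp (b * z)) (at z)"
      by (auto intro!: derivative_eq_intros)
    ultimately have "((\<lambda>z. exp (b * z) * poly Q (exp (2 * z))) has_field_derivative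
        b * exp (b * z) * poly Q (exp (2 * z)) + poly (pderiv Q) (exp (2 * z)) * (2 * exp (2 * z)) * exp (b * z)) (at z)"
      by (intro DERIV_mult)
    then show ?thesis
      by (rule DERIV_cong) (simp add: \<theta>_def algebra_simps)
  qed
  have coeff_\<theta>: "coeff (\<theta> Q) k = (b + 2 * of_nat k) * coeff Q k" for Q k
    by (cases k) (simp_all add: \<theta>_def coeff_pderiv algebra_simps)
  have f_eq: "f = (\<lambda>z. exp (b * z) * poly Q (exp (2 * z)))"
    using Q by (simp add: b_def fun_eq_iff)
  have "deriv f z = exp (b * z) * poly (\<theta> Q) (exp (2 * z))" for z
    unfolding f_eq by (rule DERIV_imp_deriv[OF deriv])
  then have "deriv f = (\<lambda>z. exp (b * z) * poly (\<theta> Q) (exp (2 * z)))"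
    by auto
  then have "deriv (deriv f) z = exp (b * z) * poly (\<theta> (\<theta> Q)) (exp (2 * z))" for z
    using DERIV_imp_deriv[OF deriv] by metis
  then have ode: "exp (b * z) * poly (\<theta> (\<theta> Q)) (exp (2 * z)) + (exp (2 * z) - \<nu>\<^sup>2) * (exp (b * z) * poly Q (exp (2 * z)))
      = s * exp ((\<mu> + 1) * z)" for z
    using bessel_eqD(4)[OF f, of z] by (simp add: f_eq)
  define L where "L = \<theta> (\<theta> Q) + pCons 0 Q - smult (\<nu>\<^sup>2) Q"
  have poly_L: "poly L \<omega> = poly (monom s (M + 1)) \<omega>" if "\<omega> \<noteq> 0" for \<omega>
  proof -
    define z where "z = Ln \<omega> / 2"
    have \<omega>: "exp (2 * z) = \<omega>"
      using that by (simp add: z_def)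
    have "exp ((\<mu> + 1) * z) = exp (b * z) * exp (of_nat (M + 1) * (2 * z))"
      unfolding mult_exp_exp by (simp add: b_def algebra_simps)
    also have "exp (of_nat (M + 1) * (2 * z)) = \<omega> ^ (M + 1)"
      unfolding exp_of_nat_mult \<omega> ..
    finally have e: "exp ((\<mu> + 1) * z) = exp (b * z) * \<omega> ^ (M + 1)" .
    have "exp (b * z) * (poly (\<theta> (\<theta> Q)) \<omega> + (\<omega> - \<nu>\<^sup>2) * poly Q \<omega>) = exp (b * z) * (s * \<omega> ^ (M + 1))"
      using ode[of z, unfolded \<omega> e] by (simp add: algebra_simps)
    then have "poly (\<theta> (\<theta> Q)) \<omega> + (\<omega> - \<nu>\<^sup>2) * poly Q \<omega> = s * \<omega> ^ (M + 1)"
      by (simp only: mult_cancel_left exp_not_eq_zero simp_thms)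
    then show ?thesis
      by (simp add: L_def poly_monom algebra_simps)
  qed
  \<comment> \<open>The identity is known for \<omega> \<noteq> 0 only; an extra factor \<omega>
    makes it hold at 0 as well.\<close>
  have "poly (pCons 0 L) \<omega> = poly (pCons 0 (monom s (M + 1))) \<omega>" for \<omega>
    using poly_L[of \<omega>] by (cases "\<omega> = 0") auto
  then have "pCons 0 L = pCons 0 (monom s (M + 1))"
    by (metis poly_eq_poly_eq_iff ext)
  then have L_eq: "L = monom s (M + 1)"
    by simp
  have rec: "((b + 2 * of_nat k)\<^sup>2 - \<nu>\<^sup>2) * coeff Q k + (if k = 0 then 0 else coeff Q (k - 1)) = (if k = M + 1 then s else 0)" for k
  proof -
    have "coeff L k = ((b + 2 * of_nat k)\<^sup>2 - \<nu>\<^sup>2) * coeff Q k + (if k = 0 then 0 else coeff Q (k - 1))"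
      by (cases k) (simp_all add: L_def coeff_\<theta> power2_eq_square algebra_simps)
    moreover have "coeff L k = (if k = M + 1 then s else 0)"
      by (simp add: L_eq)
    ultimately show ?thesis
      by (rule trans[OF sym])
  qed
  have Q0: "Q \<noteq> 0"
  proof
    assume "Q = 0"
    with rec[of "M + 1"] s show False
      by simp
  qed
  \<comment> \<open>One index above the degree only the shifted coefficient remains. It is nonzero,
    which pins the degree to M and the leading coefficient to s.\<close>
  have "coeff Q (degree Q) = (if degree Q + 1 = M + 1 then s else 0)"
    using rec[of "degree Q + 1"] by (simp add: coeff_eq_0)
  then have deg: "degree Q = M" and top: "coeff Q M = s"
    using Q0 by (auto split: if_splits)
  have step: "(b + 2 * of_nat (M - j))\<^sup>2 - \<nu>\<^sup>2 = (\<mu> - 2 * of_nat (Suc j) + 1)\<^sup>2 - \<nu>\<^sup>2" if "j \<le> M" for j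
    using that by (simp add: b_def of_nat_diff algebra_simps)
  have lc_Suc: "lommel_coeff \<mu> \<nu> (Suc j) = lommel_coeff \<mu> \<nu> j * ((\<mu> - 2 * of_nat (Suc j) + 1)\<^sup>2 - \<nu>\<^sup>2)" for j
    by (simp add: lommel_coeff_def)
  have coeffs: "coeff Q (M - j) = s * ((-1) ^ j * lommel_coeff \<mu> \<nu> j)" if "j \<le> M" for j
    using that
  proof (induction j)
    case 0
    then show ?case
      by (simp add: top lommel_coeff_def)
  next
    case (Suc j)
    have "((\<mu> - 2 * of_nat (Suc j) + 1)\<^sup>2 - \<nu>\<^sup>2) * coeff Q (M - j) + coeff Q (M - Suc j) = 0"
      using rec[of "M - j"] step[of j] Suc.prems by simp
    then have "coeff Q (M - Suc j) = - (((\<mu> - 2 * of_nat (Suc j) + 1)\<^sup>2 - \<nu>\<^sup>2) * coeff Q (M - j))"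
      by (simp add: add_eq_0_iff)
    then show ?case
      using Suc by (simp add: lc_Suc)
  qed
  \<comment> \<open>At index 0 no lower coefficient can balance the equation, so some factor of the
    product is 0.\<close>
  have "lommel_coeff \<mu> \<nu> (Suc M) = 0"
    using rec[of 0] step[of M] coeffs[of M] s by (auto simp: lc_Suc)
  then have "\<exists>m\<in>{1..Suc M}. (\<mu> - 2 * of_nat m + 1)\<^sup>2 - \<nu>\<^sup>2 = 0"
    by (simp only: lommel_coeff_def prod_zero_iff finite_atLeastAtMost)
  then obtain m where m: "1 \<le> m" "m \<le> Suc M" "(\<mu> - 2 * of_nat m + 1)\<^sup>2 - \<nu>\<^sup>2 = 0"
    unfolding Bex_def atLeastAtMost_iff by blast
  define p where "p = m - 1"
  have p: "p \<le> M" "m = Suc p"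
    using m by (auto simp: p_def)
  have pm: "\<mu> + \<nu> = of_nat (2 * p + 1) \<or> \<mu> - \<nu> = of_nat (2 * p + 1)"
  proof -
    have "(\<mu> - 2 * of_nat m + 1 - \<nu>) * (\<mu> - 2 * of_nat m + 1 + \<nu>) = 0"
      using m(3) by (simp add: power2_eq_square algebra_simps)
    then have "\<mu> - 2 * of_nat m + 1 - \<nu> = 0 \<or> \<mu> - 2 * of_nat m + 1 + \<nu> = 0"
      by (simp only: mult_eq_0_iff)
    then show ?thesis
    proof
      assume "\<mu> - 2 * of_nat m + 1 - \<nu> = 0"
      then have "\<mu> - \<nu> = of_nat (2 * p + 1)"
        by (simp add: p(2) algebra_simps)
      then show ?thesis ..
    next
      assume "\<mu> - 2 * of_nat m + 1 + \<nu> = 0"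
      then have "\<mu> + \<nu> = of_nat (2 * p + 1)"
        by (simp add: p(2) algebra_simps)
      then show ?thesis ..
    qed
  qed
  have lc_0: "lommel_coeff \<mu> \<nu> k = 0" if "p < k" for k
    unfolding lommel_coeff_def using m that p by (intro prod_zero bexI[of _ m]) auto
  have "f z = s * (exp ((\<mu> - 1) * z) * (\<Sum>k\<le>p. (-1) ^ k * lommel_coeff \<mu> \<nu> k / exp z ^ (2 * k)))" for z
  proof -
    have ee: "exp (b * z) * exp (2 * z) ^ (M - j) = exp ((\<mu> - 1) * z) / exp z ^ (2 * j)" if "j \<le> M" for j
    proof -
      have "exp (b * z) * exp (2 * z) ^ (M - j) * exp z ^ (2 * j) = exp (b * z + of_nat (M - j) * (2 * z) + of_nat (2 * j) * z)"
        by (simp only: exp_add exp_of_nat_mult)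
      also have "b * z + of_nat (M - j) * (2 * z) + of_nat (2 * j) * z = (\<mu> - 1) * z"
        using that by (simp add: b_def of_nat_diff algebra_simps)
      finally show ?thesis
        by (simp add: field_simps)
    qed
    have "f z = (\<Sum>k\<le>M. coeff Q k * (exp (b * z) * exp (2 * z) ^ k))"
      by (simp add: f_eq poly_altdef deg sum_distrib_left mult_ac)
    also have "\<dots> = (\<Sum>j\<le>M. coeff Q (M - j) * (exp (b * z) * exp (2 * z) ^ (M - j)))"
      by (rule sum.reindex_bij_witness[of _ "\<lambda>j. M - j" "\<lambda>j. M - j"]) auto
    also have "\<dots> = (\<Sum>j\<le>M. s * exp ((\<mu> - 1) * z) * ((-1) ^ j * lommel_coeff \<mu> \<nu> j / exp z ^ (2 * j)))"
      by (intro sum.cong) (simp_all add: ee coeffs)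
    also have "\<dots> = (\<Sum>j\<le>p. s * exp ((\<mu> - 1) * z) * ((-1) ^ j * lommel_coeff \<mu> \<nu> j / exp z ^ (2 * j)))"
      using p lc_0 by (intro sum.mono_neutral_right) auto
    finally show ?thesis
      by (simp add: sum_distrib_left mult.assoc)
  qed
  with pm show ?thesis
    using that by blast
qed

section \<open>Bessel and Lommel functions as functions of their parameters\<close>

text \<open>rGamma(y) = y rGamma(y + 1), so each step with |y| >= A gains a factor 1 / A. From index
  K on this holds uniformly for |z| <= r; compactness bounds the finitely many earlier
  terms.\<close>

lemma rGamma_shift_bound:
  fixes A r :: real
  assumes A: "1 \<le> A"
  obtains C where "0 \<le> C" "\<And>(z::complex) k. norm z \<le> r \<Longrightarrow> norm (rGamma (z + of_nat k + 1)) \<le> C / A ^ k"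
proof -
  obtain K :: nat where K: "r + A \<le> real K"
    using real_arch_simple by blast
  have "\<exists>B. \<forall>z::complex. norm z \<le> r \<longrightarrow> norm (rGamma (z + of_nat k + 1)) \<le> B" for k
  proof -
    have "compact ((\<lambda>z::complex. rGamma (z + of_nat k + 1)) ` cball 0 r)"
      by (intro compact_continuous_image compact_cball continuous_on_compose2[OF continuous_on_rGamma[of UNIV]]
          continuous_intros) auto
    then have "bounded ((\<lambda>z::complex. rGamma (z + of_nat k + 1)) ` cball 0 r)"
      by (rule compact_imp_bounded)
    then obtain B where "\<forall>x\<in>(\<lambda>z::complex. rGamma (z + of_nat k + 1)) ` cball 0 r. norm x \<le> B"
      unfolding bounded_iff ..
    then have "norm (rGamma (z + of_nat k + 1)) \<le> B" if "norm z \<le> r" for z :: complex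
      using that by (auto simp: image_iff)
    then show ?thesis
      by blast
  qed
  then obtain B where B: "\<And>k (z::complex). norm z \<le> r \<Longrightarrow> norm (rGamma (z + of_nat k + 1)) \<le> B k"
    by metis
  define C where "C = (\<Sum>k\<le>K. \<bar>B k\<bar> * A ^ k)"
  have small: "norm (rGamma (z + of_nat k + 1)) * A ^ k \<le> C" if z: "norm z \<le> r" and k: "k \<le> K" for z :: complex and k
  proof -
    have "norm (rGamma (z + of_nat k + 1)) * A ^ k \<le> \<bar>B k\<bar> * A ^ k"
      using B[OF z, of k] A by (intro mult_right_mono) auto
    also have "\<dots> \<le> C"
      unfolding C_def using k A by (intro member_le_sum) auto
    finally show ?thesis .
  qed
  have large: "norm (rGamma (z + of_nat (K + j) + 1)) * A ^ (K + j) \<le> C" if z: "norm z \<le> r" for z :: complex and j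
  proof (induction j)
    case 0
    then show ?case using small[OF z, of K] by simp
  next
    case (Suc j)
    define y where "y = z + of_nat (K + j) + 1"
    have "norm (of_nat (K + j + 1) :: complex) \<le> norm y + norm z"
      using norm_triangle_ineq4[of y z] by (simp add: y_def algebra_simps)
    then have "real (K + j + 1) \<le> norm y + r"
      using z unfolding norm_of_nat by linarith
    then have y: "A \<le> norm y"
      using K by simp
    have "y * rGamma (y + 1) = rGamma y"
      by (rule rGamma_plus1)
    then have "norm y * norm (rGamma (y + 1)) = norm (rGamma y)"
      by (metis norm_mult)
    then have "A * norm (rGamma (y + 1)) \<le> norm (rGamma y)"
      using mult_right_mono[OF y, of "norm (rGamma (y + 1))"] by simp
    then have "A * norm (rGamma (y + 1)) * A ^ (K + j) \<le> norm (rGamma y) * A ^ (K + j)"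
      using A by (intro mult_right_mono) auto
    also have "\<dots> \<le> C"
      using Suc by (simp add: y_def)
    finally show ?case
      by (simp add: y_def algebra_simps)
  qed
  show ?thesis
  proof (rule that)
    show "0 \<le> C"
      unfolding C_def using A by (intro sum_nonneg) auto
    fix z :: complex and k assume z: "norm z \<le> r"
    have "norm (rGamma (z + of_nat k + 1)) * A ^ k \<le> C"
    proof (cases "k \<le> K")
      case True
      then show ?thesis by (rule small[OF z])
    next
      case False
      then show ?thesis
        using large[OF z, of "k - K"] by simp
    qed
    then show "norm (rGamma (z + of_nat k + 1)) \<le> C / A ^ k"
      using A by (simp add: field_simps)
  qed
qed

text \<open>Reciprocal Gamma factors have no poles, so the resulting series is holomorphic in a and
  b also where the Lommel series breaks down.\<close>

definition rGamma2_term :: "complex \<Rightarrow> complex \<Rightarrow> nat \<Rightarrow> complex" where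
  "rGamma2_term a b k = (-1) ^ k * (rGamma (a + of_nat k + 1) * rGamma (b + of_nat k + 1))"

definition rGamma2_series :: "complex \<Rightarrow> complex \<Rightarrow> complex \<Rightarrow> complex" where
  "rGamma2_series a b x = (\<Sum>k. rGamma2_term a b k * x ^ k)"

lemma rGamma2_majorant:
  obtains M :: "nat \<Rightarrow> real" where "summable M"
    "\<And>a b k. norm a \<le> r \<Longrightarrow> norm b \<le> r \<Longrightarrow> norm (rGamma2_term a b k * x ^ k) \<le> M k"
proof -
  \<comment> \<open>A^2 > |x|, so the two reciprocal Gamma factors together beat x^k
    geometrically.\<close>
  define A where "A = norm x + 1"
  have A: "1 \<le> A"
    by (simp add: A_def)
  obtain C where C: "0 \<le> C" "\<And>(z::complex) k. norm z \<le> r \<Longrightarrow> norm (rGamma (z + of_nat k + 1)) \<le> C / A ^ k"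
    using rGamma_shift_bound[OF A] by metis
  have "norm x < A\<^sup>2"
    unfolding A_def power2_eq_square using norm_ge_zero[of x] by (simp add: algebra_simps add_pos_nonneg)
  then have "norm (norm x / A\<^sup>2) < 1"
    using A by simp
  then have "summable (\<lambda>k. C\<^sup>2 * (norm x / A\<^sup>2) ^ k)"
    by (intro summable_mult summable_geometric)
  moreover have "norm (rGamma2_term a b k * x ^ k) \<le> C\<^sup>2 * (norm x / A\<^sup>2) ^ k" if "norm a \<le> r" "norm b \<le> r" for a b k
  proof -
    have "norm (rGamma2_term a b k * x ^ k) = norm (rGamma (a + of_nat k + 1)) * norm (rGamma (b + of_nat k + 1)) * norm x ^ k"
      by (simp add: rGamma2_term_def norm_mult norm_power)
    also have "\<dots> \<le> (C / A ^ k) * (C / A ^ k) * norm x ^ k"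
      using C that A by (intro mult_right_mono mult_mono) auto
    also have "\<dots> = C\<^sup>2 * (norm x / A\<^sup>2) ^ k"
      by (simp add: power2_eq_square power_divide power_mult_distrib)
    finally show ?thesis .
  qed
  ultimately show ?thesis
    by (rule that)
qed

lemma rGamma2_uniform_limit:
  assumes "\<And>t. t \<in> S \<Longrightarrow> norm (\<alpha> t) \<le> r" "\<And>t. t \<in> S \<Longrightarrow> norm (\<beta> t) \<le> r"
  shows "uniform_limit S (\<lambda>n t. \<Sum>k<n. rGamma2_term (\<alpha> t) (\<beta> t) k * x ^ k)
    (\<lambda>t. rGamma2_series (\<alpha> t) (\<beta> t) x) sequentially"
proof -
  obtain M :: "nat \<Rightarrow> real" where M: "summable M"
    "\<And>a b k. norm a \<le> r \<Longrightarrow> norm b \<le> r \<Longrightarrow> norm (rGamma2_term a b k * x ^ k) \<le> M k"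
    using rGamma2_majorant by metis
  show ?thesis
    unfolding rGamma2_series_def
    by (rule Weierstrass_m_test[OF _ M(1)]) (use M(2) assms in auto)
qed

lemma rGamma2_summable: "summable (\<lambda>k. rGamma2_term a b k * x ^ k)"
proof -
  obtain M :: "nat \<Rightarrow> real" where M: "summable M"
    "\<And>a' b' k. norm a' \<le> max (norm a) (norm b) \<Longrightarrow> norm b' \<le> max (norm a) (norm b)
      \<Longrightarrow> norm (rGamma2_term a' b' k * x ^ k) \<le> M k"
    using rGamma2_majorant by metis
  show ?thesis
    by (rule summable_comparison_test'[OF M(1)]) (use M(2) in auto)
qed

lemma isCont_rGamma2_term: "isCont (\<lambda>p. rGamma2_term (fst p) (snd p) k) p"
  unfolding rGamma2_term_def
  by (intro isCont_mult isCont_rGamma isCont_add isCont_fst isCont_snd continuous_const continuous_ident)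

lemma continuous_rGamma2_series: "continuous_on UNIV (\<lambda>p. rGamma2_series (fst p) (snd p) x)"
proof (rule continuous_at_imp_continuous_on, rule ballI)
  fix p :: "complex \<times> complex"
  define S where "S = ball p 1"
  have le: "norm (fst q) \<le> norm p + 1" "norm (snd q) \<le> norm p + 1" if "q \<in> S" for q
  proof -
    have "norm q \<le> norm p + 1"
      using that norm_triangle_sub[of q p] by (simp add: S_def dist_norm norm_minus_commute)
    then show "norm (fst q) \<le> norm p + 1" "norm (snd q) \<le> norm p + 1"
      using norm_fst_le[of "fst q" "snd q"] norm_snd_le[of "snd q" "fst q"] by auto
  qed
  have "continuous_on S (\<lambda>p. rGamma2_series (fst p) (snd p) x)"
  proof (rule uniform_limit_theorem)
    show "\<forall>\<^sub>F n in sequentially. continuous_on S (\<lambda>t. \<Sum>k<n. rGamma2_term (fst t) (snd t) k * x ^ k)"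
      by (intro always_eventually allI continuous_at_imp_continuous_on ballI isCont_sum isCont_mult
          isCont_rGamma2_term continuous_const)
    show "uniform_limit S (\<lambda>n t. \<Sum>k<n. rGamma2_term (fst t) (snd t) k * x ^ k)
        (\<lambda>t. rGamma2_series (fst t) (snd t) x) sequentially"
      by (rule rGamma2_uniform_limit) (use le in auto)
  qed simp
  then show "isCont (\<lambda>p. rGamma2_series (fst p) (snd p) x) p"
    by (rule continuous_on_interior) (simp add: S_def interior_open)
qed

lemma holomorphic_rGamma2_series:
  assumes \<alpha>: "\<alpha> holomorphic_on UNIV" and \<beta>: "\<beta> holomorphic_on UNIV"
  shows "(\<lambda>t. rGamma2_series (\<alpha> t) (\<beta> t) x) holomorphic_on UNIV"
proof (rule holomorphic_uniform_sequence[OF open_UNIV])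
  show "(\<lambda>t. \<Sum>k<n. rGamma2_term (\<alpha> t) (\<beta> t) k * x ^ k) holomorphic_on UNIV" for n
    unfolding rGamma2_term_def using \<alpha> \<beta> by (intro holomorphic_intros)
  fix t :: complex
  have "bounded (\<alpha> ` cball t 1)" "bounded (\<beta> ` cball t 1)"
    using \<alpha> \<beta> by (auto intro!: compact_imp_bounded compact_continuous_image
        holomorphic_on_imp_continuous_on holomorphic_on_subset[where t = "cball t 1"])
  then obtain r1 r2 where "\<And>u. u \<in> cball t 1 \<Longrightarrow> norm (\<alpha> u) \<le> r1" "\<And>u. u \<in> cball t 1 \<Longrightarrow> norm (\<beta> u) \<le> r2"
    unfolding bounded_iff by blast
  then have "uniform_limit (cball t 1) (\<lambda>n t. \<Sum>k<n. rGamma2_term (\<alpha> t) (\<beta> t) k * x ^ k)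
      (\<lambda>t. rGamma2_series (\<alpha> t) (\<beta> t) x) sequentially"
    by (intro rGamma2_uniform_limit[where r = "max r1 r2"]) (simp_all add: le_max_iff_disj)
  then show "\<exists>d>0. cball t d \<subseteq> UNIV \<and> uniform_limit (cball t d) (\<lambda>n t. \<Sum>k<n. rGamma2_term (\<alpha> t) (\<beta> t) k * x ^ k)
      (\<lambda>t. rGamma2_series (\<alpha> t) (\<beta> t) x) sequentially"
    by (intro exI[of _ 1]) auto
qed

lemma rGamma2_series_commute: "rGamma2_series a b x = rGamma2_series b a x"
  by (simp add: rGamma2_series_def rGamma2_term_def mult.commute)

text \<open>\<open>lommel_entire \<nu> 0\<close> is \<open>J\<^sub>\<nu>\<close>, and \<open>lommel_entire a b\<close> with \<open>a = (\<mu> + \<nu> + 1) / 2\<close> and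
  \<open>b = (\<mu> - \<nu> + 1) / 2\<close> is \<open>s\<^bsub>\<mu>,\<nu>\<^esub>\<close> up to a constant factor.\<close>

definition lommel_entire :: "complex \<Rightarrow> complex \<Rightarrow> complex \<Rightarrow> complex" where
  "lommel_entire a b w = exp ((a + b) * (w - of_real (ln 2))) * rGamma2_series a b (exp (2 * (w - of_real (ln 2))))"

lemma lommel_entire_commute: "lommel_entire a b w = lommel_entire b a w"
  by (simp add: lommel_entire_def rGamma2_series_commute[of a b] add.commute)

lemma holomorphic_lommel_entire [holomorphic_intros]:
  assumes "\<alpha> holomorphic_on UNIV" "\<beta> holomorphic_on UNIV"
  shows "(\<lambda>t. lommel_entire (\<alpha> t) (\<beta> t) w) holomorphic_on UNIV"
  unfolding lommel_entire_def using assms by (intro holomorphic_intros holomorphic_rGamma2_series)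

lemma continuous_lommel_entire: "continuous_on UNIV (\<lambda>p. lommel_entire (fst p) (snd p) w)"
  unfolding lommel_entire_def by (intro continuous_intros continuous_rGamma2_series)

lemma exp_minus_ln2: "exp (w - of_real (ln 2)) = exp w / (2 :: complex)"
  by (simp add: exp_diff exp_of_real)

lemma rGamma_of_nat_plus1: "rGamma (of_nat k + 1 :: complex) = 1 / fact k"
  using Gamma_fact[of k, where ?'a = complex] by (simp add: rGamma_inverse_Gamma add.commute divide_inverse)

lemma bessel_J_eq: "bessel_J \<nu> w = lommel_entire \<nu> 0 w"
proof -
  have "(-1) ^ k * rGamma (\<nu> + of_nat k + 1) / fact k * (exp w / 2) ^ (2 * k)
      = rGamma2_term \<nu> 0 k * exp (2 * (w - of_real (ln 2))) ^ k" for k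
  proof -
    have "exp (2 * (w - of_real (ln 2))) = (exp w / 2)\<^sup>2"
      by (simp only: exp_double exp_minus_ln2)
    then show ?thesis
      using rGamma_of_nat_plus1[of k] by (simp only: rGamma2_term_def power_mult) simp
  qed
  then show ?thesis
    by (simp add: bessel_J_def lommel_entire_def rGamma2_series_def)
qed

lemma holomorphic_bessel_J [holomorphic_intros]:
  assumes "\<alpha> holomorphic_on UNIV"
  shows "(\<lambda>t. bessel_J (\<alpha> t) w) holomorphic_on UNIV"
  unfolding bessel_J_eq using assms by (intro holomorphic_intros)

text \<open>The tail belongs to the same family with both parameters raised by n; this links Bessel
  tails to Lommel series.\<close>

lemma rGamma2_series_split:
  "rGamma2_series a b x = (\<Sum>k<n. rGamma2_term a b k * x ^ k)
     + (-x) ^ n * rGamma2_series (a + of_nat n) (b + of_nat n) x"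
proof -
  have "rGamma2_term a b (k + n) * x ^ (k + n) = (-x) ^ n * (rGamma2_term (a + of_nat n) (b + of_nat n) k * x ^ k)" for k
    by (simp add: rGamma2_term_def power_add power_minus[of x n] add_ac mult_ac)
  then show ?thesis
    using suminf_split_initial_segment[OF rGamma2_summable[of a b x], of n]
      suminf_mult[OF rGamma2_summable[of "a + of_nat n" "b + of_nat n" x], of "(-x) ^ n"]
    by (simp add: rGamma2_series_def)
qed

text \<open>The first j terms vanish, because 1 / Gamma is 0 at nonpositive integers. For a = 0 this
  is J_(-j) = (-1)^j J_j; in general the Lommel series degenerates to a Bessel function at b =
  -j.\<close>

lemma lommel_entire_minus_nat:
  "lommel_entire a (- of_nat j) w = (-1) ^ j * lommel_entire (a + of_nat j) 0 w"
proof -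
  define y where "y = w - complex_of_real (ln 2)"
  have "rGamma2_term a (- of_nat j) k = 0" if "k < j" for k
  proof -
    have "- of_nat j + of_nat k + 1 = (- of_nat (j - k - 1) :: complex)"
      using that by (simp add: of_nat_diff)
    then have "rGamma (- of_nat j + of_nat k + 1 :: complex) = 0"
      by (simp add: rGamma_eq_zero_iff)
    then show ?thesis
      by (simp add: rGamma2_term_def)
  qed
  then have "rGamma2_series a (- of_nat j) (exp (2 * y)) = (- exp (2 * y)) ^ j * rGamma2_series (a + of_nat j) 0 (exp (2 * y))"
    using rGamma2_series_split[of a "- of_nat j" "exp (2 * y)" j] by simp
  moreover have "exp ((a + - of_nat j) * y) * (- exp (2 * y)) ^ j = (-1) ^ j * exp ((a + of_nat j + 0) * y)"
  proof -
    have "(- exp (2 * y)) ^ j = (-1) ^ j * exp (of_nat j * (2 * y))"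
      unfolding exp_of_nat_mult by (rule power_minus)
    moreover have "exp ((a + - of_nat j) * y) * exp (of_nat j * (2 * y)) = exp ((a + of_nat j + 0) * y)"
      unfolding mult_exp_exp by (simp add: algebra_simps)
    ultimately show ?thesis
      by (simp add: mult.left_commute)
  qed
  ultimately show ?thesis
    unfolding lommel_entire_def y_def [symmetric] by (metis mult.assoc)
qed

text \<open>The cosine is kept instead of a sign because this is the vanishing of the numerator of Y
  at integer orders.\<close>

lemma bessel_J_minus_int:
  assumes "n \<in> \<int>"
  shows "bessel_J (- n) w = cos (n * of_real pi) * bessel_J n w"
proof -
  have nat: "bessel_J (- of_nat j) w = (-1) ^ j * bessel_J (of_nat j) w" for j
    using lommel_entire_minus_nat[of 0 j w] by (simp add: bessel_J_eq lommel_entire_commute[of "- of_nat j"])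
  have cos: "cos (of_nat j * of_real pi :: complex) = (-1) ^ j" for j
  proof -
    have "cos (of_nat j * of_real pi :: complex) = of_real (cos (real j * pi))"
      by (simp add: cos_of_real)
    then show ?thesis
      by (simp add: cos_npi)
  qed
  obtain m where m: "n = of_int m"
    using assms by (auto elim: Ints_cases)
  show ?thesis
  proof (cases "0 \<le> m")
    case True
    then have "n = of_nat (nat m)" by (simp add: m)
    then show ?thesis using nat[of "nat m"] cos by simp
  next
    case False
    define j where "j = nat (- m)"
    have n: "n = - of_nat j" using False by (simp add: m j_def)
    have "bessel_J (of_nat j) w = (-1) ^ j * ((-1) ^ j * bessel_J (of_nat j) w)"
      by (simp add: mult.assoc [symmetric] power_mult_distrib [symmetric])
    then show ?thesis
      unfolding n using nat[of j] cos[of j] by simp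
  qed
qed

section \<open>Bessel functions of the second kind as functions of the order\<close>

text \<open>D has a simple zero at c and N vanishes there. This serves Y at integer orders and S at
  b = -j.\<close>

lemma holomorphic_removable_quotient:
  assumes N: "N holomorphic_on ball c r" and D: "D holomorphic_on ball c r" and r: "0 < r"
    and N0: "N c = 0" and D0: "D c = 0" and d: "(D has_field_derivative d) (at c)" "d \<noteq> 0"
    and nz: "\<And>z. z \<in> ball c r \<Longrightarrow> z \<noteq> c \<Longrightarrow> D z \<noteq> 0"
  shows "((\<lambda>z. N z / D z) \<longlongrightarrow> deriv N c / d) (at c)"
    and "(\<lambda>z. if z = c then deriv N c / d else N z / D z) holomorphic_on ball c r"
proof -
  have dN: "(N has_field_derivative deriv N c) (at c)"
    using N r by (intro holomorphic_derivI[OF N open_ball]) auto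
  have "((\<lambda>z. ((N z - N c) / (z - c)) / ((D z - D c) / (z - c))) \<longlongrightarrow> deriv N c / d) (at c)"
    using dN d by (intro tendsto_divide) (auto simp: has_field_derivative_iff)
  moreover have "\<forall>\<^sub>F z in at c. ((N z - N c) / (z - c)) / ((D z - D c) / (z - c)) = N z / D z"
    by (auto simp: eventually_at N0 D0 intro!: exI[of _ 1])
  ultimately show lim: "((\<lambda>z. N z / D z) \<longlongrightarrow> deriv N c / d) (at c)"
    by (rule Lim_transform_eventually)
  show "(\<lambda>z. if z = c then deriv N c / d else N z / D z) holomorphic_on ball c r"
  proof (rule no_isolated_singularity'[where K = "{c}"])
    show "((\<lambda>z. if z = c then deriv N c / d else N z / D z) \<longlongrightarrow> (if z = c then deriv N c / d else N z / D z)) (at z within ball c r)"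
      if "z \<in> {c}" for z
    proof -
      have "((\<lambda>z. if z = c then deriv N c / d else N z / D z) \<longlongrightarrow> deriv N c / d) (at c)"
        by (rule Lim_transform_eventually[OF lim]) (auto simp: eventually_at intro!: exI[of _ 1])
      then show ?thesis
        using that by (auto intro: tendsto_within_subset)
    qed
    have "(\<lambda>z. N z / D z) holomorphic_on ball c r - {c}"
      using N D nz by (intro holomorphic_on_divide) (auto intro: holomorphic_on_subset)
    then show "(\<lambda>z. if z = c then deriv N c / d else N z / D z) holomorphic_on ball c r - {c}"
      by (rule holomorphic_transform) auto
  qed auto
qed

lemma sin_of_real_pi_eq_0_iff: "sin (\<nu> * of_real pi) = 0 \<longleftrightarrow> (\<nu> :: complex) \<in> \<int>"
proof
  assume "sin (\<nu> * of_real pi) = 0"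
  then obtain n :: int where "\<nu> * of_real pi = of_real (of_int n * pi)"
    by (auto simp: sin_eq_0)
  then show "\<nu> \<in> \<int>"
    by simp
qed (auto elim!: Ints_cases simp: sin_eq_0)

lemma cos_of_int_pi_neq_0:
  assumes "(\<nu> :: complex) \<in> \<int>"
  shows "cos (\<nu> * of_real pi) \<noteq> 0"
proof
  assume "cos (\<nu> * of_real pi) = 0"
  moreover have "sin (\<nu> * of_real pi) = 0"
    using assms by (simp only: sin_of_real_pi_eq_0_iff)
  ultimately show False
    using sin_cos_squared_add[of "\<nu> * of_real pi"] by simp
qed

lemma Ints_ball_unique:
  assumes "(c :: complex) \<in> \<int>" "z \<in> \<int>" "z \<in> ball c 1"
  shows "z = c"
proof -
  obtain m n :: int where "c = of_int m" "z = of_int n"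
    using assms by (auto elim!: Ints_cases)
  moreover from this have "\<bar>m - n\<bar> < 1"
    using assms(3) by (simp add: dist_norm flip: of_int_diff)
  ultimately show ?thesis by simp
qed

text \<open>The defining limit at an integer fills a removable singularity in the order. Identities
  can therefore be proved for nonintegral \<nu> and carried over by continuity.\<close>

lemma holomorphic_bessel_Y: "(\<lambda>\<nu>. bessel_Y \<nu> w) holomorphic_on UNIV"
proof -
  define N where "N = (\<lambda>\<nu>. bessel_J \<nu> w * cos (\<nu> * of_real pi) - bessel_J (- \<nu>) w)"
  define D where "D = (\<lambda>\<nu>. sin (\<nu> * complex_of_real pi))"
  have Y: "bessel_Y_nonint \<nu> w = N \<nu> / D \<nu>" for \<nu>
    by (simp add: bessel_Y_nonint_def N_def D_def)
  have hol: "N holomorphic_on UNIV" "D holomorphic_on UNIV"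
    unfolding N_def D_def by (intro holomorphic_intros)+
  have nonint: "(\<lambda>\<nu>. bessel_Y \<nu> w) holomorphic_on - \<int>"
  proof (rule holomorphic_transform)
    show "(\<lambda>\<nu>. N \<nu> / D \<nu>) holomorphic_on - \<int>"
      using hol by (intro holomorphic_on_divide) (auto intro: holomorphic_on_subset simp: D_def sin_of_real_pi_eq_0_iff)
  qed (simp add: bessel_Y_def Y)
  have int: "(\<lambda>\<nu>. bessel_Y \<nu> w) holomorphic_on ball c 1" if c: "c \<in> \<int>" for c
  proof -
    define d where "d = complex_of_real pi * cos (c * of_real pi)"
    have dD: "(D has_field_derivative d) (at c)"
      unfolding D_def d_def by (auto intro!: derivative_eq_intros)
    have d0: "d \<noteq> 0"
      using cos_of_int_pi_neq_0[OF c] by (simp add: d_def)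
    have N0: "N c = 0"
      using bessel_J_minus_int[OF c] by (simp add: N_def mult.commute)
    have D0: "D c = 0"
      using c by (simp add: D_def sin_of_real_pi_eq_0_iff)
    have nz: "D z \<noteq> 0" if "z \<in> ball c 1" "z \<noteq> c" for z
      using Ints_ball_unique[OF c _ that(1)] that(2) by (auto simp: D_def sin_of_real_pi_eq_0_iff)
    note q = holomorphic_removable_quotient[OF holomorphic_on_subset[OF hol(1) subset_UNIV]
        holomorphic_on_subset[OF hol(2) subset_UNIV] zero_less_one N0 D0 dD d0 nz]
    have lim: "Lim (at c) (\<lambda>\<nu>. bessel_Y_nonint \<nu> w) = deriv N c / d"
      unfolding Y by (rule tendsto_Lim[OF _ q(1)]) auto
    show ?thesis
    proof (rule holomorphic_transform[OF q(2)])
      fix z assume z: "z \<in> ball c 1"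
      show "(if z = c then deriv N c / d else N z / D z) = bessel_Y z w"
      proof (cases "z = c")
        case True
        then show ?thesis
          using c lim by (simp add: bessel_Y_def)
      next
        case False
        then have "z \<notin> \<int>"
          using Ints_ball_unique[OF c _ z] by blast
        with False show ?thesis
          unfolding bessel_Y_def by (simp only: if_False Y)
      qed
    qed
  qed
  have "(\<lambda>\<nu>. bessel_Y \<nu> w) holomorphic_on (- \<int> \<union> (\<Union>c\<in>\<int>. ball c 1))"
    by (intro holomorphic_on_Un holomorphic_on_UN_open nonint int open_Compl closed_Ints open_UN ballI open_ball)
  moreover have "\<nu> \<in> - \<int> \<union> (\<Union>c\<in>\<int>. ball c 1)" for \<nu> :: complex
  proof (cases "\<nu> \<in> \<int>")
    case True
    then show ?thesis
      by (intro UnI2 UN_I[of \<nu>]) simp_all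
  qed simp
  then have "- \<int> \<union> (\<Union>c\<in>\<int>. ball c 1) = (UNIV :: complex set)"
    by (intro equalityI subsetI UNIV_I)
  ultimately show ?thesis
    by simp
qed

lemma holomorphic_bessel_Y' [holomorphic_intros]:
  assumes "\<alpha> holomorphic_on UNIV"
  shows "(\<lambda>t. bessel_Y (\<alpha> t) w) holomorphic_on UNIV"
  using holomorphic_on_compose[OF assms holomorphic_on_subset[OF holomorphic_bessel_Y subset_UNIV]] by (simp add: o_def)

lemma eventually_not_Ints: "\<forall>\<^sub>F z in at c. (z :: complex) \<notin> \<int>"
proof (cases "c \<in> \<int>")
  case True
  then show ?thesis
    using Ints_ball_unique[OF True] by (auto simp: eventually_at dist_commute intro!: exI[of _ 1])
next
  case False
  then have "\<forall>\<^sub>F z in nhds c. z \<in> - \<int>"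
    by (intro eventually_nhds_in_open) (auto intro: open_Compl closed_Ints)
  then show ?thesis
    by (auto simp: eventually_at_filter elim: eventually_mono)
qed

lemma eq_by_continuity_off_Ints:
  fixes F G :: "complex \<Rightarrow> complex"
  assumes "isCont F c" "isCont G c" and "\<forall>\<^sub>F z in at c. z - n \<notin> \<int> \<longrightarrow> F z = G z"
  shows "F c = G c"
proof (rule tendsto_unique[OF trivial_limit_at])
  show "(F \<longlongrightarrow> F c) (at c)"
    using assms(1) by (simp add: isCont_def)
  have "\<forall>\<^sub>F z in at c. z - n \<notin> \<int>"
    using eventually_not_Ints[of "c - n"] by (simp add: eventually_at_to_0[of _ c] eventually_at_to_0[of _ "c - n"] algebra_simps)
  then have "\<forall>\<^sub>F z in at c. G z = F z"
    using assms(3) by eventually_elim simp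
  then show "(F \<longlongrightarrow> G c) (at c)"
    using assms(2) by (auto simp: isCont_def intro: Lim_transform_eventually)
qed

section \<open>Lommel functions in the coordinates a and b\<close>

lemma Gamma_eq_inverse_rGamma: "Gamma z = inverse (rGamma z)"
  by (simp add: rGamma_inverse_Gamma)

lemma Gamma_mult_rGamma:
  assumes "z \<notin> \<int>\<^sub>\<le>\<^sub>0"
  shows "Gamma z * rGamma z = 1"
  using assms by (simp add: Gamma_eq_inverse_rGamma rGamma_eq_zero_iff)

text \<open>With \<mu> = a + b - 1 and \<nu> = a - b each factor is 4 (a + m) (b + m).\<close>

lemma lommel_product:
  "(\<Prod>m\<le>k. ((a + b - 1 + 2 * of_nat m + 1)\<^sup>2 - (a - b)\<^sup>2)) = 4 ^ Suc k * (pochhammer a (Suc k) * pochhammer b (Suc k) :: complex)"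
proof -
  have "(a + b - 1 + 2 * of_nat m + 1)\<^sup>2 - (a - b)\<^sup>2 = 4 * ((a + of_nat m) * (b + of_nat m))" for m
    by (simp add: power2_eq_square algebra_simps)
  then show ?thesis
    by (simp add: pochhammer_prod prod.distrib atLeast0LessThan lessThan_Suc_atMost)
qed

text \<open>The Pochhammer symbols become Gamma quotients, and the factors 4^k are absorbed by the
  argument w - ln 2, that is \<zeta> / 2, in \<open>lommel_entire\<close>.\<close>

lemma lommel_s_eq:
  assumes a: "a \<notin> \<int>\<^sub>\<le>\<^sub>0" and b: "b \<notin> \<int>\<^sub>\<le>\<^sub>0"
  shows "lommel_s (a + b - 1) (a - b) w = 2 powr (a + b - 2) * Gamma a * Gamma b * lommel_entire a b w"
proof -
  define y where "y = w - complex_of_real (ln 2)"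
  have term_eq: "(-1) ^ k * exp w ^ (2 * k) / (\<Prod>m\<le>k. ((a + b - 1 + 2 * of_nat m + 1)\<^sup>2 - (a - b)\<^sup>2))
      = Gamma a * Gamma b / 4 * (rGamma2_term a b k * exp (2 * y) ^ k)" for k
  proof -
    have poch: "Gamma z * rGamma (z + of_nat k + 1) = 1 / pochhammer z (Suc k)" if "z \<notin> \<int>\<^sub>\<le>\<^sub>0" for z :: complex
    proof -
      have "rGamma z = pochhammer z (Suc k) * rGamma (z + of_nat k + 1)"
        using pochhammer_rGamma[of z "Suc k"] by (simp add: add_ac)
      then have "Gamma z * rGamma (z + of_nat k + 1) * pochhammer z (Suc k) = 1"
        using Gamma_mult_rGamma[OF that] by (simp add: mult_ac)
      then show ?thesis
        by (auto simp: eq_divide_eq)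
    qed
    have e2: "exp (2 * y) = (exp w / 2)\<^sup>2"
      unfolding y_def by (simp only: exp_double exp_minus_ln2)
    have "exp (2 * y) ^ k = exp w ^ (2 * k) / 4 ^ k"
      unfolding e2 by (simp add: power_divide power_mult)
    then have "Gamma a * Gamma b / 4 * (rGamma2_term a b k * exp (2 * y) ^ k)
        = (-1) ^ k * (Gamma a * rGamma (a + of_nat k + 1)) * (Gamma b * rGamma (b + of_nat k + 1)) * exp w ^ (2 * k) / 4 ^ Suc k"
      by (simp add: rGamma2_term_def)
    then show ?thesis
      unfolding lommel_product poch[OF a] poch[OF b] by simp
  qed
  have "(\<Sum>k. (-1) ^ k * exp w ^ (2 * k) / (\<Prod>m\<le>k. ((a + b - 1 + 2 * of_nat m + 1)\<^sup>2 - (a - b)\<^sup>2)))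
      = Gamma a * Gamma b / 4 * rGamma2_series a b (exp (2 * y))"
    unfolding term_eq rGamma2_series_def by (rule suminf_mult[OF rGamma2_summable])
  moreover have "exp ((a + b - 1 + 1) * w) / 4 = 2 powr (a + b - 2) * exp ((a + b) * y)"
  proof -
    have "(2::complex) powr (a + b - 2) = exp ((a + b - 2) * of_real (ln 2))"
      using Ln_of_real[of 2] by (simp add: powr_def)
    then have "2 powr (a + b - 2) * exp ((a + b) * y) = exp ((a + b) * w - 2 * of_real (ln 2))"
      by (simp add: mult_exp_exp y_def) (simp add: algebra_simps)
    also have "\<dots> = exp ((a + b) * w) / (exp (of_real (ln 2)))\<^sup>2"
      by (simp only: exp_diff exp_double)
    finally show ?thesis
      by (simp add: exp_of_real)
  qed
  ultimately show ?thesis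
    unfolding lommel_s_def lommel_entire_def y_def [symmetric] by (simp add: field_simps)
qed

text \<open>In these coordinates \<nu> -> -\<nu> exchanges a and b, and the regular parameters are
  those with neither a nor b in {0, -1, ...}.\<close>

definition lommel_ab :: "complex \<Rightarrow> complex \<Rightarrow> complex \<Rightarrow> complex" where
  "lommel_ab a b w = lommel_S_regular (a + b - 1) (a - b) w"

lemma lommel_S_regular_eq: "lommel_S_regular \<mu> \<nu> w = lommel_ab ((\<mu> + \<nu> + 1) / 2) ((\<mu> - \<nu> + 1) / 2) w"
proof -
  have "(\<mu> + \<nu> + 1) / 2 + (\<mu> - \<nu> + 1) / 2 - 1 = \<mu>" "(\<mu> + \<nu> + 1) / 2 - (\<mu> - \<nu> + 1) / 2 = \<nu>"
    by (simp_all add: field_simps)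
  then show ?thesis
    by (simp add: lommel_ab_def)
qed

text \<open>(\<mu> - \<nu>) pi / 2 = b pi - pi / 2, which turns the sine into -cos(b pi) and the
  cosine into sin(b pi). The bracket, continued to b = -j, vanishes there and so offsets the pole of
  Gamma b.\<close>

lemma lommel_ab_eq:
  assumes "a \<notin> \<int>\<^sub>\<le>\<^sub>0" "b \<notin> \<int>\<^sub>\<le>\<^sub>0"
  shows "lommel_ab a b w = 2 powr (a + b - 2) * Gamma a * Gamma b * (lommel_entire a b w
    - cos (b * of_real pi) * bessel_J (a - b) w - sin (b * of_real pi) * bessel_Y (a - b) w)"
proof -
  have arg: "(a + b - 1 - (a - b)) * of_real pi / 2 = b * of_real pi - of_real (pi / 2)"
    by (simp add: field_simps)
  have "sin ((a + b - 1 - (a - b)) * of_real pi / 2) = - cos (b * of_real pi)"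
    unfolding arg sin_diff by (simp only: sin_of_real cos_of_real sin_pi_half cos_pi_half) simp
  moreover have "cos ((a + b - 1 - (a - b)) * of_real pi / 2) = sin (b * of_real pi)"
    unfolding arg cos_diff by (simp only: sin_of_real cos_of_real sin_pi_half cos_pi_half) simp
  moreover have "(a + b - 1 + (a - b) + 1) / 2 = a" "(a + b - 1 - (a - b) + 1) / 2 = b" "a + b - 1 - 1 = a + b - 2"
    by simp_all
  ultimately show ?thesis
    unfolding lommel_ab_def lommel_S_regular_def lommel_s_eq[OF assms] by (simp only:) (simp add: algebra_simps)
qed

text \<open>Eliminating Y makes the symmetry in a and b visible; at a = p + 1 the coefficient sin(a
  pi) removes the term with J_(a - b).\<close>

lemma lommel_ab_nonint:
  assumes "a \<notin> \<int>\<^sub>\<le>\<^sub>0" "b \<notin> \<int>\<^sub>\<le>\<^sub>0" and n: "a - b \<notin> \<int>"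
  shows "lommel_ab a b w = 2 powr (a + b - 2) * Gamma a * Gamma b * (lommel_entire a b w
    + (sin (b * of_real pi) * bessel_J (b - a) w - sin (a * of_real pi) * bessel_J (a - b) w) / sin ((a - b) * of_real pi))"
proof -
  have s0: "sin ((a - b) * of_real pi) \<noteq> 0"
    using n by (simp only: sin_of_real_pi_eq_0_iff not_False_eq_True)
  have "a * of_real pi = b * of_real pi + (a - b) * of_real pi"
    by (simp add: algebra_simps)
  then have sa: "sin (a * of_real pi) = sin (b * of_real pi) * cos ((a - b) * of_real pi) + cos (b * of_real pi) * sin ((a - b) * of_real pi)"
    by (simp only: sin_add)
  have Y: "bessel_Y (a - b) w = (bessel_J (a - b) w * cos ((a - b) * of_real pi) - bessel_J (b - a) w) / sin ((a - b) * of_real pi)"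
    using n by (simp add: bessel_Y_def bessel_Y_nonint_def)
  have "E - cos (b * of_real pi) * bessel_J (a - b) w - sin (b * of_real pi) * bessel_Y (a - b) w
      = E + (sin (b * of_real pi) * bessel_J (b - a) w - sin (a * of_real pi) * bessel_J (a - b) w) / sin ((a - b) * of_real pi)" for E
    unfolding Y sa using s0 by (simp add: divide_simps) (simp add: algebra_simps)
  then show ?thesis
    unfolding lommel_ab_eq[OF assms(1,2)] by (simp only:)
qed

lemma isCont_of_holomorphic:
  assumes "f holomorphic_on UNIV"
  shows "isCont f c"
  using holomorphic_on_imp_continuous_on[OF assms] by (simp add: continuous_on_eq_continuous_at)

lemma eventually_not_nonpos_Ints:
  assumes "(c::complex) \<notin> \<int>\<^sub>\<le>\<^sub>0"
  shows "\<forall>\<^sub>F z in nhds c. z \<notin> \<int>\<^sub>\<le>\<^sub>0"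
  using eventually_nhds_in_open[of "- \<int>\<^sub>\<le>\<^sub>0" c] assms by (simp add: open_Compl)

lemma isCont_lommel_ab:
  assumes a: "a \<notin> \<int>\<^sub>\<le>\<^sub>0" and b: "b \<notin> \<int>\<^sub>\<le>\<^sub>0"
  shows "isCont (\<lambda>b. lommel_ab a b w) b" "isCont (\<lambda>a. lommel_ab a b w) a"
proof -
  define F where "F = (\<lambda>a b. 2 powr (a + b - 2) * Gamma a * Gamma b * (lommel_entire a b w
      - cos (b * of_real pi) * bessel_J (a - b) w - sin (b * of_real pi) * bessel_Y (a - b) w))"
  have "isCont (\<lambda>b. F a b) b"
    unfolding F_def using b
    by (intro continuous_intros isCont_Gamma isCont_of_holomorphic holomorphic_intros isCont_powr_complex) auto
  moreover have "\<forall>\<^sub>F b in nhds b. F a b = lommel_ab a b w"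
    using eventually_not_nonpos_Ints[OF b] unfolding F_def by eventually_elim (rule lommel_ab_eq[OF a, symmetric])
  ultimately show "isCont (\<lambda>b. lommel_ab a b w) b"
    by (rule iffD1[OF isCont_cong, rotated])
  have "isCont (\<lambda>a. F a b) a"
    unfolding F_def using a
    by (intro continuous_intros isCont_Gamma isCont_of_holomorphic holomorphic_intros isCont_powr_complex) auto
  moreover have "\<forall>\<^sub>F a in nhds a. F a b = lommel_ab a b w"
    using eventually_not_nonpos_Ints[OF a] unfolding F_def by eventually_elim (rule lommel_ab_eq[OF _ b, symmetric])
  ultimately show "isCont (\<lambda>a. lommel_ab a b w) a"
    by (rule iffD1[OF isCont_cong, rotated])
qed

text \<open>This is the evenness of S in \<nu>: read off from \<open>lommel_ab_nonint\<close>, then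
  extended by continuity in b.\<close>

lemma lommel_ab_commute:
  assumes a: "a \<notin> \<int>\<^sub>\<le>\<^sub>0" and b: "b \<notin> \<int>\<^sub>\<le>\<^sub>0"
  shows "lommel_ab a b w = lommel_ab b a w"
proof (rule eq_by_continuity_off_Ints[where n = a and F = "\<lambda>b. lommel_ab a b w" and G = "\<lambda>b. lommel_ab b a w"])
  show "isCont (\<lambda>b. lommel_ab a b w) b" "isCont (\<lambda>b. lommel_ab b a w) b"
    using isCont_lommel_ab a b by auto
  have "\<forall>\<^sub>F z in at b. z \<notin> \<int>\<^sub>\<le>\<^sub>0"
    using eventually_not_nonpos_Ints[OF b] by (simp add: eventually_nhds_conv_at)
  then show "\<forall>\<^sub>F z in at b. z - a \<notin> \<int> \<longrightarrow> lommel_ab a z w = lommel_ab z a w"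
  proof eventually_elim
    case (elim z)
    show ?case
    proof
      assume za: "z - a \<notin> \<int>"
      then have az: "a - z \<notin> \<int>"
        by (metis Ints_minus minus_diff_eq)
      have "sin ((z - a) * of_real pi) = - sin ((a - z) * of_real pi)"
        by (metis minus_diff_eq mult_minus_left sin_minus)
      then show "lommel_ab a z w = lommel_ab z a w"
        unfolding lommel_ab_nonint[OF a elim az] lommel_ab_nonint[OF elim a za] lommel_entire_commute[of z a]
        by (simp add: add.commute[of z a] minus_divide_left [symmetric] mult.commute mult.left_commute)
          (simp add: algebra_simps diff_divide_distrib)
    qed
  qed
qed

section \<open>Terminating Lommel functions\<close>

text \<open>The finite sum for a = p + 1, where \<mu> = p + b and \<nu> = p + 1 - b.\<close>

definition lommel_poly :: "nat \<Rightarrow> complex \<Rightarrow> complex \<Rightarrow> complex" where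
  "lommel_poly p b w = exp ((of_nat p + b - 1) * w) *
     (\<Sum>k\<le>p. (-1) ^ k * lommel_coeff (of_nat p + b) (of_nat p + 1 - b) k / exp w ^ (2 * k))"

text \<open>The m-th factor is 4 (p - m + 1) (b - m), so the product telescopes to quotients of
  factorials and of Gamma functions.\<close>

lemma lommel_coeff_terminating:
  assumes b: "b \<notin> \<int>\<^sub>\<le>\<^sub>0" and "i \<le> p"
  shows "lommel_coeff (of_nat p + b) (of_nat p + 1 - b) i = 4 ^ i * (fact p / fact (p - i)) * (Gamma b * rGamma (b - of_nat i))"
  using \<open>i \<le> p\<close>
proof (induction i)
  case 0
  then show ?case
    using Gamma_mult_rGamma[OF b] by (simp add: lommel_coeff_def)
next
  case (Suc i)
  define N where "N = (of_nat (p - i) :: complex)"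
  have N0: "N \<noteq> 0"
    using Suc.prems by (simp add: N_def)
  have "Suc (p - Suc i) = p - i"
    using Suc.prems by simp
  then have fN: "(fact (p - i) :: complex) = N * fact (p - Suc i)"
    using fact_Suc[of "p - Suc i", where ?'a = complex] by (simp add: N_def)
  have X: "fact p / fact (p - Suc i) = N * (fact p / fact (p - i))"
    unfolding fN using N0 by simp
  have rG: "rGamma (b - of_nat (Suc i)) = (b - of_nat (Suc i)) * rGamma (b - of_nat i)"
    using rGamma_plus1[of "b - of_nat (Suc i)"] by simp
  have "lommel_coeff (of_nat p + b) (of_nat p + 1 - b) (Suc i)
      = lommel_coeff (of_nat p + b) (of_nat p + 1 - b) i * ((of_nat p + b - 2 * of_nat (Suc i) + 1)\<^sup>2 - (of_nat p + 1 - b)\<^sup>2)"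
    by (simp add: lommel_coeff_def)
  also have "(of_nat p + b - 2 * of_nat (Suc i) + 1)\<^sup>2 - (of_nat p + 1 - b)\<^sup>2 = 4 * N * (b - of_nat (Suc i))"
    using Suc.prems by (simp add: N_def of_nat_diff power2_eq_square algebra_simps)
  also have "lommel_coeff (of_nat p + b) (of_nat p + 1 - b) i = 4 ^ i * (fact p / fact (p - i)) * (Gamma b * rGamma (b - of_nat i))"
    using Suc by simp
  finally show ?case
    unfolding X rG by (simp only: power_Suc mult_ac)
qed

text \<open>After its first p + 1 terms, J_(b - p - 1) is up to sign the series
  \<open>lommel_entire (of_nat p + 1) b\<close>, so the infinite parts cancel.\<close>

lemma bessel_J_terminating:
  "lommel_entire (of_nat p + 1) b w + (-1) ^ p * bessel_J (b - (of_nat p + 1)) w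
   = (-1) ^ p * (exp ((b - (of_nat p + 1)) * (w - of_real (ln 2))) *
       (\<Sum>k\<le>p. rGamma2_term (b - (of_nat p + 1)) 0 k * exp (2 * (w - of_real (ln 2))) ^ k))"
proof -
  define y where "y = w - complex_of_real (ln 2)"
  define c where "c = b - (of_nat p + 1)"
  define S where "S = rGamma2_series b (of_nat p + 1) (exp (2 * y))"
  have "rGamma2_series c 0 (exp (2 * y)) = (\<Sum>k\<le>p. rGamma2_term c 0 k * exp (2 * y) ^ k)
      + (- exp (2 * y)) ^ Suc p * rGamma2_series (c + of_nat (Suc p)) (0 + of_nat (Suc p)) (exp (2 * y))"
    using rGamma2_series_split[of c 0 "exp (2 * y)" "Suc p"] by (simp only: lessThan_Suc_atMost)
  moreover have "c + of_nat (Suc p) = b" "0 + of_nat (Suc p) = of_nat p + (1::complex)"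
    by (simp_all add: c_def)
  ultimately have ser: "rGamma2_series c 0 (exp (2 * y)) = (\<Sum>k\<le>p. rGamma2_term c 0 k * exp (2 * y) ^ k)
      + (- exp (2 * y)) ^ Suc p * S"
    by (simp only: S_def)
  have "exp (c * y) * (- exp (2 * y)) ^ Suc p = - ((-1) ^ p) * exp ((of_nat p + 1 + b) * y)"
  proof -
    have "(- exp (2 * y)) ^ Suc p = - ((-1) ^ p) * exp (of_nat (Suc p) * (2 * y))"
      unfolding exp_of_nat_mult by (subst power_minus) simp
    moreover have "exp (c * y) * exp (of_nat (Suc p) * (2 * y)) = exp ((of_nat p + 1 + b) * y)"
      unfolding mult_exp_exp by (simp add: c_def algebra_simps)
    ultimately show ?thesis
      by (metis mult.left_commute)
  qed
  then have tail: "exp (c * y) * ((- exp (2 * y)) ^ Suc p * S) = - ((-1) ^ p) * (exp ((of_nat p + 1 + b) * y) * S)"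
    by (metis mult.assoc)
  have "bessel_J c w = exp (c * y) * (\<Sum>k\<le>p. rGamma2_term c 0 k * exp (2 * y) ^ k)
      - (-1) ^ p * lommel_entire (of_nat p + 1) b w"
    unfolding bessel_J_eq lommel_entire_def y_def [symmetric] ser rGamma2_series_commute[of "of_nat p + 1"] S_def [symmetric]
      distrib_left add_0_right tail by simp
  then have "(-1) ^ p * bessel_J c w = (-1) ^ p * (exp (c * y) * (\<Sum>k\<le>p. rGamma2_term c 0 k * exp (2 * y) ^ k))
      - ((-1) ^ p * (-1) ^ p) * lommel_entire (of_nat p + 1) b w"
    by (simp only: right_diff_distrib mult.assoc)
  moreover have "(-1) ^ p * (-1) ^ p = (1::complex)"
    by (simp add: power_mult_distrib [symmetric])
  ultimately show ?thesis
    unfolding c_def [symmetric] y_def [symmetric] by simp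
qed

lemma sin_Suc_pi_minus:
  "sin ((of_nat p + 1 - b) * of_real pi) = (-1) ^ p * sin (b * of_real pi :: complex)"
proof (induction p)
  case 0
  show ?case by (simp add: left_diff_distrib sin_diff)
next
  case (Suc p)
  have "(of_nat (Suc p) + 1 - b) * of_real pi = (of_nat p + 1 - b) * of_real pi + of_real pi"
    by (simp add: algebra_simps)
  then show ?case
    using Suc by (simp only: sin_add) simp
qed

text \<open>For nonintegral b only the finite sum of \<open>bessel_J_terminating\<close> survives;
  continuity in b then covers the positive integers.\<close>

lemma lommel_ab_eq_poly:
  assumes b: "b \<notin> \<int>\<^sub>\<le>\<^sub>0"
  shows "lommel_ab (of_nat p + 1) b w = lommel_poly p b w"
proof (rule eq_by_continuity_off_Ints[where n = 0 and F = "\<lambda>b. lommel_ab (of_nat p + 1) b w"])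
  have a: "(of_nat p + 1 :: complex) \<notin> \<int>\<^sub>\<le>\<^sub>0"
    by (auto elim!: nonpos_Ints_cases simp: complex_eq_iff)
  show "isCont (\<lambda>b. lommel_ab (of_nat p + 1) b w) b"
    by (rule isCont_lommel_ab(1)[OF a b])
  show "isCont (\<lambda>b. lommel_poly p b w) b"
    unfolding lommel_poly_def lommel_coeff_def by (intro continuous_intros) auto
  have "\<forall>\<^sub>F z in at b. z \<notin> \<int>\<^sub>\<le>\<^sub>0"
    using eventually_not_nonpos_Ints[OF b] by (simp add: eventually_nhds_conv_at)
  then show "\<forall>\<^sub>F b in at b. b - 0 \<notin> \<int> \<longrightarrow> lommel_ab (of_nat p + 1) b w = lommel_poly p b w"
  proof eventually_elim
    case (elim b)
    show ?case
    proof
      assume "b - 0 \<notin> \<int>"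
      then have b_int: "b \<notin> \<int>" by simp
      then have sb: "sin (b * of_real pi) \<noteq> 0"
        by (simp only: sin_of_real_pi_eq_0_iff not_False_eq_True)
      have n: "of_nat p + 1 - b \<notin> \<int>"
      proof
        assume "of_nat p + 1 - b \<in> \<int>"
        then have "of_nat p + 1 - (of_nat p + 1 - b) \<in> \<int>"
          by (intro Ints_diff Ints_add) auto
        then show False using b_int by simp
      qed
      have sa: "sin ((of_nat p + 1) * complex_of_real pi) = 0"
        unfolding sin_of_real_pi_eq_0_iff by (intro Ints_add) auto
      define y where "y = w - complex_of_real (ln 2)"
      define c where "c = b - (of_nat p + 1)"
      have quot: "(sin (b * of_real pi) * J - sin ((of_nat p + 1) * of_real pi) * J') / sin ((of_nat p + 1 - b) * of_real pi) = (-1) ^ p * J" for J J'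
        unfolding sin_Suc_pi_minus sa using sb by (simp add: divide_simps)
      have "lommel_ab (of_nat p + 1) b w = 2 powr (of_nat p + 1 + b - 2) * fact p * Gamma b * ((-1) ^ p *
          (exp (c * y) * (\<Sum>k\<le>p. rGamma2_term c 0 k * exp (2 * y) ^ k)))"
        unfolding lommel_ab_nonint[OF a elim n] quot bessel_J_terminating c_def y_def
        using Gamma_fact[of p, where ?'a = complex] by (simp add: add.commute)
      \<comment> \<open>Bessel's series ascends in powers of \<zeta>, the Lommel sum
        descends.\<close>
      also have "(\<Sum>k\<le>p. rGamma2_term c 0 k * exp (2 * y) ^ k) = (\<Sum>i\<le>p. rGamma2_term c 0 (p - i) * exp (2 * y) ^ (p - i))"
        by (rule sum.reindex_bij_witness[of _ "\<lambda>i. p - i" "\<lambda>i. p - i"]) auto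
      also have "2 powr (of_nat p + 1 + b - 2) * fact p * Gamma b * ((-1) ^ p *
          (exp (c * y) * (\<Sum>i\<le>p. rGamma2_term c 0 (p - i) * exp (2 * y) ^ (p - i))))
          = (\<Sum>i\<le>p. (2 powr (of_nat p + b - 1) * exp (c * y) * exp (2 * y) ^ (p - i)) * (fact p * Gamma b * ((-1) ^ p * rGamma2_term c 0 (p - i))))"
        by (simp add: sum_distrib_left mult_ac)
      also have "\<dots> = (\<Sum>i\<le>p. exp ((of_nat p + b - 1) * w) * ((-1) ^ i * lommel_coeff (of_nat p + b) (of_nat p + 1 - b) i / exp w ^ (2 * i)))"
      proof (rule sum.cong[OF refl])
        fix i assume "i \<in> {..p}"
        then have i: "i \<le> p" by simp
        have e: "2 powr (of_nat p + b - 1) * exp (c * y) * exp (2 * y) ^ (p - i) = exp ((of_nat p + b - 1) * w) / exp w ^ (2 * i) * 4 ^ i"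
        proof -
          have "(2::complex) powr (of_nat p + b - 1) = exp ((of_nat p + b - 1) * of_real (ln 2))"
            using Ln_of_real[of 2] by (simp add: powr_def)
          then have "2 powr (of_nat p + b - 1) * exp (c * y) * exp (2 * y) ^ (p - i) * exp w ^ (2 * i)
              = exp ((of_nat p + b - 1) * of_real (ln 2) + c * y + of_nat (p - i) * (2 * y) + of_nat (2 * i) * w)"
            by (simp only: exp_add exp_of_nat_mult)
          also have "(of_nat p + b - 1) * of_real (ln 2) + c * y + of_nat (p - i) * (2 * y) + of_nat (2 * i) * w
              = (of_nat p + b - 1) * w + of_nat (2 * i) * of_real (ln 2)"
            using i by (simp add: c_def y_def of_nat_diff algebra_simps)
          also have "exp \<dots> = exp ((of_nat p + b - 1) * w) * 4 ^ i"
            unfolding exp_add exp_of_nat_mult by (simp add: exp_of_real power_mult)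
          finally show ?thesis
            by (simp add: field_simps)
        qed
        have "c + of_nat (p - i) + 1 = b - of_nat i"
          using i by (simp add: c_def of_nat_diff)
        moreover have "(0::complex) + of_nat (p - i) + 1 = of_nat (p - i) + 1"
          by simp
        ultimately have "rGamma2_term c 0 (p - i) = (-1) ^ (p - i) * (rGamma (b - of_nat i) * (1 / fact (p - i)))"
          by (simp only: rGamma2_term_def rGamma_of_nat_plus1)
        moreover have "(-1) ^ p * (-1) ^ (p - i) = ((-1) ^ i :: complex)"
        proof -
          have "(-1) ^ p = ((-1) ^ (p - i) * (-1) ^ i :: complex)"
            using i by (simp add: power_add [symmetric])
          then show ?thesis
            by (simp add: mult_ac power_mult_distrib [symmetric])
        qed
        ultimately have t: "(-1) ^ p * rGamma2_term c 0 (p - i) = (-1) ^ i * (rGamma (b - of_nat i) * (1 / fact (p - i)))"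
          by (metis mult.assoc)
        show "(2 powr (of_nat p + b - 1) * exp (c * y) * exp (2 * y) ^ (p - i)) * (fact p * Gamma b * ((-1) ^ p * rGamma2_term c 0 (p - i)))
            = exp ((of_nat p + b - 1) * w) * ((-1) ^ i * lommel_coeff (of_nat p + b) (of_nat p + 1 - b) i / exp w ^ (2 * i))"
          unfolding e t lommel_coeff_terminating[OF elim i] by (simp add: mult_ac)
      qed
      also have "\<dots> = lommel_poly p b w"
        by (simp add: lommel_poly_def sum_distrib_left)
      finally show "lommel_ab (of_nat p + 1) b w = lommel_poly p b w" .
    qed
  qed
qed

section \<open>Exceptional parameters\<close>

lemma nonpos_Ints_imp_Ints: "(z::complex) \<in> \<int>\<^sub>\<le>\<^sub>0 \<Longrightarrow> z \<in> \<int>"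
  by (auto elim!: nonpos_Ints_cases)

text \<open>The singularity of \<open>S\<close> at an exceptional parameter is removable, as \<open>lommel_entire a (-j)\<close>
  is a multiple of a Bessel function.\<close>

lemma lommel_ab_removable:
  assumes a: "a \<notin> \<int>\<^sub>\<le>\<^sub>0"
  shows "\<exists>h. h holomorphic_on ball (- of_nat j) 1 \<and> (\<forall>b\<in>ball (- of_nat j) 1 - {- of_nat j}. h b = lommel_ab a b w)"
proof -
  define c where "c = (- of_nat j :: complex)"
  define K where "K = (\<lambda>b. 2 powr (a + b - 2) * Gamma a * (lommel_entire a b w
    - cos (b * of_real pi) * bessel_J (a - b) w - sin (b * of_real pi) * bessel_Y (a - b) w))"
  have K_hol: "K holomorphic_on UNIV"
    unfolding K_def by (intro holomorphic_intros) auto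
  have c_int: "c \<in> \<int>"
    by (simp add: c_def)
  \<comment> \<open>At b = -j the series is (-1)^j J_(a + j), which the cosine term cancels.\<close>
  have K0: "K c = 0"
  proof -
    have "sin (c * of_real pi) = 0"
      using c_int by (simp only: sin_of_real_pi_eq_0_iff)
    moreover have "cos (c * of_real pi) = (-1) ^ j"
    proof -
      have "cos (c * of_real pi) = of_real (cos (real j * pi))"
        by (simp add: c_def cos_of_real)
      then show ?thesis by (simp add: cos_npi)
    qed
    moreover have "lommel_entire a c w = (-1) ^ j * bessel_J (a - c) w"
      unfolding c_def lommel_entire_minus_nat bessel_J_eq by simp
    ultimately show ?thesis
      by (simp add: K_def)
  qed
  have rG: "rGamma z \<noteq> 0" if "z \<in> ball c 1" "z \<noteq> c" for z
    using Ints_ball_unique[OF c_int _ that(1)] that(2) nonpos_Ints_imp_Ints by (auto simp: rGamma_eq_zero_iff)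
  have rG0: "rGamma c = 0"
    by (simp add: rGamma_eq_zero_iff c_def)
  have d: "(rGamma has_field_derivative (-1) ^ j * fact j) (at c)"
    unfolding c_def by (rule has_field_derivative_rGamma_nonpos_int)
  note q = holomorphic_removable_quotient(2)[OF holomorphic_on_subset[OF K_hol subset_UNIV] holomorphic_rGamma
      zero_less_one K0 rG0 d _ rG]
  have "K b / rGamma b = lommel_ab a b w" if "b \<in> ball c 1 - {c}" for b
  proof -
    have "b \<notin> \<int>\<^sub>\<le>\<^sub>0"
      using rG[of b] that by (auto simp: rGamma_eq_zero_iff)
    from lommel_ab_eq[OF a this] show ?thesis
      by (simp add: K_def Gamma_eq_inverse_rGamma divide_inverse mult_ac)
  qed
  then show ?thesis
    unfolding c_def [symmetric]
    by (intro exI[of _ "\<lambda>z. if z = c then deriv K c / ((-1) ^ j * fact j) else K z / rGamma z"] conjI ballI q) auto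
qed

text \<open>Written through J alone, S is jointly continuous; that formula divides by sin((a - b)
  pi), whence the restriction on a - b.\<close>

lemma continuous_lommel_ab_off_diagonal:
  assumes "\<And>p. p \<in> S \<Longrightarrow> fst p \<notin> \<int>\<^sub>\<le>\<^sub>0 \<and> snd p \<notin> \<int>\<^sub>\<le>\<^sub>0 \<and> fst p - snd p \<notin> \<int>"
  shows "continuous_on S (\<lambda>p. lommel_ab (fst p) (snd p) w)"
proof -
  have J: "continuous_on S (\<lambda>p. bessel_J (h p) w)" if "continuous_on S h" for h :: "complex \<times> complex \<Rightarrow> complex"
    using continuous_on_compose2[OF holomorphic_on_imp_continuous_on[OF holomorphic_bessel_J[OF holomorphic_on_ident]] that]
    by auto
  have L: "continuous_on S (\<lambda>p. lommel_entire (fst p) (snd p) w)"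
    using continuous_on_subset[OF continuous_lommel_entire subset_UNIV] .
  have Gam: "continuous_on S (\<lambda>p. Gamma (fst p))" "continuous_on S (\<lambda>p. Gamma (snd p))"
    using assms by (auto intro!: continuous_on_compose2[where g = Gamma and t = "- \<int>\<^sub>\<le>\<^sub>0"] continuous_on_Gamma continuous_intros)
  have "continuous_on S (\<lambda>p. 2 powr (fst p + snd p - 2) * Gamma (fst p) * Gamma (snd p) * (lommel_entire (fst p) (snd p) w
    + (sin (snd p * of_real pi) * bessel_J (snd p - fst p) w - sin (fst p * of_real pi) * bessel_J (fst p - snd p) w)
        / sin ((fst p - snd p) * of_real pi)))"
    using assms by (intro continuous_on_mult continuous_on_add continuous_on_divide continuous_on_diff J L Gam
        continuous_on_sin continuous_on_fst continuous_on_snd continuous_on_id continuous_on_const continuous_on_powr_complex ballI)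
      (auto simp: sin_of_real_pi_eq_0_iff)
  then show ?thesis
    by (rule continuous_on_eq) (simp add: lommel_ab_nonint assms)
qed

text \<open>For \<open>a\<close> near \<open>p + 1\<close> compare with the polynomial case \<open>a = p + 1\<close>: the difference is small on the circle
  \<open>|b + j| = 1/4\<close>, where no parameter is degenerate, hence inside by the maximum principle.\<close>

lemma lommel_ab_near_exceptional:
  assumes "0 < e"
  obtains d where "0 < d" "\<And>a b. dist a (of_nat p + 1) < d \<Longrightarrow> dist b (- of_nat j) < d \<Longrightarrow> b \<noteq> - of_nat j
    \<Longrightarrow> dist (lommel_ab a b w) (lommel_poly p (- of_nat j) w) < e"
proof -
  define a0 b0 where "a0 = (of_nat p + 1 :: complex)" and "b0 = (- of_nat j :: complex)"
  have a0_int: "a0 \<in> \<int>" and b0_int: "b0 \<in> \<int>"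
    by (auto simp: a0_def b0_def)
  have a_reg: "a \<notin> \<int>\<^sub>\<le>\<^sub>0" if "a \<in> ball a0 1" for a
  proof
    assume a: "a \<in> \<int>\<^sub>\<le>\<^sub>0"
    then have "a = a0"
      using Ints_ball_unique[OF a0_int nonpos_Ints_imp_Ints that] by simp
    with a show False
      by (auto elim!: nonpos_Ints_cases simp: a0_def complex_eq_iff)
  qed
  have b_reg: "b \<notin> \<int>\<^sub>\<le>\<^sub>0" if "b \<in> ball b0 1" "b \<noteq> b0" for b
    using Ints_ball_unique[OF b0_int _ that(1)] that(2) nonpos_Ints_imp_Ints by blast
  \<comment> \<open>As the radii 1/8 and 1/4 differ, a - b stays within 3/8 of the integer a0 - b0
    without reaching it, so no difference is integral on this compact set.\<close>
  define S where "S = cball a0 (1/8) \<times> sphere b0 (1/4)"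
  have "continuous_on S (\<lambda>p. lommel_ab (fst p) (snd p) w)"
  proof (rule continuous_lommel_ab_off_diagonal)
    fix q assume "q \<in> S"
    then have q: "norm (fst q - a0) \<le> 1/8" "norm (snd q - b0) = 1/4"
      by (auto simp: S_def dist_norm norm_minus_commute)
    have "fst q - snd q \<notin> \<int>"
    proof
      assume int: "fst q - snd q \<in> \<int>"
      have eq: "(fst q - snd q) - (a0 - b0) = (fst q - a0) - (snd q - b0)"
        by simp
      have "norm ((fst q - snd q) - (a0 - b0)) \<le> 1/8 + 1/4"
        unfolding eq using q norm_triangle_ineq4[of "fst q - a0" "snd q - b0"] by linarith
      then have "fst q - snd q \<in> ball (a0 - b0) 1"
        by (simp add: dist_norm norm_minus_commute)
      then have "fst q - snd q = a0 - b0"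
        using Ints_ball_unique[OF Ints_diff[OF a0_int b0_int] int] by blast
      then have "fst q - a0 = snd q - b0"
        by (simp add: algebra_simps)
      with q show False by simp
    qed
    moreover have "fst q \<notin> \<int>\<^sub>\<le>\<^sub>0"
      using q by (intro a_reg) (simp add: dist_norm norm_minus_commute)
    moreover have "snd q \<notin> \<int>\<^sub>\<le>\<^sub>0"
      using q by (intro b_reg) (auto simp: dist_norm norm_minus_commute)
    ultimately show "fst q \<notin> \<int>\<^sub>\<le>\<^sub>0 \<and> snd q \<notin> \<int>\<^sub>\<le>\<^sub>0 \<and> fst q - snd q \<notin> \<int>"
      by blast
  qed
  then have "uniformly_continuous_on S (\<lambda>p. lommel_ab (fst p) (snd p) w)"
    by (rule compact_uniformly_continuous) (auto simp: S_def intro!: compact_Times)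
  then obtain d1 where d1: "0 < d1" "\<And>q q'. q \<in> S \<Longrightarrow> q' \<in> S \<Longrightarrow> dist q' q < d1 \<Longrightarrow>
      dist (lommel_ab (fst q') (snd q') w) (lommel_ab (fst q) (snd q) w) < e / 2"
    unfolding uniformly_continuous_on_def using half_gt_zero[OF assms] by metis
  have "isCont (\<lambda>b. lommel_poly p b w) b0"
    unfolding lommel_poly_def lommel_coeff_def by (intro continuous_intros) auto
  then obtain d2 where d2: "0 < d2" "\<And>b. dist b b0 < d2 \<Longrightarrow> dist (lommel_poly p b w) (lommel_poly p b0 w) < e / 2"
    unfolding continuous_at_eps_delta using half_gt_zero[OF assms] by metis
  have diff: "dist (lommel_ab a b w) (lommel_ab a0 b w) \<le> e / 2"
    if a: "dist a a0 < d1" "dist a a0 < 1/8" and b: "dist b b0 < 1/4" "b \<noteq> b0" for a b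
  proof -
    have "a0 \<in> ball a0 1" "a \<in> ball a0 1"
      using a by (auto simp: dist_commute)
    from this[THEN a_reg] obtain h h0 where
      h: "h holomorphic_on ball b0 1" "\<And>b. b \<in> ball b0 1 - {b0} \<Longrightarrow> h b = lommel_ab a b w" and
      h0: "h0 holomorphic_on ball b0 1" "\<And>b. b \<in> ball b0 1 - {b0} \<Longrightarrow> h0 b = lommel_ab a0 b w"
      using lommel_ab_removable[of a j w] lommel_ab_removable[of a0 j w] unfolding b0_def by blast
    have "norm (h b - h0 b) \<le> e / 2"
    proof (rule maximum_modulus_frontier[where S = "cball b0 (1/4)" and f = "\<lambda>b. h b - h0 b"])
      have sub: "ball b0 (1/4) \<subseteq> ball b0 1" "cball b0 (1/4) \<subseteq> ball b0 1"
        by auto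
      show "(\<lambda>b. h b - h0 b) holomorphic_on interior (cball b0 (1/4))"
        unfolding interior_cball using h h0 sub by (intro holomorphic_intros) (auto intro: holomorphic_on_subset)
      show "continuous_on (closure (cball b0 (1/4))) (\<lambda>b. h b - h0 b)"
        unfolding closure_closed[OF closed_cball]
        by (intro continuous_on_diff holomorphic_on_imp_continuous_on holomorphic_on_subset[OF h(1) sub(2)]
            holomorphic_on_subset[OF h0(1) sub(2)])
      show "norm (h t - h0 t) \<le> e / 2" if "t \<in> frontier (cball b0 (1/4))" for t
      proof -
        have t: "dist b0 t = 1/4"
          using that by simp
        have "(a, t) \<in> S" "(a0, t) \<in> S"
          using t a by (auto simp: S_def dist_commute)
        moreover have "dist (a, t) (a0, t) < d1"
          using a by (simp add: dist_Pair_Pair)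
        ultimately have "dist (lommel_ab a t w) (lommel_ab a0 t w) < e / 2"
          using d1(2)[of "(a0, t)" "(a, t)"] by simp
        moreover have "t \<in> ball b0 1 - {b0}"
          using t by auto
        ultimately show ?thesis
          using h(2)[of t] h0(2)[of t] by (simp add: dist_norm)
      qed
    qed (use b in \<open>auto simp: dist_commute\<close>)
    moreover have "b \<in> ball b0 1 - {b0}"
      using b by (auto simp: dist_commute)
    ultimately show ?thesis
      using h(2)[of b] h0(2)[of b] by (simp add: dist_norm)
  qed
  define d where "d = min (min d1 (1/8)) d2"
  show ?thesis
  proof (rule that[of d])
    show "0 < d"
      using d1 d2 by (simp add: d_def)
    fix a b :: complex assume ab: "dist a (of_nat p + 1) < d" "dist b (- of_nat j) < d" "b \<noteq> - of_nat j"
    have b1: "b \<in> ball b0 1" "b \<noteq> b0"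
      using ab by (auto simp: d_def b0_def dist_commute)
    have "lommel_ab a0 b w = lommel_poly p b w"
      unfolding a0_def by (rule lommel_ab_eq_poly[OF b_reg[OF b1]])
    moreover have "dist (lommel_ab a b w) (lommel_ab a0 b w) \<le> e / 2"
      using ab by (intro diff) (auto simp: d_def a0_def b0_def)
    moreover have "dist (lommel_poly p b w) (lommel_poly p b0 w) < e / 2"
      using ab by (intro d2(2)) (auto simp: d_def b0_def)
    ultimately show "dist (lommel_ab a b w) (lommel_poly p (- of_nat j) w) < e"
      using dist_triangle[of "lommel_ab a b w" "lommel_poly p b0 w" "lommel_poly p b w"] by (simp add: b0_def)
  qed
qed

lemma half_nonpos_Ints_iff: "(x + 1) / 2 \<in> \<int>\<^sub>\<le>\<^sub>0 \<longleftrightarrow> (\<exists>j::nat. x = - (of_nat (2 * j + 1) :: complex))"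
proof
  assume "(x + 1) / 2 \<in> \<int>\<^sub>\<le>\<^sub>0"
  then obtain j where j: "(x + 1) / 2 = - of_nat j"
    by (elim nonpos_Ints_cases')
  have "x = 2 * ((x + 1) / 2) - 1"
    by (simp add: field_simps)
  also have "\<dots> = - (of_nat (2 * j + 1))"
    unfolding j by simp
  finally show "\<exists>j::nat. x = - (of_nat (2 * j + 1))" ..
next
  assume "\<exists>j::nat. x = - (of_nat (2 * j + 1))"
  then obtain j :: nat where "x = - (of_nat (2 * j + 1))" ..
  then have "(x + 1) / 2 = - of_nat j"
    by simp
  then show "(x + 1) / 2 \<in> \<int>\<^sub>\<le>\<^sub>0"
    by simp
qed

lemma lommel_regular_iff:
  "(\<mu>, \<nu>) \<in> lommel_regular \<longleftrightarrow> (\<mu> + \<nu> + 1) / 2 \<notin> \<int>\<^sub>\<le>\<^sub>0 \<and> (\<mu> - \<nu> + 1) / 2 \<notin> \<int>\<^sub>\<le>\<^sub>0"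
  unfolding lommel_regular_def half_nonpos_Ints_iff by auto

text \<open>\<open>Lim\<close> is determined by convergence only along a nontrivial filter;
  \<open>nontriv\<close> makes regular pairs accumulate at the exceptional one.\<close>

lemma lommel_S_exceptional:
  assumes exc: "(\<mu>, \<nu>) \<notin> lommel_regular"
    and lim: "\<And>e. 0 < e \<Longrightarrow> \<exists>d>0. \<forall>m n. (m, n) \<in> lommel_regular \<longrightarrow> dist m \<mu> < d \<longrightarrow> dist n \<nu> < d
      \<longrightarrow> dist (lommel_S_regular m n w) L < e"
    and nontriv: "\<And>d. 0 < d \<Longrightarrow> \<exists>q\<in>lommel_regular. dist q (\<mu>, \<nu>) < d"
  shows "lommel_S \<mu> \<nu> w = L"
proof -
  have "((\<lambda>(m, n). lommel_S_regular m n w) \<longlongrightarrow> L) (at (\<mu>, \<nu>) within lommel_regular)"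
  proof (rule tendstoI)
    fix e :: real assume "0 < e"
    then obtain d where d: "0 < d" "\<And>m n. (m, n) \<in> lommel_regular \<Longrightarrow> dist m \<mu> < d \<Longrightarrow> dist n \<nu> < d
      \<Longrightarrow> dist (lommel_S_regular m n w) L < e"
      using lim by metis
    show "\<forall>\<^sub>F q in at (\<mu>, \<nu>) within lommel_regular. dist (case q of (m, n) \<Rightarrow> lommel_S_regular m n w) L < e"
      unfolding eventually_at
    proof (intro exI[of _ d] conjI ballI impI d(1))
      fix q assume q: "q \<in> lommel_regular" "q \<noteq> (\<mu>, \<nu>) \<and> dist q (\<mu>, \<nu>) < d"
      have "dist (fst q) \<mu> < d" "dist (snd q) \<nu> < d"
        using q dist_fst_le[of q "(\<mu>, \<nu>)"] dist_snd_le[of q "(\<mu>, \<nu>)"] by auto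
      then show "dist (case q of (m, n) \<Rightarrow> lommel_S_regular m n w) L < e"
        using d(2)[of "fst q" "snd q"] q by (simp add: case_prod_beta)
    qed
  qed
  moreover have "at (\<mu>, \<nu>) within lommel_regular \<noteq> bot"
    unfolding trivial_limit_within islimpt_approachable using nontriv exc by metis
  ultimately have "Lim (at (\<mu>, \<nu>) within lommel_regular) (\<lambda>(m, n). lommel_S_regular m n w) = L"
    by (intro tendsto_Lim)
  then show ?thesis
    using exc by (simp add: lommel_S_def)
qed

lemma of_nat_plus1_not_nonpos_Int: "(of_nat p + 1 :: complex) \<notin> \<int>\<^sub>\<le>\<^sub>0"
  by (auto elim!: nonpos_Ints_cases simp: complex_eq_iff)

lemma lommel_coeff_minus: "lommel_coeff \<mu> (- \<nu>) k = lommel_coeff \<mu> \<nu> k"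
  by (simp add: lommel_coeff_def)

lemma near_nonpos_Int:
  fixes t :: real
  assumes "0 < t" "t < 1"
  shows "- of_nat j + of_real t \<notin> (\<int>\<^sub>\<le>\<^sub>0 :: complex set)"
proof
  assume *: "- of_nat j + of_real t \<in> (\<int>\<^sub>\<le>\<^sub>0 :: complex set)"
  have "- of_nat j + of_real t = (- of_nat j :: complex)"
    using assms by (intro Ints_ball_unique nonpos_Ints_imp_Ints[OF *]) (auto simp: dist_norm)
  then show False
    using assms by simp
qed

lemma dist_half_sum:
  assumes "dist m \<mu> < d" "dist n \<nu> < d"
  shows "dist ((m + n + 1) / 2) ((\<mu> + \<nu> + 1) / (2::complex)) < d" "dist ((m - n + 1) / 2) ((\<mu> - \<nu> + 1) / (2::complex)) < d"
proof -
  have "(m + n + 1) / 2 - (\<mu> + \<nu> + 1) / 2 = ((m - \<mu>) + (n - \<nu>)) / 2"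
    "(m - n + 1) / 2 - (\<mu> - \<nu> + 1) / 2 = ((m - \<mu>) - (n - \<nu>)) / 2"
    by (simp_all add: field_simps)
  moreover have "norm (((m - \<mu>) + (n - \<nu>)) / 2) < d" "norm (((m - \<mu>) - (n - \<nu>)) / 2) < d"
    using assms norm_triangle_ineq[of "m - \<mu>" "n - \<nu>"] norm_triangle_ineq4[of "m - \<mu>" "n - \<nu>"]
    by (simp_all add: dist_norm norm_divide)
  ultimately show "dist ((m + n + 1) / 2) ((\<mu> + \<nu> + 1) / 2) < d" "dist ((m - n + 1) / 2) ((\<mu> - \<nu> + 1) / 2) < d"
    by (simp_all only: dist_norm)
qed

text \<open>The direction (t, -t) keeps \<mu> + \<nu>, and (t, t) keeps \<mu> - \<nu>: one of a and
  b stays at p + 1 while the other moves off -j by t.\<close>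

lemma dist_pair_perturb:
  assumes "0 < d"
  obtains t :: real where "0 < t" "t < 1" "dist (\<mu> + of_real t, \<nu> - of_real t) (\<mu> :: complex, \<nu> :: complex) < d"
    "dist (\<mu> + of_real t, \<nu> + of_real t) (\<mu>, \<nu>) < d"
proof -
  define t where "t = min (1/2) (d / 4)"
  have t: "0 < t" "t < 1" "t + t < d"
    using assms by (auto simp: t_def)
  have "sqrt (t\<^sup>2 + t\<^sup>2) \<le> t + t"
    using t by (intro sqrt_sum_squares_le_sum) auto
  moreover have "dist (\<mu> + of_real t) \<mu> = t" "dist (\<nu> - of_real t) \<nu> = t" "dist (\<nu> + of_real t) \<nu> = t"
    using t by (simp_all add: dist_norm)
  ultimately show ?thesis
    using t by (intro that[of t]) (simp_all add: dist_Pair_Pair)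
qed

text \<open>At regular pairs this is \<open>lommel_ab_eq_poly\<close>. If the other coordinate is
  -j, the two-parameter limit is computed by \<open>lommel_ab_near_exceptional\<close>.\<close>

lemma lommel_S_terminating:
  assumes "\<mu> + \<nu> = of_nat (2 * p + 1) \<or> \<mu> - \<nu> = of_nat (2 * p + 1)"
  shows "lommel_S \<mu> \<nu> w = exp ((\<mu> - 1) * w) * (\<Sum>k\<le>p. (-1) ^ k * lommel_coeff \<mu> \<nu> k / exp w ^ (2 * k))"
    (is "_ = ?P")
proof -
  define a b where "a = (\<mu> + \<nu> + 1) / 2" and "b = (\<mu> - \<nu> + 1) / 2"
  from assms show ?thesis
  proof
    assume eq: "\<mu> + \<nu> = of_nat (2 * p + 1)"
    have a: "a = of_nat p + 1"
      using eq by (simp add: a_def)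
    have mu: "of_nat p + b = \<mu>" and nu: "of_nat p + 1 - b = \<nu>"
    proof -
      have "of_nat p = (\<mu> + \<nu> - 1) / 2"
        using eq by simp
      then show "of_nat p + b = \<mu>" "of_nat p + 1 - b = \<nu>"
        by (simp_all only: b_def) (simp_all add: field_simps)
    qed
    have P: "lommel_poly p b w = ?P"
      unfolding lommel_poly_def mu nu ..
    show ?thesis
    proof (cases "(\<mu>, \<nu>) \<in> lommel_regular")
      case True
      then have "lommel_S \<mu> \<nu> w = lommel_ab a b w"
        by (simp add: lommel_S_def lommel_S_regular_eq a_def b_def)
      moreover have "b \<notin> \<int>\<^sub>\<le>\<^sub>0"
        using True by (simp add: lommel_regular_iff b_def)
      ultimately show ?thesis
        using lommel_ab_eq_poly P a by simp
    next
      case False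
      then have "b \<in> \<int>\<^sub>\<le>\<^sub>0"
        using of_nat_plus1_not_nonpos_Int[of p] a unfolding lommel_regular_iff a_def [symmetric] b_def [symmetric] by simp
      then obtain j where b: "b = - of_nat j"
        by (elim nonpos_Ints_cases')
      have "lommel_S \<mu> \<nu> w = lommel_poly p b w"
      proof (rule lommel_S_exceptional[OF False])
        fix e :: real assume "0 < e"
        then obtain d where d: "0 < d" "\<And>a' b'. dist a' (of_nat p + 1) < d \<Longrightarrow> dist b' (- of_nat j) < d \<Longrightarrow> b' \<noteq> - of_nat j
          \<Longrightarrow> dist (lommel_ab a' b' w) (lommel_poly p (- of_nat j) w) < e"
          using lommel_ab_near_exceptional by metis
        have "dist (lommel_S_regular m n w) (lommel_poly p b w) < e"
          if mn: "(m, n) \<in> lommel_regular" "dist m \<mu> < d" "dist n \<nu> < d" for m n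
          unfolding lommel_S_regular_eq b
        proof (rule d(2))
          show "dist ((m + n + 1) / 2) (of_nat p + 1) < d" "dist ((m - n + 1) / 2) (- of_nat j) < d"
            using dist_half_sum[OF mn(2,3)] unfolding a_def [symmetric] b_def [symmetric] a b by auto
          show "(m - n + 1) / 2 \<noteq> - of_nat j"
            using mn(1) unfolding lommel_regular_iff by auto
        qed
        with d(1) show "\<exists>d>0. \<forall>m n. (m, n) \<in> lommel_regular \<longrightarrow> dist m \<mu> < d \<longrightarrow> dist n \<nu> < d
            \<longrightarrow> dist (lommel_S_regular m n w) (lommel_poly p b w) < e"
          by blast
      next
        fix d :: real assume "0 < d"
        then obtain t where t: "0 < t" "t < 1" "dist (\<mu> + of_real t, \<nu> - of_real t) (\<mu>, \<nu>) < d"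
          by (rule dist_pair_perturb)
        have A: "(\<mu> + of_real t + (\<nu> - of_real t) + 1) / 2 = of_nat p + 1"
          using a by (simp add: a_def)
        have B: "(\<mu> + of_real t - (\<nu> - of_real t) + 1) / 2 = - of_nat j + of_real t"
          using b unfolding b_def by (simp add: field_simps)
        have "(\<mu> + of_real t, \<nu> - of_real t) \<in> lommel_regular"
          unfolding lommel_regular_iff A B using near_nonpos_Int[OF t(1,2)] of_nat_plus1_not_nonpos_Int by blast
        with t(3) show "\<exists>q\<in>lommel_regular. dist q (\<mu>, \<nu>) < d"
          by blast
      qed
      then show ?thesis
        by (simp only: P)
    qed
  next
    \<comment> \<open>The mirror case b = p + 1, with \<open>lommel_ab_commute\<close> exchanging
      the roles of a and b.\<close>
    assume eq: "\<mu> - \<nu> = of_nat (2 * p + 1)"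
    have b: "b = of_nat p + 1"
      using eq by (simp add: b_def)
    have mu: "of_nat p + a = \<mu>" and nu: "of_nat p + 1 - a = - \<nu>"
    proof -
      have "of_nat p = (\<mu> - \<nu> - 1) / 2"
        using eq by simp
      then show "of_nat p + a = \<mu>" "of_nat p + 1 - a = - \<nu>"
        by (simp_all only: a_def) (simp_all add: field_simps)
    qed
    have P: "lommel_poly p a w = ?P"
      unfolding lommel_poly_def mu nu lommel_coeff_minus ..
    show ?thesis
    proof (cases "(\<mu>, \<nu>) \<in> lommel_regular")
      case True
      then have S: "lommel_S \<mu> \<nu> w = lommel_ab a b w"
        by (simp add: lommel_S_def lommel_S_regular_eq a_def b_def)
      have reg: "a \<notin> \<int>\<^sub>\<le>\<^sub>0" "b \<notin> \<int>\<^sub>\<le>\<^sub>0"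
        using True by (simp_all add: lommel_regular_iff a_def b_def)
      show ?thesis
        unfolding S lommel_ab_commute[OF reg] using lommel_ab_eq_poly[OF reg(1)] P b by simp
    next
      case False
      then have "a \<in> \<int>\<^sub>\<le>\<^sub>0"
        using of_nat_plus1_not_nonpos_Int[of p] b unfolding lommel_regular_iff a_def [symmetric] b_def [symmetric] by simp
      then obtain j where a: "a = - of_nat j"
        by (elim nonpos_Ints_cases')
      have "lommel_S \<mu> \<nu> w = lommel_poly p a w"
      proof (rule lommel_S_exceptional[OF False])
        fix e :: real assume "0 < e"
        then obtain d where d: "0 < d" "\<And>a' b'. dist a' (of_nat p + 1) < d \<Longrightarrow> dist b' (- of_nat j) < d \<Longrightarrow> b' \<noteq> - of_nat j
          \<Longrightarrow> dist (lommel_ab a' b' w) (lommel_poly p (- of_nat j) w) < e"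
          using lommel_ab_near_exceptional by metis
        have "dist (lommel_S_regular m n w) (lommel_poly p a w) < e"
          if mn: "(m, n) \<in> lommel_regular" "dist m \<mu> < d" "dist n \<nu> < d" for m n
        proof -
          have reg: "(m + n + 1) / 2 \<notin> \<int>\<^sub>\<le>\<^sub>0" "(m - n + 1) / 2 \<notin> \<int>\<^sub>\<le>\<^sub>0"
            using mn(1) by (simp_all add: lommel_regular_iff)
          show ?thesis
            unfolding lommel_S_regular_eq lommel_ab_commute[OF reg] a
          proof (rule d(2))
            show "dist ((m - n + 1) / 2) (of_nat p + 1) < d" "dist ((m + n + 1) / 2) (- of_nat j) < d"
              using dist_half_sum[OF mn(2,3)] unfolding a_def [symmetric] b_def [symmetric] a b by auto
            show "(m + n + 1) / 2 \<noteq> - of_nat j"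
              using reg(1) by auto
          qed
        qed
        with d(1) show "\<exists>d>0. \<forall>m n. (m, n) \<in> lommel_regular \<longrightarrow> dist m \<mu> < d \<longrightarrow> dist n \<nu> < d
            \<longrightarrow> dist (lommel_S_regular m n w) (lommel_poly p a w) < e"
          by blast
      next
        fix d :: real assume "0 < d"
        then obtain t where t: "0 < t" "t < 1" "dist (\<mu> + of_real t, \<nu> + of_real t) (\<mu>, \<nu>) < d"
          by (rule dist_pair_perturb)
        have A: "(\<mu> + of_real t - (\<nu> + of_real t) + 1) / 2 = of_nat p + 1"
          using b by (simp add: b_def)
        have B: "(\<mu> + of_real t + (\<nu> + of_real t) + 1) / 2 = - of_nat j + of_real t"
        proof -
          have "(\<mu> + of_real t + (\<nu> + of_real t) + 1) / 2 = a + of_real t"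
            unfolding a_def by (simp add: field_simps)
          then show ?thesis
            by (simp only: a)
        qed
        have "(\<mu> + of_real t, \<nu> + of_real t) \<in> lommel_regular"
          unfolding lommel_regular_iff A B using near_nonpos_Int[OF t(1,2)] of_nat_plus1_not_nonpos_Int by blast
        with t(3) show "\<exists>q\<in>lommel_regular. dist q (\<mu>, \<nu>) < d"
          by blast
      qed
      then show ?thesis
        by (simp only: P)
    qed
  qed
qed

section \<open>Monodromy and independence of the Bessel functions\<close>

lemma bessel_J_shift: "bessel_J \<nu> (w + pi * \<i>) = exp (pi * \<i> * \<nu>) * bessel_J \<nu> w"
proof -
  have "exp ((\<nu> + 0) * (w + pi * \<i> - of_real (ln 2))) = exp (pi * \<i> * \<nu>) * exp ((\<nu> + 0) * (w - of_real (ln 2)))"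
    by (simp add: mult_exp_exp) (simp add: algebra_simps)
  moreover have "exp (2 * (w + pi * \<i> - of_real (ln 2))) = exp (2 * (w - of_real (ln 2)))"
  proof -
    have "2 * (w + pi * \<i> - of_real (ln 2)) = 2 * (w - of_real (ln 2)) + 2 * of_real pi * \<i>"
      by (simp add: algebra_simps)
    then show ?thesis
      by (simp only: exp_add exp_two_pi_i mult_1_right)
  qed
  ultimately show ?thesis
    by (simp only: bessel_J_eq lommel_entire_def mult.assoc)
qed

lemma exp_pi_i_mult:
  "exp (of_real pi * \<i> * \<nu>) = cos (\<nu> * of_real pi) + \<i> * sin (\<nu> * of_real pi)"
  "exp (- (of_real pi * \<i> * \<nu>)) = cos (\<nu> * of_real pi) - \<i> * sin (\<nu> * of_real pi)"
  using exp_Euler[of "\<nu> * of_real pi"] exp_Euler[of "- (\<nu> * of_real pi)"] by (simp_all add: mult_ac)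

text \<open>For nonintegral \<nu> this follows from the multipliers e^(pi i \<nu>) and e^(-pi i
  \<nu>) of J with orders \<nu> and -\<nu>; continuity in the order gives the integers.\<close>

lemma bessel_Y_shift:
  "bessel_Y \<nu> (w + pi * \<i>) = exp (- (pi * \<i> * \<nu>)) * bessel_Y \<nu> w + 2 * \<i> * cos (\<nu> * of_real pi) * bessel_J \<nu> w"
proof (rule eq_by_continuity_off_Ints[where n = 0 and F = "\<lambda>\<nu>. bessel_Y \<nu> (w + pi * \<i>)"
      and G = "\<lambda>\<nu>. exp (- (pi * \<i> * \<nu>)) * bessel_Y \<nu> w + 2 * \<i> * cos (\<nu> * of_real pi) * bessel_J \<nu> w"])
  show "isCont (\<lambda>\<nu>. bessel_Y \<nu> (w + pi * \<i>)) \<nu>"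
    "isCont (\<lambda>\<nu>. exp (- (pi * \<i> * \<nu>)) * bessel_Y \<nu> w + 2 * \<i> * cos (\<nu> * of_real pi) * bessel_J \<nu> w) \<nu>"
    by (intro isCont_of_holomorphic holomorphic_intros)+
  show "\<forall>\<^sub>F \<nu> in at \<nu>. \<nu> - 0 \<notin> \<int> \<longrightarrow> bessel_Y \<nu> (w + pi * \<i>)
      = exp (- (pi * \<i> * \<nu>)) * bessel_Y \<nu> w + 2 * \<i> * cos (\<nu> * of_real pi) * bessel_J \<nu> w"
  proof (intro always_eventually allI impI)
    fix \<nu> :: complex assume "\<nu> - 0 \<notin> \<int>"
    then have \<nu>: "\<nu> \<notin> \<int>" by simp
    define s c where "s = sin (\<nu> * of_real pi)" and "c = cos (\<nu> * of_real pi)"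
    have s0: "s \<noteq> 0"
      using \<nu> unfolding s_def sin_of_real_pi_eq_0_iff .
    have Y: "bessel_Y \<nu> w' = (bessel_J \<nu> w' * c - bessel_J (- \<nu>) w') / s" for w'
      using \<nu> by (simp add: bessel_Y_def bessel_Y_nonint_def s_def c_def)
    have J1: "bessel_J (- \<nu>) (w + pi * \<i>) = (c - \<i> * s) * bessel_J (- \<nu>) w"
      using bessel_J_shift[of "- \<nu>" w] exp_pi_i_mult(2)[of \<nu>] by (simp add: s_def c_def)
    have J2: "bessel_J \<nu> (w + pi * \<i>) = (c + \<i> * s) * bessel_J \<nu> w"
      using bessel_J_shift[of \<nu> w] exp_pi_i_mult(1)[of \<nu>] by (simp add: s_def c_def)
    have E: "exp (- (pi * \<i> * \<nu>)) = c - \<i> * s"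
      using exp_pi_i_mult(2)[of \<nu>] by (simp add: s_def c_def)
    show "bessel_Y \<nu> (w + pi * \<i>) = exp (- (pi * \<i> * \<nu>)) * bessel_Y \<nu> w + 2 * \<i> * cos (\<nu> * of_real pi) * bessel_J \<nu> w"
      unfolding c_def [symmetric] Y J1 J2 E using s0 by (simp add: field_simps)
  qed
qed

text \<open>The leading coefficient 1 / Gamma(\<nu> + 1) settles everything but negative integers,
  which reduce to the order -\<nu>.\<close>

lemma bessel_J_nonzero: "\<exists>w. bessel_J \<nu> w \<noteq> 0"
proof -
  have reg: "\<exists>w. bessel_J \<nu> w \<noteq> 0" if "rGamma (\<nu> + 1) \<noteq> 0" for \<nu>
  proof (rule ccontr)
    assume "\<not> (\<exists>w. bessel_J \<nu> w \<noteq> 0)"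
    then have zero: "rGamma2_series \<nu> 0 (exp (2 * (w - of_real (ln 2)))) = 0" for w
      by (simp add: bessel_J_eq lommel_entire_def)
    have "rGamma2_series \<nu> 0 x = 0" if "x \<noteq> 0" for x
      using zero[of "Ln x / 2 + of_real (ln 2)"] that by simp
    then have "(\<lambda>x. rGamma2_series \<nu> 0 x) \<midarrow>0\<rightarrow> 0"
      by (intro tendsto_eventually) (auto simp: eventually_at intro: exI[of _ 1])
    moreover have "(\<lambda>x. rGamma2_series \<nu> 0 x) \<midarrow>0\<rightarrow> rGamma2_term \<nu> 0 0"
      by (rule powser_limit_0[of 1]) (auto simp: rGamma2_series_def intro: summable_sums rGamma2_summable)
    ultimately have "rGamma2_term \<nu> 0 0 = 0"
      using tendsto_unique[OF trivial_limit_at] by blast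
    with that show False
      by (simp add: rGamma2_term_def)
  qed
  show ?thesis
  proof (cases "rGamma (\<nu> + 1) = 0")
    case False
    then show ?thesis by (rule reg)
  next
    case True
    then have "\<nu> + 1 \<in> \<int>\<^sub>\<le>\<^sub>0"
      by (simp add: rGamma_eq_zero_iff)
    then obtain j where j: "\<nu> + 1 = - of_nat j"
      by (elim nonpos_Ints_cases')
    have "- \<nu> = 1 - (\<nu> + 1)"
      by simp
    then have \<nu>: "- \<nu> = of_nat j + 1"
      unfolding j by simp
    have int: "- \<nu> \<in> \<int>"
      unfolding \<nu> by (intro Ints_add) auto
    have "rGamma (- \<nu> + 1) \<noteq> 0"
      unfolding \<nu> using of_nat_plus1_not_nonpos_Int[of "Suc j"] by (simp add: rGamma_eq_zero_iff add_ac)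
    then obtain w where "bessel_J (- \<nu>) w \<noteq> 0"
      using reg by blast
    then have "bessel_J (- (- \<nu>)) w \<noteq> 0"
      unfolding bessel_J_minus_int[OF int] using cos_of_int_pi_neq_0[OF int] by simp
    then show ?thesis
      by auto
  qed
qed

text \<open>Monodromy in place of a Wronskian: the relation at w0 + pi i minus e^(-pi i \<nu>) times
  the relation at w0 eliminates Y and gives A sin(\<nu> pi) + B cos(\<nu> pi) = 0.\<close>

lemma bessel_J_Y_independent:
  assumes eq: "\<And>w. A * bessel_J \<nu> w + B * bessel_Y \<nu> w = 0"
  shows "A = 0" "B = 0"
proof -
  define s c where "s = sin (\<nu> * of_real pi)" and "c = cos (\<nu> * of_real pi)"
  obtain w0 where w0: "bessel_J \<nu> w0 \<noteq> 0"
    using bessel_J_nonzero by blast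
  have "A * ((c + \<i> * s) * bessel_J \<nu> w0) + B * ((c - \<i> * s) * bessel_Y \<nu> w0 + 2 * \<i> * c * bessel_J \<nu> w0) = 0"
    using eq[of "w0 + pi * \<i>"] exp_pi_i_mult[of \<nu>] unfolding bessel_J_shift bessel_Y_shift by (simp add: s_def c_def)
  moreover have "2 * \<i> * bessel_J \<nu> w0 * (A * s + B * c)
      = (A * ((c + \<i> * s) * bessel_J \<nu> w0) + B * ((c - \<i> * s) * bessel_Y \<nu> w0 + 2 * \<i> * c * bessel_J \<nu> w0))
        - (c - \<i> * s) * (A * bessel_J \<nu> w0 + B * bessel_Y \<nu> w0)"
    by (simp add: algebra_simps)
  ultimately have "2 * \<i> * bessel_J \<nu> w0 * (A * s + B * c) = 0"
    using eq[of w0] by (simp only: diff_0_right mult_zero_right)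
  then have AB: "A * s + B * c = 0"
    using w0 by simp
  have "A = 0 \<and> B = 0"
  proof (cases "\<nu> \<in> \<int>")
    case True
    then have "s = 0" "c \<noteq> 0"
      unfolding s_def c_def by (simp_all only: sin_of_real_pi_eq_0_iff cos_of_int_pi_neq_0 not_False_eq_True)
    then have B: "B = 0"
      using AB by simp
    then show ?thesis
      using eq[of w0] w0 by simp
  next
    case False
    then have s0: "s \<noteq> 0"
      unfolding s_def sin_of_real_pi_eq_0_iff .
    obtain w1 where w1: "bessel_J (- \<nu>) w1 \<noteq> 0"
      using bessel_J_nonzero by blast
    have Ys: "bessel_Y \<nu> w1 * s = bessel_J \<nu> w1 * c - bessel_J (- \<nu>) w1"
      using False s0 by (simp add: bessel_Y_def bessel_Y_nonint_def s_def c_def)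
    have "s * (A * bessel_J \<nu> w1 + B * bessel_Y \<nu> w1) = s * A * bessel_J \<nu> w1 + B * (bessel_Y \<nu> w1 * s)"
      by (simp add: algebra_simps)
    also have "\<dots> = (A * s + B * c) * bessel_J \<nu> w1 - B * bessel_J (- \<nu>) w1"
      unfolding Ys by (simp add: algebra_simps)
    finally have "s * (A * bessel_J \<nu> w1 + B * bessel_Y \<nu> w1) = (A * s + B * c) * bessel_J \<nu> w1 - B * bessel_J (- \<nu>) w1" .
    then have "B * bessel_J (- \<nu>) w1 = 0"
      unfolding AB eq by simp
    then have "B = 0"
      using w1 by simp
    then show ?thesis
      using AB s0 by simp
  qed
  then show "A = 0" "B = 0"
    by auto
qed

section \<open>The exponent of convergence\<close>

lemma zorder_entire_pos:
  assumes "f holomorphic_on UNIV" "f w \<noteq> 0" "f z = 0"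
  shows "0 < zorder f z"
  using zorder_exist_zero[OF assms(1) open_UNIV connected_UNIV, of z] assms by auto

lemma finite_zeros_cball:
  assumes "f holomorphic_on UNIV" "f w \<noteq> 0"
  shows "finite {z. norm z \<le> r \<and> f z = 0}"
proof (cases "f constant_on UNIV")
  case True
  then obtain y where "\<And>x. f x = y"
    unfolding constant_on_def by auto
  then have "{z. norm z \<le> r \<and> f z = 0} = {}"
    using assms(2) by auto
  then show ?thesis
    by (simp only: finite.emptyI)
next
  case False
  have eq: "{z. norm z \<le> r \<and> f z = 0} = {z \<in> cball 0 r. f z = 0}"
    by auto
  show ?thesis
    unfolding eq by (rule holomorphic_compact_finite_zeros[OF assms(1) open_UNIV connected_UNIV compact_cball subset_UNIV False])
qed

lemma card_zeros_le_zero_count: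
  assumes "f holomorphic_on UNIV" "f w \<noteq> 0"
  shows "int (card {z. norm z \<le> r \<and> f z = 0}) \<le> zero_count f r"
proof -
  have "of_nat (card {z. norm z \<le> r \<and> f z = 0}) * 1 \<le> zero_count f r"
    unfolding zero_count_def
    by (rule sum_bounded_below) (use zorder_entire_pos[OF assms] in \<open>auto simp: Suc_le_eq zless_iff_Suc_zadd[symmetric] int_one_le_iff_zero_less\<close>)
  then show ?thesis by simp
qed

lemma conv_exponent_finite_imp_few_zeros:
  assumes f: "f holomorphic_on UNIV" "f w \<noteq> 0" and conv: "conv_exponent f < \<infinity>"
  shows "few_zeros f"
proof (cases "finite {z. f z = 0}")
  case True
  have "\<forall>\<^sub>F r in at_top. finite {z. norm z \<le> r \<and> f z = 0} \<and> real (card {z. norm z \<le> r \<and> f z = 0}) \<le> r ^ 1"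
    using eventually_ge_at_top[of "real (card {z. f z = 0})"]
  proof eventually_elim
    case (elim r)
    have "card {z. norm z \<le> r \<and> f z = 0} \<le> card {z. f z = 0}"
      by (rule card_mono[OF True]) auto
    with elim show ?case
      using finite_zeros_cball[OF f] by simp
  qed
  then show ?thesis
    unfolding few_zeros_def by blast
next
  case False
  then have "Limsup at_top (\<lambda>r::real. ereal (ln (real_of_int (zero_count f r)) / ln r)) < \<infinity>"
    using conv by (simp add: conv_exponent_def)
  then obtain K :: nat where "Limsup at_top (\<lambda>r::real. ereal (ln (real_of_int (zero_count f r)) / ln r)) < ereal (real K)"
    using less_PInf_Ex_of_nat by auto
  from Limsup_lessD[OF this]
  have ev: "\<forall>\<^sub>F r in at_top. ln (real_of_int (zero_count f r)) / ln r < real K"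
    by simp
  have "\<forall>\<^sub>F r in at_top. finite {z. norm z \<le> r \<and> f z = 0} \<and> real (card {z. norm z \<le> r \<and> f z = 0}) \<le> r ^ K"
    using ev eventually_gt_at_top[of 1]
  proof eventually_elim
    case (elim r)
    define n where "n = card {z. norm z \<le> r \<and> f z = 0}"
    have n_le: "real n \<le> real_of_int (zero_count f r)"
      using card_zeros_le_zero_count[OF f, of r] unfolding n_def by linarith
    \<comment> \<open>A count of 0 must be split off, as \<open>ln 0 = 0\<close> is a convention;
      for a positive count the logarithms can be compared.\<close>
    have "real n \<le> r ^ K"
    proof (cases "n = 0")
      case True
      then show ?thesis using elim by simp
    next
      case False
      then have c: "1 \<le> real_of_int (zero_count f r)"
        using n_le by linarith
      have "ln (real_of_int (zero_count f r)) \<le> ln (r ^ K)"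
        using elim by (simp add: divide_less_eq ln_realpow)
      then have "real_of_int (zero_count f r) \<le> r ^ K"
        using c elim by (subst (asm) ln_le_cancel_iff) auto
      with n_le show ?thesis by linarith
    qed
    then show ?case
      using finite_zeros_cball[OF f] by (simp add: n_def)
  qed
  then show ?thesis
    unfolding few_zeros_def by blast
qed

section \<open>Counting the zeros of the finite sum\<close>

text \<open>Up to an exponential factor f is a polynomial in e^(-2 z), nonzero because c 0 = 1.
  Translation by pi i multiplies f by a constant and so preserves multiplicities; they are bounded,
  and the count is O(r).\<close>

lemma exp_polynomial_conv_exponent:
  fixes \<alpha> \<sigma> :: complex and c :: "nat \<Rightarrow> complex"
  assumes f: "\<And>z. f z = \<sigma> * (exp (\<alpha> * z) * (\<Sum>k\<le>p. (-1) ^ k * c k / exp z ^ (2 * k)))"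
    and \<sigma>: "\<sigma> \<noteq> 0" and c0: "c 0 = 1"
  shows "conv_exponent f < \<infinity>"
proof -
  define R where "R = (\<Sum>k\<le>p. monom ((-1) ^ k * c k) k)"
  have R_eq: "poly R (exp (- 2 * z)) = (\<Sum>k\<le>p. (-1) ^ k * c k / exp z ^ (2 * k))" for z
  proof -
    have "exp (- 2 * z) ^ k = 1 / exp z ^ (2 * k)" for k
    proof -
      have "exp (- 2 * z) = 1 / exp z ^ 2"
        using exp_minus[of "2 * z"] exp_double[of z] by (simp add: divide_inverse)
      then show ?thesis
        by (simp add: power_one_over power_mult)
    qed
    then show ?thesis
      by (simp add: R_def poly_sum poly_monom)
  qed
  have "coeff R 0 = (\<Sum>k\<le>p. if k = 0 then (-1) ^ k * c k else 0)"
    by (simp add: R_def coeff_sum)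
  then have "coeff R 0 = 1"
    by (simp add: c0)
  then have R0: "R \<noteq> 0"
    by auto
  have zero_iff: "f z = 0 \<longleftrightarrow> poly R (exp (- 2 * z)) = 0" for z
    using \<sigma> by (simp add: f R_eq [symmetric])
  define C where "C = exp (\<alpha> * (pi * \<i>))"
  have exp_shift: "exp (- 2 * (z + pi * \<i>)) = exp (- 2 * z)" for z
  proof -
    have "- 2 * z = - 2 * (z + pi * \<i>) + 2 * of_real pi * \<i>"
      by (simp add: algebra_simps)
    then show ?thesis
      by (metis exp_add exp_two_pi_i mult_1_right)
  qed
  have f_shift: "f (z + pi * \<i>) = C * f z" for z
  proof -
    have "f (z + pi * \<i>) = \<sigma> * (exp (\<alpha> * (z + pi * \<i>)) * poly R (exp (- 2 * z)))"
      unfolding f R_eq [symmetric] exp_shift ..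
    also have "exp (\<alpha> * (z + pi * \<i>)) = C * exp (\<alpha> * z)"
      by (simp add: C_def mult_exp_exp) (simp add: algebra_simps)
    finally show ?thesis
      unfolding f R_eq [symmetric] by (simp add: mult_ac)
  qed
  have C0: "C \<noteq> 0"
    by (simp add: C_def)
  have zorder_shift1: "zorder f (z + pi * \<i>) = zorder f z" for z
  proof -
    have "zorder f (z + pi * \<i>) = zorder (\<lambda>u. f (u + (z + pi * \<i>))) 0"
      by (rule zorder_shift)
    also have "(\<lambda>u. f (u + (z + pi * \<i>))) = (\<lambda>u. C * f (u + z))"
      using f_shift by (auto simp: add.assoc [symmetric])
    also have "zorder \<dots> 0 = zorder (\<lambda>u. f (u + z)) 0"
      by (rule zorder_cmult[OF C0])
    also have "\<dots> = zorder f z"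
      by (rule zorder_shift [symmetric])
    finally show ?thesis .
  qed
  have shift_nat: "zorder f (z + of_nat n * (pi * \<i>)) = zorder f z \<and> (f (z + of_nat n * (pi * \<i>)) = 0 \<longleftrightarrow> f z = 0)" for z n
  proof (induction n)
    case (Suc n)
    have "z + of_nat (Suc n) * (pi * \<i>) = (z + of_nat n * (pi * \<i>)) + pi * \<i>"
      by (simp add: algebra_simps)
    then show ?case
      using Suc zorder_shift1[of "z + of_nat n * (pi * \<i>)"] f_shift[of "z + of_nat n * (pi * \<i>)"] C0
      by (simp only:) simp
  qed simp
  have shift_int: "zorder f (z + of_int n * (pi * \<i>)) = zorder f z" "f (z + of_int n * (pi * \<i>)) = 0 \<longleftrightarrow> f z = 0" for z n
  proof -
    have "zorder f (z + of_int n * (pi * \<i>)) = zorder f z \<and> (f (z + of_int n * (pi * \<i>)) = 0 \<longleftrightarrow> f z = 0)"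
    proof (cases "0 \<le> n")
      case True
      then show ?thesis using shift_nat[of z "nat n"] by simp
    next
      case False
      then show ?thesis using shift_nat[of "z + of_int n * (pi * \<i>)" "nat (- n)"] by simp
    qed
    then show "zorder f (z + of_int n * (pi * \<i>)) = zorder f z" "f (z + of_int n * (pi * \<i>)) = 0 \<longleftrightarrow> f z = 0"
      by auto
  qed
  \<comment> \<open>A fundamental strip: z -> e^(-2 z) is injective on it, so the roots of R bound
    the number of zeros here.\<close>
  define Z0 where "Z0 = {z. f z = 0 \<and> 0 \<le> Im z \<and> Im z < pi}"
  have finZ0: "finite Z0"
  proof (rule inj_on_finite)
    show "(\<lambda>z. exp (- 2 * z)) ` Z0 \<subseteq> {x. poly R x = 0}"
      by (auto simp: Z0_def zero_iff)
    show "finite {x. poly R x = 0}"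
      by (rule poly_roots_finite[OF R0])
    show "inj_on (\<lambda>z. exp (- 2 * z)) Z0"
    proof (rule inj_onI)
      fix x y assume x: "x \<in> Z0" and y: "y \<in> Z0" and "exp (- 2 * x) = exp (- 2 * y)"
      then obtain n :: int where n: "- 2 * x = - 2 * y + (of_int (2 * n) * pi) * \<i>"
        unfolding exp_eq by auto
      have "Im (- 2 * x) = Im (- 2 * y + (of_int (2 * n) * pi) * \<i>)"
        by (simp only: n)
      then have "Im y - Im x = of_int n * pi"
        by simp
      moreover have "\<bar>Im y - Im x\<bar> < pi"
        using x y by (auto simp: Z0_def abs_less_iff)
      ultimately have "\<bar>of_int n\<bar> * pi < 1 * pi"
        by (simp add: abs_mult)
      then have "\<bar>real_of_int n\<bar> < 1"
        by (simp only: mult_less_cancel_right_pos[OF pi_gt_zero])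
      then have "n = 0"
        by linarith
      with n show "x = y" by simp
    qed
  qed
  define W where "W = (\<Sum>z\<in>Z0. \<bar>zorder f z\<bar>)"
  have decomp: "\<exists>z0\<in>Z0. \<exists>n::int. z = z0 + of_int n * (pi * \<i>) \<and> \<bar>real_of_int n\<bar> \<le> norm z + 1" if "f z = 0" for z
  proof -
    define n where "n = \<lfloor>Im z / pi\<rfloor>"
    define z0 where "z0 = z + of_int (- n) * (pi * \<i>)"
    have fl: "real_of_int n * pi \<le> Im z" "Im z < (real_of_int n + 1) * pi"
    proof -
      have "real_of_int n \<le> Im z / pi" "Im z / pi < real_of_int n + 1"
        unfolding n_def by linarith+
      then show "real_of_int n * pi \<le> Im z" "Im z < (real_of_int n + 1) * pi"
        by (simp_all add: pos_le_divide_eq pos_divide_less_eq)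
    qed
    have Im_z0: "Im z0 = Im z - real_of_int n * pi"
      by (simp add: z0_def)
    have "f z0 = 0"
      unfolding z0_def using shift_int(2) that by blast
    then have "z0 \<in> Z0"
      using fl by (simp add: Z0_def Im_z0 algebra_simps)
    moreover have "z = z0 + of_int n * (pi * \<i>)"
      by (simp add: z0_def)
    moreover have "\<bar>real_of_int n\<bar> \<le> norm z + 1"
    proof -
      have "\<bar>Im z / pi\<bar> \<le> \<bar>Im z\<bar>"
        using pi_ge_two by (simp add: abs_divide divide_le_eq mult_le_cancel_left1)
      also have "\<dots> \<le> norm z"
        by (rule abs_Im_le_cmod)
      finally have "\<bar>Im z / pi\<bar> \<le> norm z" .
      moreover have "\<bar>real_of_int n\<bar> \<le> \<bar>Im z / pi\<bar> + 1"
        unfolding n_def by linarith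
      ultimately show ?thesis by linarith
    qed
    ultimately show ?thesis by blast
  qed
  have zorder_le: "zorder f z \<le> W" if z: "f z = 0" for z
  proof -
    obtain z0 n where z0: "z0 \<in> Z0" "z = z0 + of_int n * (pi * \<i>)"
      using decomp[OF z] by blast
    have "zorder f z \<le> \<bar>zorder f z0\<bar>"
      unfolding z0(2) shift_int(1) by simp
    also have "\<dots> \<le> W"
      unfolding W_def using z0(1) finZ0 by (intro member_le_sum) auto
    finally show ?thesis .
  qed
  have W0: "0 \<le> W"
    by (simp add: W_def sum_nonneg)
  have count: "real_of_int (zero_count f r) \<le> real_of_int W * (real (card Z0) * (2 * r + 5))" if r: "1 \<le> r" for r
  proof -
    \<comment> \<open>Covers |n| <= |z| + 1; as N <= r + 2, the range has at most 2 r + 5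
      elements.\<close>
    define N where "N = \<lceil>r\<rceil> + 1"
    define Zr where "Zr = {z. norm z \<le> r \<and> f z = 0}"
    have sub: "Zr \<subseteq> (\<lambda>(z0, n). z0 + of_int n * (pi * \<i>)) ` (Z0 \<times> {- N..N})"
    proof
      fix z assume "z \<in> Zr"
      then have z: "norm z \<le> r" "f z = 0"
        by (auto simp: Zr_def)
      obtain z0 n where z0: "z0 \<in> Z0" "z = z0 + of_int n * (pi * \<i>)" "\<bar>real_of_int n\<bar> \<le> norm z + 1"
        using decomp[OF z(2)] by blast
      have "\<bar>real_of_int n\<bar> \<le> real_of_int N"
        using z0(3) z(1) unfolding N_def by linarith
      then have "n \<in> {- N..N}"
        by auto
      then show "z \<in> (\<lambda>(z0, n). z0 + of_int n * (pi * \<i>)) ` (Z0 \<times> {- N..N})"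
        using z0 by (intro image_eqI[of _ _ "(z0, n)"]) auto
    qed
    have fin: "finite (Z0 \<times> {- N..N})"
      using finZ0 by simp
    have "card Zr \<le> card ((\<lambda>(z0, n). z0 + of_int n * (pi * \<i>)) ` (Z0 \<times> {- N..N}))"
      by (rule card_mono[OF finite_imageI[OF fin] sub])
    also have "\<dots> \<le> card (Z0 \<times> {- N..N})"
      by (rule card_image_le[OF fin])
    also have "\<dots> = card Z0 * card {- N..N}"
      by (rule card_cartesian_product)
    finally have "real (card Zr) \<le> real (card Z0) * real (card {- N..N})"
      unfolding of_nat_mult [symmetric] of_nat_le_iff .
    also have "\<dots> \<le> real (card Z0) * (2 * r + 5)"
    proof (rule mult_left_mono)
      have "0 \<le> N" "real_of_int N \<le> r + 2"
        using r unfolding N_def by linarith+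
      then show "real (card {- N..N}) \<le> 2 * r + 5"
        by simp
    qed simp
    finally have card: "real (card Zr) \<le> real (card Z0) * (2 * r + 5)" .
    have "zero_count f r \<le> of_nat (card Zr) * W"
      unfolding zero_count_def Zr_def by (rule sum_bounded_above) (use zorder_le in auto)
    then have "real_of_int (zero_count f r) \<le> real (card Zr) * real_of_int W"
      by (metis of_int_le_iff of_int_mult of_int_of_nat_eq)
    also have "\<dots> \<le> real (card Z0) * (2 * r + 5) * real_of_int W"
      using card W0 by (intro mult_right_mono) auto
    finally show ?thesis
      by (simp add: mult.commute)
  qed
  \<comment> \<open>2 r + 5 <= 7 r, so the count is at most D r, and at most r^2 once r >= D. Any
    finite bound on the exponent will do.\<close>
  define D where "D = real_of_int W * (real (card Z0) * 7)"
  have f_hol: "f holomorphic_on UNIV"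
    unfolding f by (intro holomorphic_intros) auto
  have "\<exists>w. f w \<noteq> 0"
  proof (rule ccontr)
    assume "\<not> (\<exists>w. f w \<noteq> 0)"
    then have "poly R (exp (- 2 * (- Ln x / 2))) = 0" for x
      using zero_iff by blast
    then have "poly R x = 0" if "x \<noteq> 0" for x
      using that by (metis exp_Ln mult_minus_left mult_minus_right minus_divide_left minus_minus nonzero_mult_div_cancel_left times_divide_eq_right zero_neq_numeral)
    then have "- {0} \<subseteq> {x. poly R x = 0}"
      by auto
    then have "finite (- {0::complex})"
      using poly_roots_finite[OF R0] finite_subset by blast
    then show False
      using infinite_UNIV_char_0[where ?'a = complex] by (simp add: Compl_eq_Diff_UNIV)
  qed
  then obtain w0 where w0: "f w0 \<noteq> 0" ..
  have "Limsup at_top (\<lambda>r::real. ereal (ln (real_of_int (zero_count f r)) / ln r)) \<le> ereal 2"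
  proof (rule Limsup_bounded)
    show "\<forall>\<^sub>F r in at_top. ereal (ln (real_of_int (zero_count f r)) / ln r) \<le> ereal 2"
      using eventually_ge_at_top[of 2] eventually_ge_at_top[of D]
    proof eventually_elim
      case (elim r)
      have "0 \<le> zero_count f r"
        using card_zeros_le_zero_count[OF f_hol w0, of r] by linarith
      moreover have "ln (real_of_int (zero_count f r)) \<le> 2 * ln r" if "0 < zero_count f r"
      proof -
        have "real_of_int (zero_count f r) \<le> real_of_int W * (real (card Z0) * (2 * r + 5))"
          using count[of r] elim by simp
        also have "\<dots> \<le> real_of_int W * (real (card Z0) * (7 * r))"
          using elim W0 by (intro mult_left_mono) auto
        also have "\<dots> = D * r"
          by (simp add: D_def)
        also have "\<dots> \<le> r * r"
          using elim by (intro mult_right_mono) auto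
        also have "\<dots> = r ^ 2"
          by (simp add: power2_eq_square)
        finally have "ln (real_of_int (zero_count f r)) \<le> ln (r ^ 2)"
          using that elim by (subst ln_le_cancel_iff) auto
        then show ?thesis
          using elim by (simp add: ln_realpow)
      qed
      ultimately have "ln (real_of_int (zero_count f r)) \<le> 2 * ln r"
        using elim by (cases "zero_count f r = 0") auto
      then show ?case
        using elim by (simp add: divide_le_eq)
    qed
  qed
  then show ?thesis
    unfolding conv_exponent_def by auto
qed

theorem theorem1p2:
  fixes \<mu> \<nu> \<sigma> A B :: complex and f :: "complex \<Rightarrow> complex"
  assumes "\<sigma> \<noteq> 0"
    and "f holomorphic_on UNIV"
    and "\<And>z. (deriv ^^ 2) f z + (exp (2 * z) - \<nu>\<^sup>2) * f z = \<sigma> * exp ((\<mu> + 1) * z)"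
    and "\<And>z. f z = A * bessel_J \<nu> z + B * bessel_Y \<nu> z + \<sigma> * lommel_S \<mu> \<nu> z"
  shows "conv_exponent f < \<infinity> \<longleftrightarrow>
    A = 0 \<and> B = 0 \<and>
    (\<exists>p::nat. (\<mu> + \<nu> = of_nat (2 * p + 1) \<or> \<mu> - \<nu> = of_nat (2 * p + 1)) \<and>
      (\<forall>w. lommel_S \<mu> \<nu> w =
        exp ((\<mu> - 1) * w) * (\<Sum>k\<le>p. (-1) ^ k * lommel_coeff \<mu> \<nu> k / exp w ^ (2 * k))))"
proof
  assume conv: "conv_exponent f < \<infinity>"
  have f: "bessel_eq \<nu> \<mu> \<sigma> f"
    using assms(2,3) by (simp add: bessel_eq_def)
  \<comment> \<open>f cannot vanish identically, as \<sigma> is not 0.\<close>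
  obtain w where "f w \<noteq> 0"
    using bessel_eq_0_iff[OF f] assms(1) by blast
  then have "few_zeros f"
    by (rule conv_exponent_finite_imp_few_zeros[OF assms(2) _ conv])
  then obtain M Q where Q: "\<And>z. f z = exp ((\<mu> - 1 - 2 * of_nat M) * z) * poly Q (exp (2 * z))"
    using few_zeros_imp_exp_polynomial[OF f assms(1)] by metis
  obtain p :: nat where p: "\<mu> + \<nu> = of_nat (2 * p + 1) \<or> \<mu> - \<nu> = of_nat (2 * p + 1)"
    and f_eq: "\<And>z. f z = \<sigma> * (exp ((\<mu> - 1) * z) * (\<Sum>k\<le>p. (-1) ^ k * lommel_coeff \<mu> \<nu> k / exp z ^ (2 * k)))"
    using exp_polynomial_solution[OF f assms(1) Q] by metis
  \<comment> \<open>For this p the function \<sigma> S is the same finite sum as f, so the Bessel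
    part is identically 0.\<close>
  have "A * bessel_J \<nu> z + B * bessel_Y \<nu> z = 0" for z
    using assms(4)[of z] unfolding f_eq lommel_S_terminating[OF p] by simp
  from bessel_J_Y_independent[OF this] p lommel_S_terminating[OF p]
  show "A = 0 \<and> B = 0 \<and> (\<exists>p::nat. (\<mu> + \<nu> = of_nat (2 * p + 1) \<or> \<mu> - \<nu> = of_nat (2 * p + 1)) \<and>
      (\<forall>w. lommel_S \<mu> \<nu> w =
        exp ((\<mu> - 1) * w) * (\<Sum>k\<le>p. (-1) ^ k * lommel_coeff \<mu> \<nu> k / exp w ^ (2 * k))))"
    by blast
next
  assume "A = 0 \<and> B = 0 \<and> (\<exists>p::nat. (\<mu> + \<nu> = of_nat (2 * p + 1) \<or> \<mu> - \<nu> = of_nat (2 * p + 1)) \<and>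
      (\<forall>w. lommel_S \<mu> \<nu> w =
        exp ((\<mu> - 1) * w) * (\<Sum>k\<le>p. (-1) ^ k * lommel_coeff \<mu> \<nu> k / exp w ^ (2 * k))))"
  then obtain p :: nat where "A = 0" "B = 0"
    and S: "\<And>w. lommel_S \<mu> \<nu> w =
        exp ((\<mu> - 1) * w) * (\<Sum>k\<le>p. (-1) ^ k * lommel_coeff \<mu> \<nu> k / exp w ^ (2 * k))"
    by blast
  then have "f z = \<sigma> * (exp ((\<mu> - 1) * z) * (\<Sum>k\<le>p. (-1) ^ k * lommel_coeff \<mu> \<nu> k / exp z ^ (2 * k)))" for z
    using assms(4)[of z] by simp
  then show "conv_exponent f < \<infinity>"
    by (rule exp_polynomial_conv_exponent) (use assms(1) in \<open>simp_all add: lommel_coeff_def\<close>)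
qed

end
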